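(* Let $J\neq F_n^\infty$ be a WOT-closed two-sided ideal of $F_n^\infty$ and let $T:=[T_1,\ldots,T_n]$, $T_i\in B(\mathcal H)$, and $T':=[T_1',\ldots,T_n']$, $T_i'\in B(\mathcal H')$, be two $J$-constrained pure row contractions. Then $T$ and $T'$ are unitarily equivalent if and only if their constrained characteristic functions $\Theta_{J,T}$ and $\Theta_{J,T'}$ coincide.
   Context: Let $n\in\{1,2,\dots\}$ and let $F^2(H_n)=\bigoplus_{k\ge 0}H_n^{\otimes k}$ be the full Fock space of an $n$-dimensional complex Hilbert space $H_n$ with orthonormal basis $e_1,\dots,e_n$ (with $H_n^{\otimes 0}=\mathbb C1$). Left and right creation operators: $S_i\varphi=e_i\otimes\varphi$, $R_i\varphi=\varphi\otimes e_i$. $F_n^\infty\subset B(F^2(H_n))$ is the WOT-closed algebra generated by $S_1,\dots,S_n$ and the identity. Put $\mathcal N_J=F^2(H_n)\ominus\overline{JF^2(H_n)}$, $B_i=P_{\mathcal N_J}S_i|_{\mathcal N_J}$, $W_i=P_{\mathcal N_J}R_i|_{\mathcal N_J}$. A bounded operator $M:\mathcal N_J\otimes\mathcal K\to\mathcal N_J\otimes\mathcal K'$ is multi-analytic (with respect to $B_1,\dots,B_n$) if $M(B_i\otimes I_{\mathcal K})=(B_i\otimes I_{\mathcal K'})M$, $i=1,\dots,n$. $\mathbb F_n^+$ is the unital free semigroup on $g_1,\dots,g_n$; $|\alpha|$ is the length of $\alpha$; $T_\alpha=T_{i_1}\cdots T_{i_k}$, $e_\alpha=e_{i_1}\otimes\cdots\otimes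 e_{i_k}$ for $\alpha=g_{i_1}\cdots g_{i_k}$. $T$ is a row contraction if $TT^*=\sum_iT_iT_i^*\le I$ ($T$ viewed as an operator $\mathcal H^{(n)}\to\mathcal H$); it is pure if $\text{SOT-}\lim_k\sum_{|\alpha|=k}T_\alpha T_\alpha^*=0$. A pure $T$ is $J$-constrained if $f(T_1,\dots,T_n)=0$ for all $f\in J$, where for $f\in F_n^\infty$ with $f(1)=\sum_\alpha a_\alpha e_\alpha$, $f(T_1,\dots,T_n)=\text{SOT-}\lim_{r\to1}\sum_{k\ge0}\sum_{|\alpha|=k}r^{|\alpha|}a_\alpha T_\alpha$. Set $\Delta_T=(I-TT^* )^{1/2}$, $\Delta_{T^*}=(I-T^*T)^{1/2}\in B(\mathcal H^{(n)})$, $\mathcal D_T=\overline{\Delta_T\mathcal H}$, $\mathcal D_{T^*}=\overline{\Delta_{T^*}\mathcal H^{(n)}}$. $T$ and $T'$ are unitarily equivalent if $T_i=U^*T_i'U$, $i=1,\dots,n$, for some unitary $U:\mathcal H\to\mathcal H'$. The constrained characteristic function $\Theta_{J,T}:\mathcal N_J\otimes\mathcal D_{T^*}\to\mathcal N_J\otimes\mathcal D_T$ is the multi-analytic operator with formal Fourier representation $$-I_{\mathcal N_J}\otimes T+(I_{\mathcal N_J}\otimes\Delta_T)\Big(I-\sum_{i=1}^nW_i\otimes T_i^*\Big)^{-1}[W_1\otimes I_{\mathcal H},\dots,W_n\otimes I_{\mathcal H}](I_{\mathcal N_J}\otimes\Delta_{T^*}),$$ understood as the SOT-limit as $r\to1$,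 $r<1$, of the expressions with each $W_i$ replaced by $rW_i$. Equivalently it is the compression $P_{\mathcal N_J\otimes\mathcal D_T}\Theta_T|_{\mathcal N_J\otimes\mathcal D_{T^*}}$, where $\Theta_T$ on $F^2(H_n)\otimes\mathcal D_{T^*}$ is given by the same formula with $R_i$ in place of $W_i$. Two multi-analytic operators $\Phi:\mathcal N_J\otimes\mathcal K_1\to\mathcal N_J\otimes\mathcal K_2$ and $\Phi':\mathcal N_J\otimes\mathcal K_1'\to\mathcal N_J\otimes\mathcal K_2'$ coincide if there are unitary multi-analytic operators $U_j:\mathcal N_J\otimes\mathcal K_j\to\mathcal N_J\otimes\mathcal K_j'$, $j=1,2$, with $\Phi'U_1=U_2\Phi$. *)

theory Defs
  imports "HOL-Analysis.Analysis"
begin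

section \<open>Complex Hilbert spaces\<close>

text \<open>
  A complex Hilbert space is a complete real inner product space with a compatible complex
  structure: the real inner product is the real part of the complex one, so that norm, topology
  and completeness are those of the library.  The complex inner product is linear in its first
  argument.
\<close>

class chilbert_space = real_inner + complete_space +
  fixes scaleC :: "complex \<Rightarrow> 'a \<Rightarrow> 'a" (infixr \<open>*\<^sub>C\<close> 75)
    and cinner :: "'a \<Rightarrow> 'a \<Rightarrow> complex"
  assumes scaleC_add_right: "c *\<^sub>C (x + y) = c *\<^sub>C x + c *\<^sub>C y"
    and scaleC_add_left: "(c + d) *\<^sub>C x = c *\<^sub>C x + d *\<^sub>C x"
    and scaleC_scaleC: "c *\<^sub>C d *\<^sub>C x = (c * d) *\<^sub>C x"
    and scaleC_of_real: "complex_of_real r *\<^sub>C x = r *\<^sub>R x"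
    and cinner_commute: "cinner x y = cnj (cinner y x)"
    and cinner_add_left: "cinner (x + y) z = cinner x z + cinner y z"
    and cinner_scaleC_left: "cinner (c *\<^sub>C x) y = c * cinner x y"
    and Re_cinner: "Re (cinner x y) = inner x y"

instance chilbert_space \<subseteq> banach ..

lemma norm_scaleC: "norm (c *\<^sub>C (x::'a::chilbert_space)) = cmod c * norm x"
proof -
  have im: "Im (cinner x x) = 0"
    using cinner_commute[of x x] by (simp add: complex_eq_iff)
  have "cinner (c *\<^sub>C x) (c *\<^sub>C x) = (c * cnj c) * cinner x x"
    by (subst cinner_scaleC_left, subst cinner_commute, subst cinner_scaleC_left)
      (simp add: cinner_commute[of x x, symmetric])
  then have "inner (c *\<^sub>C x) (c *\<^sub>C x) = (cmod c)\<^sup>2 * inner x x"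
    by (simp add: Re_cinner[symmetric] complex_norm_square[symmetric] im del: of_real_power)
  then show ?thesis
    by (simp add: norm_eq_sqrt_inner real_sqrt_mult)
qed

lemma cmod_cinner_le: "cmod (cinner x y) \<le> norm x * norm (y::'a::chilbert_space)"
proof (cases "cinner x y = 0")
  case False
  define c where "c = cnj (sgn (cinner x y))"
  have c: "cmod c = 1"
    using False by (simp add: c_def norm_sgn)
  have "c * cinner x y = complex_of_real (cmod (cinner x y))"
    using False
    by (simp add: c_def sgn_div_norm scaleR_conv_of_real complex_norm_square[symmetric]
        mult.commute power2_eq_square field_simps)
  then have "cinner (c *\<^sub>C x) y = complex_of_real (cmod (cinner x y))"
    by (simp add: cinner_scaleC_left)
  then have "cmod (cinner x y) = inner (c *\<^sub>C x) y"
    by (metis Re_complex_of_real Re_cinner)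
  also have "\<dots> \<le> norm (c *\<^sub>C x) * norm y"
    by (rule norm_cauchy_schwarz)
  finally show ?thesis
    by (simp add: norm_scaleC c)
qed simp

instantiation complex :: chilbert_space
begin
definition scaleC_complex :: "complex \<Rightarrow> complex \<Rightarrow> complex" where
  "scaleC_complex c x = c * x"
definition cinner_complex :: "complex \<Rightarrow> complex \<Rightarrow> complex" where
  "cinner_complex x y = x * cnj y"
instance
  by standard
    (auto simp: scaleC_complex_def cinner_complex_def inner_complex_def scaleR_conv_of_real
      algebra_simps)
end

instantiation vec :: (chilbert_space, finite) chilbert_space
begin
definition scaleC_vec :: "complex \<Rightarrow> ('a, 'b) vec \<Rightarrow> ('a, 'b) vec" where
  "scaleC_vec c x = (\<chi> i. c *\<^sub>C (x $ i))"
definition cinner_vec :: "('a, 'b) vec \<Rightarrow> ('a, 'b) vec \<Rightarrow> complex" where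
  "cinner_vec x y = (\<Sum>i\<in>UNIV. cinner (x $ i) (y $ i))"
instance
  by standard
    (auto simp: scaleC_vec_def cinner_vec_def inner_vec_def vec_eq_iff scaleC_add_right
      scaleC_add_left scaleC_scaleC scaleC_of_real cinner_add_left cinner_scaleC_left
      sum.distrib sum_distrib_left Re_cinner intro!: sum.cong cinner_commute)
end

section \<open>Square-summable families\<close>

typedef (overloaded) ('i, 'a) ell2 =
  "{f :: 'i \<Rightarrow> 'a::real_normed_vector. (\<lambda>i. (norm (f i))\<^sup>2) summable_on UNIV}"
  morphisms ell2_nth Abs_ell2
  by (rule exI[of _ "\<lambda>_. 0"]) simp

setup_lifting type_definition_ell2

lemma ell2_nth_summable: "(\<lambda>i. (norm (ell2_nth x i))\<^sup>2) summable_on UNIV"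
  using ell2_nth by blast

lemma ell2_eqI: "(\<And>i. ell2_nth x i = ell2_nth y i) \<Longrightarrow> x = y"
  by (metis ell2_nth_inject ext)

lemma summable_on_le_real:
  fixes f g :: "'i \<Rightarrow> real"
  assumes "g summable_on A" "\<And>i. i \<in> A \<Longrightarrow> 0 \<le> f i" "\<And>i. i \<in> A \<Longrightarrow> f i \<le> g i"
  shows "f summable_on A"
proof (rule nonneg_bdd_above_summable_on)
  show "bdd_above (sum f ` {F. F \<subseteq> A \<and> finite F})"
  proof (rule bdd_aboveI2)
    fix F
    assume "F \<in> {F. F \<subseteq> A \<and> finite F}"
    then have F: "F \<subseteq> A" "finite F"
      by auto
    have "sum f F \<le> sum g F"
      using F assms(3) by (intro sum_mono) blast
    also have "\<dots> \<le> infsum g A"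
      using F assms order_trans by (intro finite_sum_le_infsum) blast+
    finally show "sum f F \<le> infsum g A" .
  qed
qed (use assms in blast)

lemma sq_summable_add:
  fixes f g :: "'i \<Rightarrow> 'a::real_normed_vector"
  assumes "(\<lambda>i. (norm (f i))\<^sup>2) summable_on UNIV" "(\<lambda>i. (norm (g i))\<^sup>2) summable_on UNIV"
  shows "(\<lambda>i. (norm (f i + g i))\<^sup>2) summable_on UNIV"
proof (rule summable_on_le_real)
  show "(\<lambda>i. 2 * ((norm (f i))\<^sup>2 + (norm (g i))\<^sup>2)) summable_on UNIV"
    by (rule summable_on_cmult_right) (rule summable_on_add[OF assms])
  show "(norm (f i + g i))\<^sup>2 \<le> 2 * ((norm (f i))\<^sup>2 + (norm (g i))\<^sup>2)" for i
  proof -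
    have "(norm (f i + g i))\<^sup>2 \<le> (norm (f i) + norm (g i))\<^sup>2"
      by (intro power_mono norm_triangle_ineq) simp
    also have "\<dots> \<le> 2 * ((norm (f i))\<^sup>2 + (norm (g i))\<^sup>2)"
      using sum_squares_bound[of "norm (f i)" "norm (g i)"] by (simp add: power2_sum)
    finally show ?thesis .
  qed
qed auto

lemma sq_summable_scale:
  fixes f :: "'i \<Rightarrow> 'a::real_normed_vector"
  assumes "(\<lambda>i. (norm (f i))\<^sup>2) summable_on UNIV" "\<And>i. norm (g i) = c * norm (f i)"
  shows "(\<lambda>i. (norm (g i))\<^sup>2) summable_on UNIV"
  using summable_on_cmult_right[OF assms(1), of "c\<^sup>2"] by (simp add: assms(2) power_mult_distrib)

instantiation ell2 :: (type, real_normed_vector) real_vector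
begin
lift_definition zero_ell2 :: "('a, 'b) ell2" is "\<lambda>_. 0" by simp
lift_definition plus_ell2 :: "('a, 'b) ell2 \<Rightarrow> ('a, 'b) ell2 \<Rightarrow> ('a, 'b) ell2"
  is "\<lambda>f g i. f i + g i" by (rule sq_summable_add)
lift_definition uminus_ell2 :: "('a, 'b) ell2 \<Rightarrow> ('a, 'b) ell2" is "\<lambda>f i. - f i" by simp
definition minus_ell2 :: "('a, 'b) ell2 \<Rightarrow> ('a, 'b) ell2 \<Rightarrow> ('a, 'b) ell2" where
  "minus_ell2 x y = x + - y"
lift_definition scaleR_ell2 :: "real \<Rightarrow> ('a, 'b) ell2 \<Rightarrow> ('a, 'b) ell2"
  is "\<lambda>r f i. r *\<^sub>R f i" by (rule sq_summable_scale) auto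
instance
  by standard
    (rule ell2_eqI, simp add: minus_ell2_def zero_ell2.rep_eq plus_ell2.rep_eq
      uminus_ell2.rep_eq scaleR_ell2.rep_eq scaleR_add_right scaleR_add_left add_ac)+
end

lemmas ell2_nth_simps [simp] =
  zero_ell2.rep_eq plus_ell2.rep_eq uminus_ell2.rep_eq scaleR_ell2.rep_eq

lemma ell2_nth_minus [simp]: "ell2_nth (x - y) i = ell2_nth x i - ell2_nth y i"
  by (simp add: minus_ell2_def del: add_uminus_conv_diff)

lemma sq_summable_prod_abs:
  fixes x :: "('i, 'a::real_normed_vector) ell2" and y :: "('i, 'b::real_normed_vector) ell2"
  assumes "\<And>i. norm (h i) \<le> norm (ell2_nth x i) * norm (ell2_nth y i)"
  shows "(\<lambda>i. norm (h i)) summable_on UNIV"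
proof (rule summable_on_le_real)
  show "(\<lambda>i. (norm (ell2_nth x i))\<^sup>2 + (norm (ell2_nth y i))\<^sup>2) summable_on UNIV"
    by (rule summable_on_add[OF ell2_nth_summable ell2_nth_summable])
  fix i
  have "norm (ell2_nth x i) * norm (ell2_nth y i)
      \<le> (norm (ell2_nth x i))\<^sup>2 + (norm (ell2_nth y i))\<^sup>2"
    using sum_squares_bound[of "norm (ell2_nth x i)" "norm (ell2_nth y i)"]
      mult_nonneg_nonneg[OF norm_ge_zero[of "ell2_nth x i"] norm_ge_zero[of "ell2_nth y i"]]
    by linarith
  then show "norm (h i) \<le> (norm (ell2_nth x i))\<^sup>2 + (norm (ell2_nth y i))\<^sup>2"
    by (rule order_trans[OF assms])
qed simp

lemma inner_ell2_summable:
  fixes x y :: "('i, 'a::real_inner) ell2"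
  shows "(\<lambda>i. inner (ell2_nth x i) (ell2_nth y i)) summable_on UNIV"
  by (rule abs_summable_summable, rule sq_summable_prod_abs[of _ x y])
    (simp add: Cauchy_Schwarz_ineq2)

instantiation ell2 :: (type, real_inner) real_inner
begin
definition inner_ell2 :: "('a, 'b) ell2 \<Rightarrow> ('a, 'b) ell2 \<Rightarrow> real" where
  "inner_ell2 x y = (\<Sum>\<^sub>\<infinity>i. inner (ell2_nth x i) (ell2_nth y i))"
definition norm_ell2 :: "('a, 'b) ell2 \<Rightarrow> real" where
  "norm_ell2 x = sqrt (\<Sum>\<^sub>\<infinity>i. (norm (ell2_nth x i))\<^sup>2)"
definition sgn_ell2 :: "('a, 'b) ell2 \<Rightarrow> ('a, 'b) ell2" where
  "sgn_ell2 x = x /\<^sub>R norm x"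
definition dist_ell2 :: "('a, 'b) ell2 \<Rightarrow> ('a, 'b) ell2 \<Rightarrow> real" where
  "dist_ell2 x y = norm (x - y)"
definition uniformity_ell2 :: "(('a, 'b) ell2 \<times> ('a, 'b) ell2) filter" where
  "uniformity_ell2 = (INF e\<in>{0 <..}. principal {(x, y). dist x y < e})"
definition open_ell2 :: "('a, 'b) ell2 set \<Rightarrow> bool" where
  "open_ell2 U \<longleftrightarrow> (\<forall>x\<in>U. eventually (\<lambda>(x', y). x' = x \<longrightarrow> y \<in> U) uniformity)"
instance
proof
  fix x y z :: "('a, 'b) ell2" and r :: real
  show "inner x y = inner y x"
    by (simp add: inner_ell2_def inner_commute)
  show "inner (x + y) z = inner x z + inner y z"
    by (simp add: inner_ell2_def inner_add_left infsum_add inner_ell2_summable)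
  show "inner (r *\<^sub>R x) y = r * inner x y"
    by (simp add: inner_ell2_def infsum_cmult_right')
  show "0 \<le> inner x x"
    by (simp add: inner_ell2_def infsum_nonneg)
  show "norm x = sqrt (inner x x)"
    by (simp add: inner_ell2_def norm_ell2_def power2_norm_eq_inner)
  show "inner x x = 0 \<longleftrightarrow> x = 0"
  proof
    assume "inner x x = 0"
    then have "inner (ell2_nth x i) (ell2_nth x i) = 0" for i
      using nonneg_infsum_le_0D[of "\<lambda>i. inner (ell2_nth x i) (ell2_nth x i)" UNIV i]
        inner_ell2_summable[of x x]
      by (simp add: inner_ell2_def)
    then show "x = 0"
      by (intro ell2_eqI) simp
  qed (simp add: inner_ell2_def)
qed (simp_all add: sgn_ell2_def dist_ell2_def uniformity_ell2_def open_ell2_def)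
end

lemma sum_ell2_le:
  assumes "finite F"
  shows "(\<Sum>i\<in>F. (norm (ell2_nth x i))\<^sup>2) \<le> (norm (x::('i, 'a::real_inner) ell2))\<^sup>2"
proof -
  have "(\<Sum>i\<in>F. (norm (ell2_nth x i))\<^sup>2) \<le> (\<Sum>\<^sub>\<infinity>i. (norm (ell2_nth x i))\<^sup>2)"
    by (rule finite_sum_le_infsum[OF ell2_nth_summable assms]) auto
  also have "\<dots> = (norm x)\<^sup>2"
    unfolding norm_ell2_def by (rule real_sqrt_pow2[symmetric], rule infsum_nonneg) simp
  finally show ?thesis .
qed

lemma Cauchy_ell2_convergent:
  fixes X :: "nat \<Rightarrow> ('i, 'a::{real_inner, complete_space}) ell2"
  assumes X: "Cauchy X"
  shows "convergent X"
proof -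
  have "Cauchy (\<lambda>n. ell2_nth (X n) i)" for i
  proof (rule CauchyI)
    fix e :: real
    assume "0 < e"
    from CauchyD[OF X this]
    obtain M where M: "\<forall>m\<ge>M. \<forall>n\<ge>M. norm (X m - X n) < e" ..
    have le: "norm (ell2_nth (X m) i - ell2_nth (X n) i) \<le> norm (X m - X n)" for m n
      using sum_ell2_le[of "{i}" "X m - X n"]
      by (intro power2_le_imp_le[OF _ norm_ge_zero]) simp
    show "\<exists>M. \<forall>m\<ge>M. \<forall>n\<ge>M. norm (ell2_nth (X m) i - ell2_nth (X n) i) < e"
      by (rule exI[of _ M]) (auto intro: le_less_trans[OF le] simp: M)
  qed
  then have "\<exists>f. \<forall>i. (\<lambda>n. ell2_nth (X n) i) \<longlonglongrightarrow> f i"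
    unfolding Cauchy_convergent_iff convergent_def by (intro choice allI)
  then obtain f where f: "\<And>i. (\<lambda>n. ell2_nth (X n) i) \<longlonglongrightarrow> f i"
    by blast
  have fin: "(\<Sum>i\<in>F. (norm (ell2_nth (X m) i - f i))\<^sup>2) \<le> e\<^sup>2"
    if "\<forall>m\<ge>M. \<forall>n\<ge>M. norm (X m - X n) < e" "M \<le> m" "finite F" for M m F e
  proof (rule tendsto_upperbound)
    show "(\<lambda>n. \<Sum>i\<in>F. (norm (ell2_nth (X m) i - ell2_nth (X n) i))\<^sup>2)
        \<longlonglongrightarrow> (\<Sum>i\<in>F. (norm (ell2_nth (X m) i - f i))\<^sup>2)"
      by (intro tendsto_intros f)
    show "\<forall>\<^sub>F n in sequentially.
        (\<Sum>i\<in>F. (norm (ell2_nth (X m) i - ell2_nth (X n) i))\<^sup>2) \<le> e\<^sup>2"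
    proof (rule eventually_sequentiallyI)
      fix n
      assume "M \<le> n"
      then have "norm (X m - X n) < e"
        using that by blast
      then have "(norm (X m - X n))\<^sup>2 \<le> e\<^sup>2"
        by (intro power_mono) auto
      then show "(\<Sum>i\<in>F. (norm (ell2_nth (X m) i - ell2_nth (X n) i))\<^sup>2) \<le> e\<^sup>2"
        using sum_ell2_le[OF that(3), of "X m - X n"] by simp
    qed
  qed simp
  have summ: "(\<lambda>i. (norm (ell2_nth (X m) i - f i))\<^sup>2) summable_on UNIV"
    if "\<forall>m\<ge>M. \<forall>n\<ge>M. norm (X m - X n) < e" "M \<le> m" for M m e
    by (rule nonneg_bdd_above_summable_on)
      (use fin[OF that] in \<open>auto intro!: bdd_aboveI2[of _ _ "e\<^sup>2"]\<close>)
  obtain M0 where M0: "\<forall>m\<ge>M0. \<forall>n\<ge>M0. norm (X m - X n) < 1"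
    using CauchyD[OF X, of 1] by auto
  have "(\<lambda>i. (norm (ell2_nth (X M0) i + - (ell2_nth (X M0) i - f i)))\<^sup>2) summable_on UNIV"
    by (rule sq_summable_add[OF ell2_nth_summable])
      (use summ[OF M0 order_refl] in \<open>simp add: norm_minus_commute\<close>)
  then have fsum: "(\<lambda>i. (norm (f i))\<^sup>2) summable_on UNIV"
    by simp
  define L where "L = Abs_ell2 f"
  have L: "ell2_nth L = f"
    using fsum by (simp add: L_def Abs_ell2_inverse)
  have "X \<longlonglongrightarrow> L"
  proof (rule LIMSEQ_I)
    fix r :: real
    assume "0 < r"
    then obtain M where M: "\<forall>m\<ge>M. \<forall>n\<ge>M. norm (X m - X n) < r / 2"
      using CauchyD[OF X, of "r / 2"] by auto
    have "norm (X m - L) < r" if "M \<le> m" for m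
    proof -
      have "(\<Sum>\<^sub>\<infinity>i. (norm (ell2_nth (X m - L) i))\<^sup>2) \<le> (r / 2)\<^sup>2"
        by (rule infsum_le_finite_sums[OF ell2_nth_summable])
          (use fin[OF M that] in \<open>simp add: L\<close>)
      then have "norm (X m - L) \<le> r / 2"
        unfolding norm_ell2_def using \<open>0 < r\<close> by (intro real_le_lsqrt) simp_all
      then show ?thesis
        using \<open>0 < r\<close> by simp
    qed
    then show "\<exists>M. \<forall>m\<ge>M. norm (X m - L) < r"
      by blast
  qed
  then show "convergent X"
    by (auto simp: convergent_def)
qed

instance ell2 :: (type, "{real_inner, complete_space}") complete_space
  by standard (rule Cauchy_ell2_convergent)

lemma cinner_ell2_summable:
  fixes x y :: "('i, 'a::chilbert_space) ell2"
  shows "(\<lambda>i. cinner (ell2_nth x i) (ell2_nth y i)) summable_on UNIV"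
  by (rule abs_summable_summable, rule sq_summable_prod_abs[of _ x y]) (simp add: cmod_cinner_le)

instantiation ell2 :: (type, chilbert_space) chilbert_space
begin
lift_definition scaleC_ell2 :: "complex \<Rightarrow> ('a, 'b) ell2 \<Rightarrow> ('a, 'b) ell2"
  is "\<lambda>c f i. c *\<^sub>C f i" by (rule sq_summable_scale) (auto simp: norm_scaleC)
definition cinner_ell2 :: "('a, 'b) ell2 \<Rightarrow> ('a, 'b) ell2 \<Rightarrow> complex" where
  "cinner_ell2 x y = (\<Sum>\<^sub>\<infinity>i. cinner (ell2_nth x i) (ell2_nth y i))"
instance
proof
  fix x y z :: "('a, 'b) ell2" and c d :: complex and r :: real
  show "c *\<^sub>C (x + y) = c *\<^sub>C x + c *\<^sub>C y"
    by (rule ell2_eqI) (simp add: scaleC_ell2.rep_eq scaleC_add_right)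
  show "(c + d) *\<^sub>C x = c *\<^sub>C x + d *\<^sub>C x"
    by (rule ell2_eqI) (simp add: scaleC_ell2.rep_eq scaleC_add_left)
  show "c *\<^sub>C d *\<^sub>C x = (c * d) *\<^sub>C x"
    by (rule ell2_eqI) (simp add: scaleC_ell2.rep_eq scaleC_scaleC)
  show "complex_of_real r *\<^sub>C x = r *\<^sub>R x"
    by (rule ell2_eqI) (simp add: scaleC_ell2.rep_eq scaleC_of_real)
  show "cinner x y = cnj (cinner y x)"
    by (simp add: cinner_ell2_def infsum_cnj[symmetric] cinner_commute[symmetric])
  show "cinner (x + y) z = cinner x z + cinner y z"
    by (simp add: cinner_ell2_def cinner_add_left infsum_add cinner_ell2_summable)
  show "cinner (c *\<^sub>C x) y = c * cinner x y"
    by (simp add: cinner_ell2_def scaleC_ell2.rep_eq cinner_scaleC_left infsum_cmult_right')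
  show "Re (cinner x y) = inner x y"
    by (simp add: cinner_ell2_def inner_ell2_def infsum_Re[OF cinner_ell2_summable, symmetric]
        Re_cinner)
qed
end

section \<open>Operators between closed subspaces\<close>

definition csubspace :: "'a::chilbert_space set \<Rightarrow> bool" where
  "csubspace V \<longleftrightarrow> 0 \<in> V \<and> (\<forall>x\<in>V. \<forall>y\<in>V. x + y \<in> V) \<and> (\<forall>c. \<forall>x\<in>V. c *\<^sub>C x \<in> V)"

definition ccspan :: "'a::chilbert_space set \<Rightarrow> 'a set" where
  "ccspan A = closure (csubspace hull A)"

definition ortho_compl :: "'a::chilbert_space set \<Rightarrow> 'a set" where
  "ortho_compl A = {x. \<forall>y\<in>A. cinner x y = 0}"

text \<open>
  Operators are total functions; an operator on a subspace is determined by its values there and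
  nothing is required of it elsewhere.
\<close>

definition bounded_op :: "'a::chilbert_space set \<Rightarrow> 'b::chilbert_space set \<Rightarrow> ('a \<Rightarrow> 'b) \<Rightarrow> bool" where
  "bounded_op V W f \<longleftrightarrow>
     f ` V \<subseteq> W \<and> (\<forall>x\<in>V. \<forall>y\<in>V. f (x + y) = f x + f y) \<and>
     (\<forall>c. \<forall>x\<in>V. f (c *\<^sub>C x) = c *\<^sub>C f x) \<and> (\<exists>K. \<forall>x\<in>V. norm (f x) \<le> K * norm x)"

abbreviation bounded_ops :: "('a::chilbert_space \<Rightarrow> 'b::chilbert_space) set" where
  "bounded_ops \<equiv> {f. bounded_op UNIV UNIV f}"

definition unitary_op :: "'a::chilbert_space set \<Rightarrow> 'b::chilbert_space set \<Rightarrow> ('a \<Rightarrow> 'b) \<Rightarrow> bool" where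
  "unitary_op V W U \<longleftrightarrow>
     bounded_op V W U \<and> U ` V = W \<and> (\<forall>x\<in>V. \<forall>y\<in>V. cinner (U x) (U y) = cinner x y)"

definition proj :: "'a::chilbert_space set \<Rightarrow> 'a \<Rightarrow> 'a" where
  "proj V x = (THE p. p \<in> V \<and> x - p \<in> ortho_compl V)"

definition adj :: "('a::chilbert_space \<Rightarrow> 'b::chilbert_space) \<Rightarrow> 'b \<Rightarrow> 'a" where
  "adj A = (THE B. \<forall>x y. cinner (A x) y = cinner x (B y))"

definition positive_op :: "('a::chilbert_space \<Rightarrow> 'a) \<Rightarrow> bool" where
  "positive_op A \<longleftrightarrow>
     bounded_op UNIV UNIV A \<and> (\<forall>x. Im (cinner (A x) x) = 0 \<and> 0 \<le> Re (cinner (A x) x))"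

definition sqrt_op :: "('a::chilbert_space \<Rightarrow> 'a) \<Rightarrow> 'a \<Rightarrow> 'a" where
  "sqrt_op A = (THE B. positive_op B \<and> B \<circ> B = A)"

definition wot :: "('a::chilbert_space \<Rightarrow> 'b::chilbert_space) topology" where
  "wot = pullback_topology bounded_ops (\<lambda>A (x, y). cinner (A x) y) euclidean"

section \<open>The full Fock space\<close>

text \<open>
  The letters of the free semigroup are indexed by a finite type \<open>'n\<close> (so \<open>n = CARD('n) \<ge> 1\<close>),
  and its elements are words, that is lists.  Since the words of length \<open>k\<close> index the orthonormal
  basis \<open>e\<^sub>\<alpha>\<close> of the \<open>k\<close>-th tensor power of the \<open>n\<close>-dimensional space, the Fock space is
  the space of square-summable families over all words, and its tensor product with a Hilbert
  space \<open>'a\<close> is the space of square-summable \<open>'a\<close>-valued families.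
\<close>

type_synonym ('n, 'a) fock_tensor = "('n list, 'a) ell2"
type_synonym 'n fock = "('n, complex) fock_tensor"

lemma sq_summable_single: "(\<lambda>w. (norm (if w = v then x else 0))\<^sup>2) summable_on UNIV"
proof -
  have "(\<lambda>w. (norm (if w = v then x else 0))\<^sup>2) summable_on {v}"
    by simp
  then show ?thesis
    by (rule iffD1[OF summable_on_cong_neutral, rotated -1]) auto
qed

lift_definition basis_vec :: "'n list \<Rightarrow> 'n fock" is "\<lambda>v w. if w = v then 1 else 0"
  by (rule sq_summable_single)

lift_definition tensor_vec ::
  "'n fock \<Rightarrow> 'a::chilbert_space \<Rightarrow> ('n, 'a) fock_tensor" is "\<lambda>\<phi> k w. \<phi> w *\<^sub>C k"
  by (rule sq_summable_scale) (auto simp: norm_scaleC mult.commute)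

lemma sq_summable_inj_shift:
  fixes \<phi> :: "'i \<Rightarrow> 'a::real_normed_vector"
  assumes "(\<lambda>v. (norm (\<phi> v))\<^sup>2) summable_on UNIV" "inj g"
  shows "(\<lambda>w. (norm (if w \<in> range g then \<phi> (inv g w) else 0))\<^sup>2) summable_on UNIV"
proof -
  have "(\<lambda>w. (norm (\<phi> (inv g w)))\<^sup>2) summable_on range g"
    using assms by (simp add: summable_on_reindex o_def)
  then show ?thesis
    by (rule iffD1[OF summable_on_cong_neutral, rotated -1]) auto
qed

lift_definition left_creation :: "'n \<Rightarrow> 'n fock \<Rightarrow> 'n fock"
  is "\<lambda>i \<phi> w. if w \<noteq> [] \<and> hd w = i then \<phi> (tl w) else 0"
  subgoal for i \<phi>
  proof -
    assume \<phi>: "(\<lambda>v. (norm (\<phi> v))\<^sup>2) summable_on UNIV"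
    have inj: "inj (\<lambda>v. i # v)"
      by (simp add: inj_def)
    have "(if w \<in> range (\<lambda>v. i # v) then \<phi> (inv (\<lambda>v. i # v) w) else 0)
        = (if w \<noteq> [] \<and> hd w = i then \<phi> (tl w) else 0)" for w
      using inv_f_f[OF inj] by (cases w) auto
    then show ?thesis
      using sq_summable_inj_shift[OF \<phi> inj] by simp
  qed
  done

lift_definition right_creation :: "'n \<Rightarrow> 'n fock \<Rightarrow> 'n fock"
  is "\<lambda>i \<phi> w. if w \<noteq> [] \<and> last w = i then \<phi> (butlast w) else 0"
  subgoal for i \<phi>
  proof -
    assume \<phi>: "(\<lambda>v. (norm (\<phi> v))\<^sup>2) summable_on UNIV"
    have inj: "inj (\<lambda>v. v @ [i])"
      by (simp add: inj_def)
    have "(if w \<in> range (\<lambda>v. v @ [i]) then \<phi> (inv (\<lambda>v. v @ [i]) w) else 0)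
        = (if w \<noteq> [] \<and> last w = i then \<phi> (butlast w) else 0)" for w
      using inv_f_f[OF inj] by (cases w rule: rev_cases) auto
    then show ?thesis
      using sq_summable_inj_shift[OF \<phi> inj] by simp
  qed
  done

lemma left_creation_basis_vec: "left_creation i (basis_vec w) = basis_vec (i # w)"
proof (rule ell2_eqI)
  show "ell2_nth (left_creation i (basis_vec w)) v = ell2_nth (basis_vec (i # w)) v" for v
    by (cases v) (auto simp: left_creation.rep_eq basis_vec.rep_eq)
qed

lemma right_creation_basis_vec: "right_creation i (basis_vec w) = basis_vec (w @ [i])"
proof (rule ell2_eqI)
  show "ell2_nth (right_creation i (basis_vec w)) v = ell2_nth (basis_vec (w @ [i])) v" for v
    by (cases v rule: rev_cases) (auto simp: right_creation.rep_eq basis_vec.rep_eq)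
qed

definition op_algebra :: "('a::chilbert_space \<Rightarrow> 'a) set \<Rightarrow> bool" where
  "op_algebra \<A> \<longleftrightarrow> \<A> \<subseteq> bounded_ops \<and> (\<lambda>_. 0) \<in> \<A> \<and>
     (\<forall>f\<in>\<A>. \<forall>g\<in>\<A>. (\<lambda>x. f x + g x) \<in> \<A> \<and> f \<circ> g \<in> \<A>) \<and>
     (\<forall>c. \<forall>f\<in>\<A>. (\<lambda>x. c *\<^sub>C f x) \<in> \<A>)"

definition F_infty :: "('n fock \<Rightarrow> 'n fock) set" where
  "F_infty = (\<lambda>\<A>. op_algebra \<A> \<and> closedin wot \<A>) hull (insert id (range left_creation))"

definition two_sided_ideal :: "('n fock \<Rightarrow> 'n fock) set \<Rightarrow> bool" where
  "two_sided_ideal J \<longleftrightarrow> J \<subseteq> F_infty \<and> (\<lambda>_. 0) \<in> J \<and>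
     (\<forall>f\<in>J. \<forall>g\<in>J. (\<lambda>x. f x + g x) \<in> J) \<and> (\<forall>c. \<forall>f\<in>J. (\<lambda>x. c *\<^sub>C f x) \<in> J) \<and>
     (\<forall>f\<in>J. \<forall>g\<in>F_infty. f \<circ> g \<in> J \<and> g \<circ> f \<in> J)"

definition N_space :: "('n fock \<Rightarrow> 'n fock) set \<Rightarrow> 'n fock set" where
  "N_space J = ortho_compl (ccspan {f \<phi> | f \<phi>. f \<in> J})"

definition B_op :: "('n fock \<Rightarrow> 'n fock) set \<Rightarrow> 'n \<Rightarrow> 'n fock \<Rightarrow> 'n fock" where
  "B_op J i \<phi> = proj (N_space J) (left_creation i \<phi>)"

definition W_op :: "('n fock \<Rightarrow> 'n fock) set \<Rightarrow> 'n \<Rightarrow> 'n fock \<Rightarrow> 'n fock" where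
  "W_op J i \<phi> = proj (N_space J) (right_creation i \<phi>)"

section \<open>Tensor products and multi-analytic operators\<close>

definition tensor_space ::
  "'n fock set \<Rightarrow> 'a::chilbert_space set \<Rightarrow> ('n, 'a) fock_tensor set" where
  "tensor_space N K = ccspan {tensor_vec \<phi> k | \<phi> k. \<phi> \<in> N \<and> k \<in> K}"

text \<open>
  For bounded \<open>X\<close> on \<open>N\<close> and \<open>Y\<close> on \<open>K\<close>, the operator \<open>X \<otimes> Y\<close> on
  \<open>N \<otimes> K\<close> is the bounded operator acting as expected on elementary tensors.  It is
  unique on \<open>tensor_space N K\<close>; the values chosen outside this space are irrelevant.
\<close>

definition tensor_op ::
  "'n fock set \<Rightarrow> 'a::chilbert_space set \<Rightarrow> ('n fock \<Rightarrow> 'n fock) \<Rightarrow>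
   ('a \<Rightarrow> 'b::chilbert_space) \<Rightarrow> ('n, 'a) fock_tensor \<Rightarrow> ('n, 'b) fock_tensor" where
  "tensor_op N K X Y = (SOME Z. bounded_op (tensor_space N K) UNIV Z \<and>
     (\<forall>\<phi>\<in>N. \<forall>k\<in>K. Z (tensor_vec \<phi> k) = tensor_vec (X \<phi>) (Y k)))"

definition multi_analytic ::
  "('n fock \<Rightarrow> 'n fock) set \<Rightarrow> 'a::chilbert_space set \<Rightarrow> 'b::chilbert_space set \<Rightarrow>
   (('n, 'a) fock_tensor \<Rightarrow> ('n, 'b) fock_tensor) \<Rightarrow> bool" where
  "multi_analytic J K K' M \<longleftrightarrow>
     bounded_op (tensor_space (N_space J) K) (tensor_space (N_space J) K') M \<and>
     (\<forall>i. \<forall>x\<in>tensor_space (N_space J) K.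
        M (tensor_op (N_space J) K (B_op J i) id x) =
        tensor_op (N_space J) K' (B_op J i) id (M x))"

definition coincide ::
  "('n fock \<Rightarrow> 'n fock) set \<Rightarrow>
   'a::chilbert_space set \<Rightarrow> 'b::chilbert_space set \<Rightarrow>
   (('n, 'a) fock_tensor \<Rightarrow> ('n, 'b) fock_tensor) \<Rightarrow>
   'c::chilbert_space set \<Rightarrow> 'd::chilbert_space set \<Rightarrow>
   (('n, 'c) fock_tensor \<Rightarrow> ('n, 'd) fock_tensor) \<Rightarrow> bool" where
  "coincide J K\<^sub>1 K\<^sub>2 \<Phi> K\<^sub>1' K\<^sub>2' \<Phi>' \<longleftrightarrow>
     (\<exists>U\<^sub>1 U\<^sub>2. multi_analytic J K\<^sub>1 K\<^sub>1' U\<^sub>1 \<and> multi_analytic J K\<^sub>2 K\<^sub>2' U\<^sub>2 \<and>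
        unitary_op (tensor_space (N_space J) K\<^sub>1) (tensor_space (N_space J) K\<^sub>1') U\<^sub>1 \<and>
        unitary_op (tensor_space (N_space J) K\<^sub>2) (tensor_space (N_space J) K\<^sub>2') U\<^sub>2 \<and>
        (\<forall>x\<in>tensor_space (N_space J) K\<^sub>1. \<Phi>' (U\<^sub>1 x) = U\<^sub>2 (\<Phi> x)))"

section \<open>Constrained row contractions\<close>

definition word_op :: "('n \<Rightarrow> 'h \<Rightarrow> 'h) \<Rightarrow> 'n list \<Rightarrow> 'h \<Rightarrow> 'h" where
  "word_op T w = foldr (\<lambda>i f. T i \<circ> f) w id"

definition row_op :: "('n::finite \<Rightarrow> 'h::chilbert_space \<Rightarrow> 'h) \<Rightarrow> 'h ^ 'n \<Rightarrow> 'h" where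
  "row_op T x = (\<Sum>i\<in>UNIV. T i (x $ i))"

definition row_contraction :: "('n::finite \<Rightarrow> 'h::chilbert_space \<Rightarrow> 'h) \<Rightarrow> bool" where
  "row_contraction T \<longleftrightarrow> (\<forall>i. T i \<in> bounded_ops) \<and>
     positive_op (\<lambda>x. x - row_op T (adj (row_op T) x))"

definition pure :: "('n::finite \<Rightarrow> 'h::chilbert_space \<Rightarrow> 'h) \<Rightarrow> bool" where
  "pure T \<longleftrightarrow>
     (\<forall>x. (\<lambda>k. \<Sum>w | length w = k. word_op T w (adj (word_op T w) x)) \<longlonglongrightarrow> 0)"

definition func_calc ::
  "('n::finite fock \<Rightarrow> 'n fock) \<Rightarrow> ('n \<Rightarrow> 'h::chilbert_space \<Rightarrow> 'h) \<Rightarrow> 'h \<Rightarrow> 'h" where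
  "func_calc f T x = Lim (at_left 1) (\<lambda>r::real. \<Sum>k. \<Sum>w | length w = k.
     (complex_of_real r ^ length w * ell2_nth (f (basis_vec [])) w) *\<^sub>C word_op T w x)"

definition constrained ::
  "('n::finite fock \<Rightarrow> 'n fock) set \<Rightarrow> ('n \<Rightarrow> 'h::chilbert_space \<Rightarrow> 'h) \<Rightarrow> bool" where
  "constrained J T \<longleftrightarrow> (\<forall>f\<in>J. func_calc f T = (\<lambda>_. 0))"

definition unitarily_equivalent ::
  "('n \<Rightarrow> 'h::chilbert_space \<Rightarrow> 'h) \<Rightarrow> ('n \<Rightarrow> 'k::chilbert_space \<Rightarrow> 'k) \<Rightarrow> bool" where
  "unitarily_equivalent T T' \<longleftrightarrow>
     (\<exists>U. unitary_op UNIV UNIV U \<and> (\<forall>i. T i = adj U \<circ> T' i \<circ> U))"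

section \<open>The constrained characteristic function\<close>

definition defect :: "('n::finite \<Rightarrow> 'h::chilbert_space \<Rightarrow> 'h) \<Rightarrow> 'h \<Rightarrow> 'h" where
  "defect T = sqrt_op (\<lambda>x. x - row_op T (adj (row_op T) x))"

definition defect_star :: "('n::finite \<Rightarrow> 'h::chilbert_space \<Rightarrow> 'h) \<Rightarrow> 'h ^ 'n \<Rightarrow> 'h ^ 'n" where
  "defect_star T = sqrt_op (\<lambda>x. x - adj (row_op T) (row_op T x))"

definition defect_space :: "('n::finite \<Rightarrow> 'h::chilbert_space \<Rightarrow> 'h) \<Rightarrow> 'h set" where
  "defect_space T = closure (range (defect T))"

definition defect_star_space :: "('n::finite \<Rightarrow> 'h::chilbert_space \<Rightarrow> 'h) \<Rightarrow> ('h ^ 'n) set" where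
  "defect_star_space T = closure (range (defect_star T))"

text \<open>
  In the row operator \<open>[r W\<^sub>1 \<otimes> I, \<dots>, r W\<^sub>n \<otimes> I]\<close> the identification of
  \<open>N \<otimes> H\<^sup>n\<close> with \<open>(N \<otimes> H)\<^sup>n\<close> is made by tensoring \<open>W\<^sub>i\<close> with the \<open>i\<close>-th
  coordinate map.
\<close>

definition char_fun_r ::
  "('n::finite fock \<Rightarrow> 'n fock) set \<Rightarrow> ('n \<Rightarrow> 'h::chilbert_space \<Rightarrow> 'h) \<Rightarrow> real \<Rightarrow>
   ('n, 'h ^ 'n) fock_tensor \<Rightarrow> ('n, 'h) fock_tensor" where
  "char_fun_r J T r x =
    (let N = N_space J;
         R = (\<lambda>y. \<Sum>i\<in>UNIV. tensor_op N UNIV (\<lambda>\<phi>. r *\<^sub>R W_op J i \<phi>) (\<lambda>h. h $ i) y);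
         A = (\<lambda>z. z - (\<Sum>i\<in>UNIV. tensor_op N UNIV (\<lambda>\<phi>. r *\<^sub>R W_op J i \<phi>) (adj (T i)) z))
     in - tensor_op N (defect_star_space T) id (row_op T) x
        + tensor_op N UNIV id (defect T)
            (inv_into (tensor_space N UNIV) A
              (R (tensor_op N (defect_star_space T) id (defect_star T) x))))"

definition char_fun ::
  "('n::finite fock \<Rightarrow> 'n fock) set \<Rightarrow> ('n \<Rightarrow> 'h::chilbert_space \<Rightarrow> 'h) \<Rightarrow>
   ('n, 'h ^ 'n) fock_tensor \<Rightarrow> ('n, 'h) fock_tensor" where
  "char_fun J T x = Lim (at_left 1) (\<lambda>r. char_fun_r J T r x)"

end

(*
  For a row contraction T the Julia operator with rows (T^*, D_star) and (D, -T), built from the two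
  defect operators D and D_star, is unitary.  Running it as a linear system along the words of the
  free semigroup, with an initial state h in H and an input x in F^2 tensor H^n, produces an output
  K h + Theta x, where K is the Poisson kernel and Theta the characteristic function of T.
  Conservation of energy and purity make (h, x) |-> K h + Theta x an isometry, and its restriction to
  inputs with values in the defect space of T^* is onto F^2 tensor (the defect space of T).  Hence
  the range of K is the orthogonal complement of the range of Theta.

  If T is J-constrained, K maps into the constrained space N tensor (the defect space of T), and there
  its range is the orthogonal complement of the range of the constrained characteristic function.
  Since K intertwines T_i^* with the backward shifts, T is recovered up to unitary equivalence from
  the constrained characteristic function.
*)
theory Submission
  imports Defs
begin

section \<open>Hilbert space preliminaries\<close>

text \<open>The unitary \<open>U\<^sub>2\<close> between the model spaces is not known to have the
  form identity tensor unitary, so no map between defect spaces can be read off from it. The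
  recovery of T gets by with less: a unitary intertwining the \<open>B_op J i\<close> also
  intertwines their adjoints, which are the left backward shifts on N tensor D because these leave
  \<open>N_space J\<close> invariant.

  Elements of J commute with the right creation operators, so the complement of N tensor H is
  invariant under them, hence under \<Theta>. This is why the compressions W_i may replace R_i in
  the resolvent, and why a vector of N tensor D, tested against \<Theta> x, sees only the projection
  of x.

  The inverse and the radial limit in the definition are both handled by the system. For radius r <
  1 the states are the fixed point of a contraction. As r tends to 1 each coordinate converges,
  being a finite recursion, and norm convergence follows because purity makes \<Theta> isometric.

  K lands in N tensor D because f(T), evaluated on the adjoint of K at elementary tensors, is a
  bounded operator applied to radial dilations of f(1).\<close>

lemma cinner_add_right: "cinner (x::'a::chilbert_space) (y + z) = cinner x y + cinner x z"
  by (metis cinner_add_left cinner_commute complex_cnj_add)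

lemma cinner_scaleC_right: "cinner (x::'a::chilbert_space) (c *\<^sub>C y) = cnj c * cinner x y"
  by (metis cinner_scaleC_left cinner_commute complex_cnj_mult)

interpretation cinner: bounded_bilinear "cinner :: 'a::chilbert_space \<Rightarrow> 'a \<Rightarrow> complex"
proof
  fix x y z :: 'a and r :: real
  show "cinner (x + y) z = cinner x z + cinner y z" by (rule cinner_add_left)
  show "cinner x (y + z) = cinner x y + cinner x z" by (rule cinner_add_right)
  show "cinner (r *\<^sub>R x) y = r *\<^sub>R cinner x y"
    by (simp add: scaleC_of_real[of r x, symmetric] cinner_scaleC_left scaleR_conv_of_real)
  show "cinner x (r *\<^sub>R y) = r *\<^sub>R cinner x y"
    by (simp add: scaleC_of_real[of r y, symmetric] cinner_scaleC_right scaleR_conv_of_real)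
  show "\<exists>K. \<forall>(x::'a) y. norm (cinner x y) \<le> norm x * norm y * K"
    by (rule exI[of _ 1]) (simp add: cmod_cinner_le)
qed

interpretation scaleC: bounded_bilinear "scaleC :: complex \<Rightarrow> 'a::chilbert_space \<Rightarrow> 'a"
proof
  fix x y :: complex and a b :: 'a and r :: real
  show "(x + y) *\<^sub>C a = x *\<^sub>C a + y *\<^sub>C a" by (rule scaleC_add_left)
  show "x *\<^sub>C (a + b) = x *\<^sub>C a + x *\<^sub>C b" by (rule scaleC_add_right)
  show "(r *\<^sub>R x) *\<^sub>C a = r *\<^sub>R (x *\<^sub>C a)"
    by (simp add: scaleC_of_real[of r "x *\<^sub>C a", symmetric] scaleC_scaleC scaleR_conv_of_real)
  show "x *\<^sub>C (r *\<^sub>R a) = r *\<^sub>R (x *\<^sub>C a)"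
    by (simp add: scaleC_of_real[of r a, symmetric] scaleC_of_real[of r "x *\<^sub>C a", symmetric] scaleC_scaleC mult.commute)
  show "\<exists>K. \<forall>(x::complex) (y::'a). norm (x *\<^sub>C y) \<le> norm x * norm y * K"
    by (rule exI[of _ 1]) (simp add: norm_scaleC)
qed

declare cinner.zero_left [simp] cinner.zero_right [simp]
  scaleC.zero_left [simp] scaleC.zero_right [simp]

lemma scaleC_one [simp]: "1 *\<^sub>C (x::'a::chilbert_space) = x"
  using scaleC_of_real[of 1 x] by simp

lemma Im_cinner: "Im (cinner x y) = inner (x::'a::chilbert_space) (\<i> *\<^sub>C y)"
  by (simp add: Re_cinner[symmetric] cinner_scaleC_right)

lemma cinner_self: "cinner x x = complex_of_real ((norm (x::'a::chilbert_space))\<^sup>2)"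
proof -
  have "Im (cinner x x) = 0"
    using cinner_commute[of x x] by (simp add: complex_eq_iff)
  then show ?thesis by (simp add: complex_eq_iff Re_cinner power2_norm_eq_inner)
qed

lemma cinner_eq_iff_inner:
  "cinner (x::'a::chilbert_space) y = 0 \<longleftrightarrow> inner x y = 0 \<and> inner x (\<i> *\<^sub>C y) = 0"
  by (simp add: complex_eq_iff Re_cinner Im_cinner)

lemma cinner_eq_zero_commute: "cinner (x::'a::chilbert_space) y = 0 \<longleftrightarrow> cinner y x = 0"
  by (metis cinner_commute complex_cnj_zero)

lemma cinner_ext: "(\<And>z. cinner (x::'a::chilbert_space) z = cinner y z) \<Longrightarrow> x = y"
  using cinner_self[of "x - y"] by (simp add: cinner.diff_left)

lemma bounded_op_UNIV_iff:
  "bounded_op UNIV UNIV f \<longleftrightarrow> bounded_linear f \<and> (\<forall>c x. f (c *\<^sub>C x) = c *\<^sub>C f x)"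
proof
  assume f: "bounded_op UNIV UNIV f"
  then obtain K where K: "\<And>x. norm (f x) \<le> K * norm x" by (auto simp: bounded_op_def)
  have "bounded_linear f"
    by (rule bounded_linear_intro[of _ K])
      (use f K in \<open>auto simp: bounded_op_def mult.commute simp flip: scaleC_of_real\<close>)
  with f show "bounded_linear f \<and> (\<forall>c x. f (c *\<^sub>C x) = c *\<^sub>C f x)" by (auto simp: bounded_op_def)
next
  assume f: "bounded_linear f \<and> (\<forall>c x. f (c *\<^sub>C x) = c *\<^sub>C f x)"
  then obtain K where "\<And>x. norm (f x) \<le> norm x * K"
    using bounded_linear.bounded by blast
  with f show "bounded_op UNIV UNIV f"
    by (auto simp: bounded_op_def linear_add bounded_linear.linear mult.commute intro!: exI[of _ K])
qed

lemma bounded_op_linear: "bounded_op UNIV UNIV f \<Longrightarrow> bounded_linear f"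
  by (simp add: bounded_op_UNIV_iff)

lemma bounded_op_scaleC: "bounded_op UNIV UNIV f \<Longrightarrow> f (c *\<^sub>C x) = c *\<^sub>C f x"
  by (simp add: bounded_op_UNIV_iff)

lemma bounded_op_compose:
  "bounded_op UNIV UNIV f \<Longrightarrow> bounded_op UNIV UNIV g \<Longrightarrow> bounded_op UNIV UNIV (f \<circ> g)"
  unfolding bounded_op_UNIV_iff using bounded_linear_compose[of f g] by (auto simp: o_def)

lemma bounded_op_id: "bounded_op UNIV UNIV (id::'a::chilbert_space \<Rightarrow> 'a)"
  by (simp add: bounded_op_UNIV_iff id_def bounded_linear_ident)

lemma bounded_op_subset:
  "bounded_op UNIV UNIV f \<Longrightarrow> f ` V \<subseteq> W \<Longrightarrow> bounded_op V W f"
  by (auto simp: bounded_op_def)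

subsection \<open>Orthogonal projections\<close>

lemma csubspace_diff: "csubspace V \<Longrightarrow> x \<in> V \<Longrightarrow> y \<in> V \<Longrightarrow> x - y \<in> (V::'a::chilbert_space set)"
proof -
  assume V: "csubspace V" "x \<in> V" "y \<in> V"
  have "(-1) *\<^sub>C y = - y" using scaleC_of_real[of "-1" y] by simp
  then have "- y \<in> V" using V unfolding csubspace_def by metis
  then show ?thesis using V unfolding csubspace_def by (metis add_uminus_conv_diff)
qed

lemma csubspace_scaleR: "csubspace V \<Longrightarrow> x \<in> V \<Longrightarrow> r *\<^sub>R x \<in> (V::'a::chilbert_space set)"
  unfolding csubspace_def by (metis scaleC_of_real)

lemma csubspace_imp_subspace: "csubspace V \<Longrightarrow> subspace (V::'a::chilbert_space set)"
  by (simp add: subspace_def csubspace_scaleR) (simp add: csubspace_def)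

lemma csubspace_ortho_compl [simp]: "csubspace (ortho_compl A)"
  by (auto simp: csubspace_def ortho_compl_def cinner.add_left cinner_scaleC_left)

lemma closed_ortho_compl [simp]: "closed (ortho_compl A)"
proof -
  have "ortho_compl A = (\<Inter>y\<in>A. {x. cinner x y = 0})" by (auto simp: ortho_compl_def)
  moreover have "closed {x. cinner x y = 0}" for y :: 'a
    by (intro closed_Collect_eq continuous_intros cinner.continuous_on)
  ultimately show ?thesis by auto
qed

lemma csubspace_closure: "csubspace V \<Longrightarrow> csubspace (closure (V::'a::chilbert_space set))"
  unfolding csubspace_def
proof (intro conjI ballI allI)
  assume V: "0 \<in> V \<and> (\<forall>x\<in>V. \<forall>y\<in>V. x + y \<in> V) \<and> (\<forall>c. \<forall>x\<in>V. c *\<^sub>C x \<in> V)"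
  show "0 \<in> closure V" using V closure_subset by blast
  fix x assume "x \<in> closure V"
  then obtain f where f: "\<And>n::nat. f n \<in> V" "f \<longlonglongrightarrow> x" by (auto simp: closure_sequential)
  {
    fix y assume "y \<in> closure V"
    then obtain g where g: "\<And>n::nat. g n \<in> V" "g \<longlonglongrightarrow> y" by (auto simp: closure_sequential)
    show "x + y \<in> closure V"
      unfolding closure_sequential
      by (rule exI[of _ "\<lambda>n. f n + g n"]) (use V f g in \<open>auto intro!: tendsto_intros\<close>)
  next
    fix c
    show "c *\<^sub>C x \<in> closure V"
      unfolding closure_sequential
      by (rule exI[of _ "\<lambda>n. c *\<^sub>C f n"])
        (use V f in \<open>auto intro!: scaleC.tendsto tendsto_intros\<close>)
  }
qed

lemma csubspace_hull: "csubspace (csubspace hull A)"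
  by (rule hull_in) (auto simp: csubspace_def)

lemma csubspace_ccspan [simp]: "csubspace (ccspan A)"
  by (simp add: ccspan_def csubspace_closure csubspace_hull)

lemma closed_ccspan [simp]: "closed (ccspan A)"
  by (simp add: ccspan_def)

lemma ccspan_superset: "A \<subseteq> ccspan A"
  unfolding ccspan_def by (meson closure_subset hull_subset order_trans)

lemma ccspan_minimal: "A \<subseteq> V \<Longrightarrow> csubspace V \<Longrightarrow> closed V \<Longrightarrow> ccspan A \<subseteq> V"
  unfolding ccspan_def by (simp add: closure_minimal hull_minimal)

text \<open>A minimising sequence for the distance is Cauchy by the parallelogram law. The real
  inner product suffices: a complex subspace is closed under multiplication by \<i>, which yields
  complex orthogonality from real orthogonality.\<close>

lemma orthogonal_decomposition_exists:
  fixes V :: "'a::{real_inner, complete_space} set"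
  assumes V: "subspace V" "closed V"
  shows "\<exists>p\<in>V. \<forall>v\<in>V. inner (x - p) v = 0"
proof -
  define d where "d = (INF v\<in>V. (norm (x - v))\<^sup>2)"
  have bb: "bdd_below ((\<lambda>v. (norm (x - v))\<^sup>2) ` V)" by (rule bdd_belowI2[of _ 0]) simp
  have ne: "V \<noteq> {}" using V subspace_0 by blast
  have d_le: "d \<le> (norm (x - v))\<^sup>2" if "v \<in> V" for v
    unfolding d_def using bb that by (rule cINF_lower)
  have "\<exists>v\<in>V. (norm (x - v))\<^sup>2 < d + 1 / real (Suc n)" for n
  proof (rule ccontr)
    assume "\<not> ?thesis"
    then have "d + 1 / real (Suc n) \<le> d"
      unfolding d_def using ne by (intro cINF_greatest) (auto simp: not_less d_def)
    then show False by (auto simp: field_simps)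
  qed
  then obtain f where f: "\<And>n. f n \<in> V" "\<And>n. (norm (x - f n))\<^sup>2 < d + 1 / real (Suc n)"
    by metis
  have par: "(norm (f m - f n))\<^sup>2 \<le> 2 / real (Suc m) + 2 / real (Suc n)" for m n
  proof -
    have mid: "(1/2) *\<^sub>R (f m + f n) \<in> V"
      using V f by (intro subspace_scale subspace_add)
    have "(norm (f m - f n))\<^sup>2
        = 2 * (norm (x - f m))\<^sup>2 + 2 * (norm (x - f n))\<^sup>2 - 4 * (norm (x - (1/2) *\<^sub>R (f m + f n)))\<^sup>2"
      unfolding power2_norm_eq_inner by (simp add: algebra_simps inner_commute)
    then show ?thesis using d_le[OF mid] f(2)[of m] f(2)[of n] by linarith
  qed
  have "Cauchy f"
  proof (rule CauchyI)
    fix e :: real assume e: "0 < e"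
    then obtain M where M: "4 / e\<^sup>2 < real (Suc M)"
      using reals_Archimedean2[of "4 / e\<^sup>2"] by (metis less_trans lessI of_nat_less_iff)
    have "norm (f m - f n) < e" if "m \<ge> M" "n \<ge> M" for m n
    proof (rule power2_less_imp_less)
      have "2 / real (Suc m) \<le> 2 / real (Suc M)" "2 / real (Suc n) \<le> 2 / real (Suc M)"
        using that by (auto intro!: divide_left_mono)
      then have "(norm (f m - f n))\<^sup>2 \<le> 4 / real (Suc M)" using par[of m n] by simp
      also have "\<dots> < e\<^sup>2" using M e by (simp add: field_simps)
      finally show "(norm (f m - f n))\<^sup>2 < e\<^sup>2" .
    qed (use e in simp)
    then show "\<exists>M. \<forall>m\<ge>M. \<forall>n\<ge>M. norm (f m - f n) < e" by blast
  qed
  then obtain p where p: "f \<longlonglongrightarrow> p" using Cauchy_convergent_iff convergent_def by blast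
  have pV: "p \<in> V" using closed_sequentially[OF V(2) _ p] f(1) by blast
  have "(norm (x - p))\<^sup>2 \<le> d + 0"
  proof (rule LIMSEQ_le)
    show "(\<lambda>n. (norm (x - f n))\<^sup>2) \<longlonglongrightarrow> (norm (x - p))\<^sup>2" by (intro tendsto_intros p)
    show "(\<lambda>n. d + 1 / real (Suc n)) \<longlonglongrightarrow> d + 0"
      by (intro tendsto_intros LIMSEQ_Suc[OF lim_1_over_n])
  qed (use f(2) less_imp_le in blast)
  then have pd: "(norm (x - p))\<^sup>2 \<le> (norm (x - v))\<^sup>2" if "v \<in> V" for v using d_le[OF that] by linarith
  have "inner (x - p) v = 0" if v: "v \<in> V" for v
  proof (cases "v = 0")
    case False
    \<comment> \<open>This \<open>t\<close> minimises the distance from \<open>x\<close> to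
      \<open>p + t v\<close>; if the inner product were nonzero, \<open>p\<close> would not be
      nearest.\<close>
    define t where "t = inner (x - p) v / inner v v"
    have "p + t *\<^sub>R v \<in> V" using V pV v by (simp add: subspace_add subspace_scale)
    from pd[OF this] have "0 \<le> - 2 * t * inner (x - p) v + t\<^sup>2 * inner v v"
      unfolding power2_norm_eq_inner
      by (simp add: algebra_simps inner_commute power2_eq_square)
    also have "\<dots> = - (inner (x - p) v)\<^sup>2 / inner v v"
      using False by (simp add: t_def field_simps power2_eq_square)
    finally have "(inner (x - p) v)\<^sup>2 / inner v v \<le> 0" by simp
    moreover have "0 < inner v v" using False by simp
    ultimately have "(inner (x - p) v)\<^sup>2 \<le> 0" by (simp only: divide_le_0_iff) auto
    then show ?thesis by simp
  qed simp
  then show ?thesis using pV by blast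
qed

lemma proj_unique:
  assumes "csubspace V" "p \<in> V" "x - p \<in> ortho_compl V" "q \<in> V" "x - q \<in> ortho_compl V"
  shows "p = (q::'a::chilbert_space)"
proof -
  have "p - q \<in> V" using assms csubspace_diff by blast
  then have "cinner (x - q) (p - q) - cinner (x - p) (p - q) = 0"
    using assms by (simp add: ortho_compl_def)
  then have "cinner (p - q) (p - q) = 0" by (simp add: cinner.diff_left[symmetric])
  then show ?thesis by (simp add: cinner_self)
qed

lemma proj_eqI:
  assumes "csubspace V" "p \<in> V" "x - p \<in> ortho_compl V"
  shows "proj V x = (p::'a::chilbert_space)"
  unfolding proj_def by (rule the_equality) (use assms proj_unique in blast)+

lemma
  fixes V :: "'a::chilbert_space set"
  assumes V: "csubspace V" "closed V"
  shows proj_in: "proj V x \<in> V" and proj_ortho: "x - proj V x \<in> ortho_compl V"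
proof -
  obtain p where p: "p \<in> V" "\<And>v. v \<in> V \<Longrightarrow> inner (x - p) v = 0"
    using orthogonal_decomposition_exists[OF csubspace_imp_subspace[OF V(1)] V(2), of x] by blast
  have "x - p \<in> ortho_compl V"
    using p(2) V(1) by (auto simp: ortho_compl_def cinner_eq_iff_inner csubspace_def)
  then have "proj V x = p" using p(1) V(1) by (intro proj_eqI)
  then show "proj V x \<in> V" "x - proj V x \<in> ortho_compl V"
    using p(1) \<open>x - p \<in> _\<close> by auto
qed

lemma proj_id: "csubspace V \<Longrightarrow> x \<in> V \<Longrightarrow> proj V x = x"
  by (rule proj_eqI) (auto simp: ortho_compl_def)

lemma proj_ortho_zero: "csubspace V \<Longrightarrow> x \<in> ortho_compl V \<Longrightarrow> proj V x = 0"
  by (rule proj_eqI) (auto simp: csubspace_def)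

lemma ortho_complD: "x \<in> ortho_compl V \<Longrightarrow> v \<in> V \<Longrightarrow> cinner x v = 0"
  by (simp add: ortho_compl_def)

lemma cinner_proj_right:
  assumes "csubspace V" "closed V" "v \<in> V"
  shows "cinner v (proj V x) = cinner v x"
  using ortho_complD[OF proj_ortho[OF assms(1,2), of x] assms(3)]
  by (subst (1 2) cinner_commute) (simp add: cinner.diff_left)

lemma norm_proj_le:
  assumes V: "csubspace V" "closed V"
  shows "norm (proj V x) \<le> norm x"
proof -
  have "(norm (proj V x))\<^sup>2 = cmod (cinner (proj V x) (proj V x))"
    by (simp add: cinner_self del: of_real_power)
  also have "\<dots> = cmod (cinner (proj V x) x)" using cinner_proj_right[OF V proj_in[OF V]] by simp
  also have "\<dots> \<le> norm (proj V x) * norm x" by (rule cmod_cinner_le)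
  finally show ?thesis
    by (cases "norm (proj V x) = 0") (auto simp: power2_eq_square)
qed

lemma bounded_op_proj:
  assumes V: "csubspace V" "closed V"
  shows "bounded_op UNIV UNIV (proj V)"
  unfolding bounded_op_def
proof (intro conjI allI ballI exI[of _ 1])
  note i = proj_in[OF V] and o = proj_ortho[OF V]
  have C: "csubspace (ortho_compl V)" by simp
  fix x y
  have "(x - proj V x) + (y - proj V y) \<in> ortho_compl V"
    using o C unfolding csubspace_def by blast
  then show "proj V (x + y) = proj V x + proj V y"
    using i V by (intro proj_eqI) (auto simp: csubspace_def algebra_simps)
  have "c *\<^sub>C (x - proj V x) \<in> ortho_compl V" for c
    using o C unfolding csubspace_def by blast
  then show "proj V (c *\<^sub>C x) = c *\<^sub>C proj V x" for c
    using i V by (intro proj_eqI) (auto simp: csubspace_def scaleC.diff_right)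
  show "norm (proj V x) \<le> 1 * norm x" using norm_proj_le[OF V] by simp
qed auto

lemma ortho_compl_ortho_compl:
  assumes V: "csubspace V" "closed V"
  shows "ortho_compl (ortho_compl V) = V"
proof (intro subset_antisym subsetI)
  fix x assume x: "x \<in> ortho_compl (ortho_compl V)"
  let ?q = "x - proj V x"
  have "cinner x ?q = 0" using x proj_ortho[OF V] by (rule ortho_complD)
  moreover have "cinner (proj V x) ?q = 0"
    using ortho_complD[OF proj_ortho[OF V] proj_in[OF V]] cinner_eq_zero_commute by blast
  ultimately have "cinner ?q ?q = 0" by (simp add: cinner.diff_left)
  then show "x \<in> V" using proj_in[OF V, of x] by (simp add: cinner_self)
next
  fix x assume "x \<in> V"
  then show "x \<in> ortho_compl (ortho_compl V)"
    by (auto simp: ortho_compl_def cinner_eq_zero_commute)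
qed

subsection \<open>Adjoints\<close>

text \<open>The kernel of a nonzero functional has codimension one, so the component
  \<open>u\<close> of any \<open>a\<close> outside it, taken orthogonal to the kernel, represents
  \<open>f\<close> up to a scalar.\<close>

lemma riesz_real:
  fixes f :: "'a::{real_inner, complete_space} \<Rightarrow> real"
  assumes f: "bounded_linear f"
  shows "\<exists>y. \<forall>x. f x = inner x y"
proof (cases "\<forall>x. f x = 0")
  case True
  then show ?thesis by (intro exI[of _ 0]) simp
next
  case False
  then obtain a where a: "f a \<noteq> 0" by blast
  interpret f: bounded_linear f by (rule f)
  have "closed {x. f x = 0}"
    by (intro closed_Collect_eq continuous_intros f.continuous_on)
  moreover have "subspace {x. f x = 0}"
    by (simp add: subspace_def f.add f.scaleR)
  ultimately obtain p where p: "f p = 0" "\<And>v. f v = 0 \<Longrightarrow> inner (a - p) v = 0"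
    using orthogonal_decomposition_exists[of "{x. f x = 0}" a] by auto
  define u where "u = a - p"
  have fu: "f u \<noteq> 0" using a p(1) by (simp add: u_def f.diff)
  then have u0: "inner u u \<noteq> 0" using f.zero by auto
  show ?thesis
  proof (intro exI allI)
    fix x
    have "f (x - (f x / f u) *\<^sub>R u) = 0" using fu by (simp add: f.diff f.scaleR)
    then have "inner u (x - (f x / f u) *\<^sub>R u) = 0" using p(2) u_def by blast
    then have "inner u x = (f x / f u) * inner u u" by (simp add: inner_diff_right)
    then show "f x = inner x ((f u / inner u u) *\<^sub>R u)"
      using fu u0 by (simp add: inner_commute field_simps)
  qed
qed

text \<open>\<open>adj\<close> is a definite description, so existence comes first. Riesz for the
  real inner product yields equal real parts; replacing \<open>x\<close> by
  \<open>\<i> *\<^sub>C x\<close> turns the imaginary parts into real ones.\<close>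

lemma adj_exists:
  assumes A: "bounded_op UNIV UNIV (A::'a::chilbert_space \<Rightarrow> 'b::chilbert_space)"
  shows "\<exists>B. \<forall>x y. cinner (A x) y = cinner x (B y)"
proof -
  have "\<exists>b. \<forall>x. inner (A x) y = inner x b" for y
    by (rule riesz_real)
      (rule bounded_linear_compose[OF bounded_linear_inner_left bounded_op_linear[OF A]])
  then obtain B where B: "\<And>x y. inner (A x) y = inner x (B y)" by metis
  have "cinner (A x) y = cinner x (B y)" for x y
  proof -
    have r: "Re (cinner (A x) y) = Re (cinner x (B y))" for x by (simp add: Re_cinner B)
    from r[of "\<i> *\<^sub>C x"] have "Im (cinner (A x) y) = Im (cinner x (B y))"
      by (simp add: bounded_op_scaleC[OF A] cinner_scaleC_left)
    with r[of x] show ?thesis by (simp add: complex_eq_iff)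
  qed
  then show ?thesis by blast
qed

lemma adj_eqI:
  assumes "\<And>x y. cinner ((A::'a::chilbert_space \<Rightarrow> 'b::chilbert_space) x) y = cinner x (B y)"
  shows "adj A = B"
  unfolding adj_def
proof (rule the_equality)
  fix B' assume "\<forall>x y. cinner (A x) y = cinner x (B' y)"
  then have "cinner x (B' y) = cinner x (B y)" for x y
    using assms by simp
  then have "cinner (B' y) x = cinner (B y) x" for x y
    using cinner_commute[of "B' y" x] cinner_commute[of "B y" x] by simp
  then show "B' = B" by (intro ext) (rule cinner_ext)
qed (use assms in blast)

lemma cinner_adj:
  assumes "bounded_op UNIV UNIV (A::'a::chilbert_space \<Rightarrow> 'b::chilbert_space)"
  shows "cinner (A x) y = cinner x (adj A y)"
proof -
  obtain B where B: "\<And>x y. cinner (A x) y = cinner x (B y)" using adj_exists[OF assms] by blast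
  then show ?thesis using adj_eqI[of A B, OF B] by simp
qed

lemma cinner_adj_left:
  assumes "bounded_op UNIV UNIV (A::'a::chilbert_space \<Rightarrow> 'b::chilbert_space)"
  shows "cinner (adj A y) x = cinner y (A x)"
  using cinner_adj[OF assms, of x y] cinner_commute[of "adj A y" x] cinner_commute[of y "A x"] by simp

lemma bounded_op_adj:
  assumes A: "bounded_op UNIV UNIV (A::'a::chilbert_space \<Rightarrow> 'b::chilbert_space)"
  shows "bounded_op UNIV UNIV (adj A)"
  unfolding bounded_op_def
proof (intro conjI allI ballI)
  show "adj A (x + y) = adj A x + adj A y" for x y
    by (rule cinner_ext) (simp add: cinner_adj_left[OF A] cinner.add_left)
  show "adj A (c *\<^sub>C x) = c *\<^sub>C adj A x" for c x
    by (rule cinner_ext) (simp add: cinner_adj_left[OF A] cinner_scaleC_left)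
  obtain K where K: "0 \<le> K" "\<And>x. norm (A x) \<le> norm x * K"
    using bounded_linear.nonneg_bounded[OF bounded_op_linear[OF A]] by blast
  have "norm (adj A y) \<le> K * norm y" for y
  proof -
    have "(norm (adj A y))\<^sup>2 = cmod (cinner (A (adj A y)) y)"
      by (simp add: cinner_adj[OF A] cinner_self del: of_real_power)
    also have "\<dots> \<le> norm (A (adj A y)) * norm y" by (rule cmod_cinner_le)
    also have "\<dots> \<le> norm (adj A y) * K * norm y" by (intro mult_right_mono K) simp
    finally have *: "norm (adj A y) * norm (adj A y) \<le> norm (adj A y) * (K * norm y)"
      by (simp add: power2_eq_square mult_ac)
    show ?thesis
    proof (cases "adj A y = 0")
      case True
      then show ?thesis using K(1) by simp
    qed (use * in simp)
  qed
  then show "\<exists>K. \<forall>x\<in>UNIV. norm (adj A x) \<le> K * norm x" by blast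
qed auto

lemma adj_compose:
  assumes "bounded_op UNIV UNIV A" "bounded_op UNIV UNIV B"
  shows "adj (A \<circ> B) = adj B \<circ> adj A"
  by (rule adj_eqI) (simp add: cinner_adj[OF assms(1)] cinner_adj[OF assms(2)])

subsection \<open>Positive square roots\<close>

text \<open>
  For a self-adjoint contraction \<open>X\<close> the square root of \<open>I - X\<close> is \<open>I - Y\<close>, where
  \<open>Y = (X + Y\<^sup>2) / 2\<close> is found by iteration.  The scalar iteration with \<open>X = 1\<close>
  dominates the increments in norm, which gives convergence although the map is no contraction.
\<close>

primrec sqrt_iter :: "('a::real_normed_vector \<Rightarrow>\<^sub>L 'a) \<Rightarrow> nat \<Rightarrow> 'a \<Rightarrow>\<^sub>L 'a" where
  "sqrt_iter X 0 = 0"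
| "sqrt_iter X (Suc n) = (1/2) *\<^sub>R (X + (sqrt_iter X n o\<^sub>L sqrt_iter X n))"

primrec sqrt_bound :: "nat \<Rightarrow> real" where
  "sqrt_bound 0 = 0"
| "sqrt_bound (Suc n) = (1 + (sqrt_bound n)\<^sup>2) / 2"

lemma sqrt_bound_01: "0 \<le> sqrt_bound n \<and> sqrt_bound n \<le> 1"
  by (induction n) (auto simp: power_le_one)

lemma sqrt_bound_mono: "sqrt_bound n \<le> sqrt_bound (Suc n)"
proof -
  have "0 \<le> (1 - sqrt_bound n)\<^sup>2" by simp
  then show ?thesis by (simp add: power2_eq_square algebra_simps)
qed

lemma norm_sqrt_iter:
  assumes "norm X \<le> 1"
  shows "norm (sqrt_iter X n) \<le> sqrt_bound n"
proof (induction n)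
  case (Suc n)
  have "norm (sqrt_iter X n o\<^sub>L sqrt_iter X n) \<le> sqrt_bound n * sqrt_bound n"
    by (rule order_trans[OF norm_blinfun_compose])
      (intro mult_mono Suc, use sqrt_bound_01 in auto)
  then have "norm (X + (sqrt_iter X n o\<^sub>L sqrt_iter X n)) \<le> 1 + (sqrt_bound n)\<^sup>2"
    using assms norm_triangle_ineq[of X "sqrt_iter X n o\<^sub>L sqrt_iter X n"]
    by (simp add: power2_eq_square)
  then show ?case by simp
qed simp

text \<open>A difference of squares factors as a (a - b) + (a - b) b without commutativity. Bounding
  each factor by its scalar counterpart gives exactly the same factorisation of the scalar
  increment.\<close>

lemma norm_sqrt_iter_diff:
  assumes "norm X \<le> 1"
  shows "norm (sqrt_iter X (Suc n) - sqrt_iter X n) \<le> sqrt_bound (Suc n) - sqrt_bound n"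
proof (induction n)
  case 0
  then show ?case using assms by simp
next
  case (Suc n)
  let ?a = "sqrt_iter X (Suc n)" and ?b = "sqrt_iter X n"
  let ?s = "sqrt_bound (Suc n)" and ?t = "sqrt_bound n"
  have "sqrt_iter X (Suc (Suc n)) - ?a
      = (1/2) *\<^sub>R ((?a o\<^sub>L ?a) - (?b o\<^sub>L ?b))"
    by (subst sqrt_iter.simps, subst (3) sqrt_iter.simps) (simp only: scaleR_diff_right[symmetric] add_diff_cancel_left)
  also have "(?a o\<^sub>L ?a) - (?b o\<^sub>L ?b) = (?a o\<^sub>L (?a - ?b)) + ((?a - ?b) o\<^sub>L ?b)"
    by (rule blinfun_eqI) (simp del: sqrt_iter.simps add: blinfun.bilinear_simps)
  finally have "norm (sqrt_iter X (Suc (Suc n)) - ?a)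
      = norm ((?a o\<^sub>L (?a - ?b)) + ((?a - ?b) o\<^sub>L ?b)) / 2"
    by simp
  moreover have "norm ((?a o\<^sub>L (?a - ?b)) + ((?a - ?b) o\<^sub>L ?b)) \<le> ?s * (?s - ?t) + (?s - ?t) * ?t"
    by (rule order_trans[OF norm_triangle_ineq], rule add_mono;
        rule order_trans[OF norm_blinfun_compose]; rule mult_mono)
      (use Suc norm_sqrt_iter[OF assms, of "Suc n"] norm_sqrt_iter[OF assms, of n]
        sqrt_bound_01 sqrt_bound_mono[of n] in \<open>simp_all del: sqrt_iter.simps sqrt_bound.simps\<close>)
  moreover have "?s * (?s - ?t) + (?s - ?t) * ?t = 2 * (sqrt_bound (Suc (Suc n)) - ?s)"
    by (subst (2) sqrt_bound.simps(2), subst (4) sqrt_bound.simps(2)) (simp add: power2_eq_square algebra_simps del: sqrt_bound.simps)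
  ultimately show ?case by (simp del: sqrt_iter.simps sqrt_bound.simps)
qed

text \<open>The increments telescope against those of a monotone real sequence bounded by 1. This
  gives a Cauchy sequence in operator norm without any geometric rate.\<close>

lemma convergent_sqrt_iter:
  fixes X :: "'a::{banach} \<Rightarrow>\<^sub>L 'a"
  assumes "norm X \<le> 1"
  shows "convergent (sqrt_iter X)"
proof -
  have le: "norm (sqrt_iter X (n + k) - sqrt_iter X n) \<le> sqrt_bound (n + k) - sqrt_bound n" for n k
  proof (induction k)
    case (Suc k)
    then show ?case
      using norm_sqrt_iter_diff[OF assms, of "n + k"]
        norm_triangle_ineq[of "sqrt_iter X (Suc (n + k)) - sqrt_iter X (n + k)"
          "sqrt_iter X (n + k) - sqrt_iter X n"]
      by (simp del: sqrt_iter.simps sqrt_bound.simps)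
  qed simp
  have "incseq sqrt_bound" by (rule incseq_SucI) (rule sqrt_bound_mono)
  then obtain l where l: "sqrt_bound \<longlonglongrightarrow> l" "\<And>n. sqrt_bound n \<le> l"
    using incseq_convergent[of sqrt_bound 1] sqrt_bound_01 by blast
  have "Cauchy (sqrt_iter X)"
  proof (rule CauchyI')
    fix e :: real assume "0 < e"
    then obtain M where M: "\<And>n. n \<ge> M \<Longrightarrow> norm (sqrt_bound n - l) < e"
      using LIMSEQ_D[OF l(1)] by blast
    show "\<exists>M. \<forall>m\<ge>M. \<forall>n>m. dist (sqrt_iter X m) (sqrt_iter X n) < e"
    proof (intro exI[of _ M] allI impI)
      fix m n assume "M \<le> m" "m < n"
      then show "dist (sqrt_iter X m) (sqrt_iter X n) < e"
        using le[of m "n - m"] M[of m] l(2)[of n] l(2)[of m] by (simp add: dist_norm norm_minus_commute)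
    qed
  qed
  then show ?thesis by (simp add: Cauchy_convergent_iff)
qed

section \<open>Positive operators and uniqueness of the square root\<close>

lemma positive_op_selfadjoint:
  assumes B: "positive_op B"
  shows "cinner (B x) y = cinner (x::'a::chilbert_space) (B y)"
proof -
  have bop: "bounded_op UNIV UNIV B" using B by (simp add: positive_op_def)
  interpret B: bounded_linear B using bop by (rule bounded_op_linear)
  have real: "cinner (B v) v = cinner v (B v)" for v
    using B cinner_commute[of "B v" v] by (simp add: positive_op_def complex_eq_iff)
  \<comment> \<open>Polarisation of the real quadratic form at \<open>x + y\<close>. The instance
    with \<i> times \<open>y\<close> supplies the second equation that separates the two
    summands.\<close>
  have 1: "cinner (B x) y + cinner (B y) x = cinner x (B y) + cinner y (B x)" for x y
    using real[of "x + y"] real[of x] real[of y]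
    by (simp add: B.add cinner.add_left cinner.add_right add.commute)
  have "\<i> * (cinner (B y) x - cinner (B x) y) = \<i> * (cinner y (B x) - cinner x (B y))"
    using 1[of x "\<i> *\<^sub>C y"]
    by (simp add: bounded_op_scaleC[OF bop] cinner_scaleC_left cinner_scaleC_right algebra_simps)
  then have "cinner (B y) x - cinner (B x) y = cinner y (B x) - cinner x (B y)" by simp
  with 1[of x y] show ?thesis by (simp add: complex_eq_iff)
qed

text \<open>The form at \<open>y + t z\<close> is a quadratic in \<open>t\<close> without constant
  term; nonnegativity for all real \<open>t\<close> forces its linear coefficient, the inner product
  of \<open>B y\<close> with \<open>z\<close>, to vanish.\<close>

lemma positive_op_zero:
  assumes B: "positive_op B" and y: "cinner (B y) y = 0"
  shows "B y = (0::'a::chilbert_space)"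
proof -
  interpret B: bounded_linear B using B by (simp add: positive_op_def bounded_op_linear)
  have sa: "inner (B z) w = inner (B w) z" for z w
    using positive_op_selfadjoint[OF B, of z w] by (simp add: Re_cinner[symmetric] cinner_commute[of z])
  have pos: "0 \<le> inner (B v) v" for v
    using B by (simp add: positive_op_def Re_cinner[symmetric])
  have y0: "inner (B y) y = 0" using y by (simp add: Re_cinner[symmetric])
  have "inner (B y) z = 0" for z
  proof -
    have q: "0 \<le> 2 * t * inner (B y) z + t\<^sup>2 * inner (B z) z" for t
      using pos[of "y + t *\<^sub>R z"] sa[of z y] y0
      by (simp add: B.add B.scaleR inner_add_left inner_add_right power2_eq_square algebra_simps)
    show ?thesis
    proof (cases "inner (B z) z = 0")
      case True
      then show ?thesis using q[of 1] q[of "-1"] by simp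
    next
      case False
      then have p: "0 < inner (B z) z" using pos[of z] by simp
      have "0 \<le> - (inner (B y) z)\<^sup>2 / inner (B z) z"
        using q[of "- inner (B y) z / inner (B z) z"] p
        by (simp add: field_simps power2_eq_square)
      then have "(inner (B y) z)\<^sup>2 \<le> 0" using p by (simp add: zero_le_divide_iff divide_le_0_iff)
      then show ?thesis by simp
    qed
  qed
  from this[of "B y"] show ?thesis by simp
qed

locale selfadjoint_contraction =
  fixes X :: "'a::chilbert_space \<Rightarrow> 'a"
  assumes bop: "bounded_op UNIV UNIV X"
    and sa: "cinner (X x) y = cinner x (X y)"
    and contr: "norm (X x) \<le> norm x"
begin

definition root_compl :: "'a \<Rightarrow>\<^sub>L 'a" where "root_compl = lim (sqrt_iter (Blinfun X))"

lemma apply_Blinfun_X: "blinfun_apply (Blinfun X) = X"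
  by (simp add: bounded_linear_Blinfun_apply bounded_op_linear[OF bop])

lemma norm_Blinfun_X: "norm (Blinfun X) \<le> 1"
  by (rule norm_blinfun_bound) (simp_all add: apply_Blinfun_X contr)

lemma tendsto_root_compl: "sqrt_iter (Blinfun X) \<longlonglongrightarrow> root_compl"
  unfolding root_compl_def
  using convergent_sqrt_iter[OF norm_Blinfun_X] by (simp add: convergent_LIMSEQ_iff)

lemma tendsto_root_compl_apply:
  "(\<lambda>n. sqrt_iter (Blinfun X) n x) \<longlonglongrightarrow> root_compl x"
  by (intro blinfun.tendsto tendsto_root_compl tendsto_const)

lemma root_compl_eq: "root_compl x = (1/2) *\<^sub>R (X x + root_compl (root_compl x))"
proof (rule LIMSEQ_unique)
  show "(\<lambda>n. sqrt_iter (Blinfun X) (Suc n) x) \<longlonglongrightarrow> root_compl x"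
    using tendsto_root_compl_apply by (rule LIMSEQ_Suc)
  have "(\<lambda>n. (1/2) *\<^sub>R (X x + sqrt_iter (Blinfun X) n (sqrt_iter (Blinfun X) n x)))
      \<longlonglongrightarrow> (1/2) *\<^sub>R (X x + root_compl (root_compl x))"
    by (intro tendsto_intros blinfun.tendsto tendsto_root_compl tendsto_root_compl_apply)
  then show "(\<lambda>n. sqrt_iter (Blinfun X) (Suc n) x)
      \<longlonglongrightarrow> (1/2) *\<^sub>R (X x + root_compl (root_compl x))"
    by (simp add: blinfun.bilinear_simps apply_Blinfun_X)
qed

lemma norm_root_compl: "norm (root_compl x) \<le> norm x"
proof (rule LIMSEQ_le_const2)
  show "(\<lambda>n. norm (sqrt_iter (Blinfun X) n x)) \<longlonglongrightarrow> norm (root_compl x)"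
    by (intro tendsto_intros tendsto_root_compl_apply)
  have "norm (sqrt_iter (Blinfun X) n x) \<le> norm x" for n
  proof -
    have "norm (sqrt_iter (Blinfun X) n x) \<le> norm (sqrt_iter (Blinfun X) n) * norm x"
      by (rule norm_blinfun)
    also have "\<dots> \<le> 1 * norm x"
      using norm_sqrt_iter[OF norm_Blinfun_X, of n] sqrt_bound_01[of n]
      by (intro mult_right_mono) auto
    finally show ?thesis by simp
  qed
  then show "\<exists>N. \<forall>n\<ge>N. norm (sqrt_iter (Blinfun X) n x) \<le> norm x" by blast
qed

lemma root_compl_selfadjoint: "cinner (root_compl x) y = cinner x (root_compl y)"
proof -
  have "cinner (sqrt_iter (Blinfun X) n x) y = cinner x (sqrt_iter (Blinfun X) n y)" for n x y
    by (induction n arbitrary: x y)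
      (simp_all add: blinfun.bilinear_simps apply_Blinfun_X cinner.scaleR_left cinner.scaleR_right
        cinner.add_left cinner.add_right sa[symmetric])
  moreover have "(\<lambda>n. cinner (sqrt_iter (Blinfun X) n x) y) \<longlonglongrightarrow> cinner (root_compl x) y"
    "(\<lambda>n. cinner x (sqrt_iter (Blinfun X) n y)) \<longlonglongrightarrow> cinner x (root_compl y)"
    by (intro cinner.tendsto tendsto_root_compl_apply tendsto_const)+
  ultimately show ?thesis using LIMSEQ_unique by fastforce
qed

definition root :: "'a \<Rightarrow> 'a" where "root x = x - root_compl x"

lemma root_root: "root (root x) = x - X x"
proof -
  have "root_compl (root_compl x) = 2 *\<^sub>R root_compl x - X x"
    by (subst (2) root_compl_eq) (simp add: algebra_simps scaleR_2)
  then show ?thesis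
    by (simp add: root_def blinfun.bilinear_simps scaleR_2)
qed

lemma root_selfadjoint: "cinner (root x) y = cinner x (root y)"
  by (simp add: root_def cinner.diff_left cinner.diff_right root_compl_selfadjoint)

lemma positive_root: "positive_op root"
  unfolding positive_op_def bounded_op_UNIV_iff
proof (intro conjI allI)
  have "bounded_linear (\<lambda>x. x - root_compl x)"
    by (intro bounded_linear_intros)
  then show "bounded_linear root" unfolding root_def[abs_def] .
  show "root (c *\<^sub>C x) = c *\<^sub>C root x" for c x
    by (rule cinner_ext) (simp add: root_selfadjoint cinner_scaleC_left)
  fix x
  have "cinner (root x) x = cnj (cinner (root x) x)"
    using root_selfadjoint[of x x] cinner_commute[of x "root x"] by simp
  then show "Im (cinner (root x) x) = 0" by (metis Reals_cnj_iff complex_is_Real_iff)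
  have "inner (root_compl x) x \<le> norm (root_compl x) * norm x" by (rule norm_cauchy_schwarz)
  also have "\<dots> \<le> norm x * norm x" by (intro mult_right_mono norm_root_compl) simp
  finally show "0 \<le> Re (cinner (root x) x)"
    by (simp add: Re_cinner root_def inner_diff_left power2_norm_eq_inner[symmetric] power2_eq_square)
qed

end

text \<open>An intertwining relation passes to every iterate and then to the limit. The two spaces
  may differ, so the lemma serves for commuting operators, for T between its two defect operators,
  and for a unitary equivalence.\<close>

lemma root_intertwine:
  assumes "selfadjoint_contraction X" "selfadjoint_contraction X'"
    and C: "bounded_linear C" and CX: "\<And>x. C (X x) = X' (C x)"
  shows "C (selfadjoint_contraction.root X x) = selfadjoint_contraction.root X' (C x)"
proof -
  interpret X: selfadjoint_contraction X by fact
  interpret X': selfadjoint_contraction X' by fact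
  interpret C: bounded_linear C by (rule C)
  have *: "C (sqrt_iter (Blinfun X) n x) = sqrt_iter (Blinfun X') n (C x)" for n x
    by (induction n arbitrary: x)
      (simp_all add: blinfun.bilinear_simps X.apply_Blinfun_X X'.apply_Blinfun_X C.scaleR C.add
        C.zero CX)
  have "(\<lambda>n. C (sqrt_iter (Blinfun X) n x)) \<longlonglongrightarrow> C (X.root_compl x)"
    by (intro C.tendsto X.tendsto_root_compl_apply)
  moreover have "(\<lambda>n. C (sqrt_iter (Blinfun X) n x)) \<longlonglongrightarrow> X'.root_compl (C x)"
    unfolding * by (rule X'.tendsto_root_compl_apply)
  ultimately have "C (X.root_compl x) = X'.root_compl (C x)" by (rule LIMSEQ_unique)
  then show ?thesis by (simp add: X.root_def X'.root_def C.diff)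
qed

context selfadjoint_contraction
begin

text \<open>\<open>X\<close> is the identity minus the square of \<open>C\<close>, so
  \<open>C\<close> commutes with \<open>X\<close> and hence with \<open>root\<close>. Then (root +
  C)(root - C) = 0, and positivity makes both \<open>root\<close> and \<open>C\<close> kill every
  vector \<open>y = root x - C x\<close>; self-adjointness then gives \<open>y = 0\<close>.\<close>

lemma root_unique:
  assumes C: "positive_op C" and CC: "\<And>x. C (C x) = x - X x"
  shows "C = root"
proof
  fix x
  interpret C: bounded_linear C using C by (simp add: positive_op_def bounded_op_linear)
  interpret R: bounded_linear root using positive_root by (simp add: positive_op_def bounded_op_linear)
  have "C (X x) = X (C x)" for x
    using CC[of x] CC[of "C x"] by (simp add: C.diff)
  then have comm: "C (root x) = root (C x)" for x
    using root_intertwine[OF selfadjoint_contraction_axioms selfadjoint_contraction_axioms C.bounded_linear]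
    by blast
  define y where "y = root x - C x"
  have "root y + C y = 0" by (simp add: y_def R.diff C.diff root_root CC comm)
  then have "cinner (root y) y + cinner (C y) y = 0" by (simp add: cinner.add_left[symmetric])
  moreover have "0 \<le> Re (cinner (root y) y)" "0 \<le> Re (cinner (C y) y)"
    "Im (cinner (root y) y) = 0" "Im (cinner (C y) y) = 0"
    using positive_root C by (simp_all add: positive_op_def)
  ultimately have "cinner (root y) y = 0" "cinner (C y) y = 0"
    by (simp_all add: complex_eq_iff)
  then have "root y = 0" "C y = 0" using positive_op_zero positive_root C by blast+
  then have "cinner y y = 0"
    unfolding y_def cinner.diff_left root_selfadjoint positive_op_selfadjoint[OF C]
    by (simp add: y_def[symmetric])
  then show "C x = root x" by (simp add: y_def cinner_self)
qed

lemma sqrt_op_eq_root: "sqrt_op (\<lambda>x. x - X x) = root"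
  unfolding sqrt_op_def
  by (rule the_equality) (auto simp: positive_root root_root fun_eq_iff intro: root_unique[THEN fun_cong])

end

section \<open>Operators on square-summable families\<close>

lemma norm_ell2_sq: "(norm (x::('i, 'a::real_inner) ell2))\<^sup>2 = (\<Sum>\<^sub>\<infinity>i. (norm (ell2_nth x i))\<^sup>2)"
  unfolding norm_ell2_def by (rule real_sqrt_pow2, rule infsum_nonneg) simp

lemma norm_ell2_le:
  fixes x :: "('i, 'a::real_inner) ell2"
  assumes "\<And>F. finite F \<Longrightarrow> (\<Sum>i\<in>F. (norm (ell2_nth x i))\<^sup>2) \<le> c"
  shows "(norm x)\<^sup>2 \<le> c"
  unfolding norm_ell2_sq by (rule infsum_le_finite_sums[OF ell2_nth_summable]) (use assms in auto)

lemma norm_ell2_nth_le: "norm (ell2_nth x i) \<le> norm (x::('i, 'a::real_inner) ell2)"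
  using sum_ell2_le[of "{i}" x] by (intro power2_le_imp_le[OF _ norm_ge_zero]) simp

lemma ell2_nth_scaleC [simp]: "ell2_nth (c *\<^sub>C x) i = c *\<^sub>C ell2_nth x i"
  by (simp add: scaleC_ell2.rep_eq)

lemma bounded_op_ell2_nth:
  "bounded_op UNIV UNIV (\<lambda>x::('i, 'a::chilbert_space) ell2. ell2_nth x i)"
  by (auto simp: bounded_op_def intro!: exI[of _ 1] norm_ell2_nth_le)

lemma ell2_nth_sum [simp]:
  "ell2_nth (\<Sum>j\<in>A. f j) i = (\<Sum>j\<in>A. ell2_nth (f j :: ('i, 'a::real_normed_vector) ell2) i)"
  by (induction A rule: infinite_finite_induct) auto

lemma ell2_nth_Abs:
  "(\<lambda>i. (norm (f i))\<^sup>2) summable_on UNIV \<Longrightarrow> ell2_nth (Abs_ell2 f) = f"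
  by (simp add: Abs_ell2_inverse)

lemma infsum_UNIV_single: "(\<And>j. j \<noteq> i \<Longrightarrow> f j = 0) \<Longrightarrow> (\<Sum>\<^sub>\<infinity>j. f j) = f i"
  by (subst infsum_cong_neutral[of "{i}" _ f f]) auto

text \<open>Finitely many coordinates carry almost all of the norm of \<open>x\<close>. On them
  \<open>X r\<close> is eventually close to \<open>x\<close>, and since its total norm does not
  exceed that of \<open>x\<close>, little is left for its tail.\<close>

lemma tendsto_ell2_coordinatewise:
  fixes X :: "'b \<Rightarrow> ('i, 'a::real_inner) ell2"
  assumes X: "\<And>i. ((\<lambda>r. ell2_nth (X r) i) \<longlongrightarrow> ell2_nth x i) F"
    and le: "\<forall>\<^sub>F r in F. norm (X r) \<le> norm x"
  shows "(X \<longlongrightarrow> x) F"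
proof (rule tendstoI)
  fix e :: real assume e: "0 < e"
  \<comment> \<open>The head contributes less than \<open>d\<close>, the tails of \<open>X r\<close>
    and of \<open>x\<close> less than \<open>2 * d\<close> each, so the squared distance stays below
    \<open>6 * d\<close>.\<close>
  define d where "d = e\<^sup>2 / 6"
  have d: "0 < d" using e by (simp add: d_def)
  let ?s = "\<lambda>y A. \<Sum>i\<in>A. (norm (ell2_nth (y::('i,'a) ell2) i))\<^sup>2"
  have "((\<lambda>i. (norm (ell2_nth x i))\<^sup>2) has_sum (norm x)\<^sup>2) UNIV"
    unfolding norm_ell2_sq using ell2_nth_summable by (rule has_sum_infsum)
  then have "(?s x \<longlongrightarrow> (norm x)\<^sup>2) (finite_subsets_at_top UNIV)"
    by (simp add: has_sum_def)
  then have "\<forall>\<^sub>F A in finite_subsets_at_top UNIV. (norm x)\<^sup>2 - d < ?s x A"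
    using d by (intro order_tendstoD(1)) auto
  then obtain A where A: "finite A" "(norm x)\<^sup>2 - d < ?s x A"
    by (auto simp: eventually_finite_subsets_at_top)
  have split: "(norm y)\<^sup>2 = ?s y A + (\<Sum>\<^sub>\<infinity>i\<in>-A. (norm (ell2_nth y i))\<^sup>2)" for y :: "('i,'a) ell2"
  proof -
    have "(\<Sum>\<^sub>\<infinity>i\<in>A \<union> -A. (norm (ell2_nth y i))\<^sup>2)
      = (\<Sum>\<^sub>\<infinity>i\<in>A. (norm (ell2_nth y i))\<^sup>2) + (\<Sum>\<^sub>\<infinity>i\<in>-A. (norm (ell2_nth y i))\<^sup>2)"
      by (rule infsum_Un_disjoint)
        (auto intro: summable_on_subset_banach[OF ell2_nth_summable] simp: A)
    then show ?thesis using A(1) by (simp add: norm_ell2_sq)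
  qed
  have tail: "(\<Sum>\<^sub>\<infinity>i\<in>-A. (norm (ell2_nth (y - x) i))\<^sup>2)
      \<le> 2 * ((norm y)\<^sup>2 - ?s y A) + 2 * ((norm x)\<^sup>2 - ?s x A)" for y
  proof -
    have s: "(\<lambda>i. (norm (ell2_nth z i))\<^sup>2) summable_on -A" for z :: "('i,'a) ell2"
      by (rule summable_on_subset_banach[OF ell2_nth_summable]) simp
    have "(\<Sum>\<^sub>\<infinity>i\<in>-A. (norm (ell2_nth (y - x) i))\<^sup>2)
      \<le> (\<Sum>\<^sub>\<infinity>i\<in>-A. 2 * (norm (ell2_nth y i))\<^sup>2 + 2 * (norm (ell2_nth x i))\<^sup>2)"
    proof (rule infsum_mono)
      fix i
      let ?a = "ell2_nth y i" and ?b = "ell2_nth x i"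
      have "(norm (?a - ?b))\<^sup>2 + (norm (?a + ?b))\<^sup>2 = 2 * (norm ?a)\<^sup>2 + 2 * (norm ?b)\<^sup>2"
        by (simp add: power2_norm_eq_inner algebra_simps inner_commute)
      then show "(norm (ell2_nth (y - x) i))\<^sup>2 \<le> 2 * (norm ?a)\<^sup>2 + 2 * (norm ?b)\<^sup>2"
        using zero_le_power2[of "norm (?a + ?b)"] unfolding ell2_nth_minus by linarith
    qed (intro s summable_on_add summable_on_cmult_right)+
    also have "\<dots> = 2 * (\<Sum>\<^sub>\<infinity>i\<in>-A. (norm (ell2_nth y i))\<^sup>2) + 2 * (\<Sum>\<^sub>\<infinity>i\<in>-A. (norm (ell2_nth x i))\<^sup>2)"
      by (subst infsum_add) (auto intro!: s summable_on_cmult_right simp: infsum_cmult_right')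
    finally show ?thesis using split[of y] split[of x] by simp
  qed
  have "((\<lambda>r. ?s (X r) A) \<longlongrightarrow> ?s x A) F" by (intro tendsto_intros X)
  then have e1: "\<forall>\<^sub>F r in F. (norm x)\<^sup>2 - d < ?s (X r) A" using A by (intro order_tendstoD(1)) auto
  have "((\<lambda>r. ?s (X r - x) A) \<longlongrightarrow> (\<Sum>i\<in>A. (norm (ell2_nth x i - ell2_nth x i))\<^sup>2)) F"
    unfolding ell2_nth_minus by (intro tendsto_intros X)
  then have e2: "\<forall>\<^sub>F r in F. ?s (X r - x) A < d" using d by (intro order_tendstoD(2)) auto
  show "\<forall>\<^sub>F r in F. dist (X r) x < e"
    using le e1 e2
  proof eventually_elim
    case (elim r)
    have "(norm (X r))\<^sup>2 \<le> (norm x)\<^sup>2" using elim(1) by (intro power_mono) auto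
    have aux: "n < 6 * d"
      if "a \<le> b" "n = s + t" "t \<le> 2 * (a - u) + 2 * (b - v)" "b - d < v" "b - d < u" "s < d"
      for a b n s t u v :: real
      using that d by argo
    have "(norm (X r - x))\<^sup>2 < 6 * d"
      by (rule aux[OF _ split tail A(2) elim(2,3)]) fact
    then have "(norm (X r - x))\<^sup>2 < e\<^sup>2" by (simp add: d_def)
    then show ?case using e by (simp add: dist_norm power2_less_imp_less)
  qed
qed

subsection \<open>Elementary tensors\<close>

lift_definition ell2_single :: "'i \<Rightarrow> 'a::real_normed_vector \<Rightarrow> ('i, 'a) ell2"
  is "\<lambda>v x w. if w = v then x else 0"
proof -
  fix v :: 'i and x :: 'a
  have "(\<lambda>w. (norm (if w = v then x else 0))\<^sup>2) summable_on {v}" by simp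
  then show "(\<lambda>w. (norm (if w = v then x else 0))\<^sup>2) summable_on UNIV"
    by (rule iffD1[OF summable_on_cong_neutral, rotated -1]) auto
qed

lemmas ell2_nth_single = ell2_single.rep_eq

lemma cinner_single_right: "cinner x (ell2_single i k) = cinner (ell2_nth x i) (k::'a::chilbert_space)"
  unfolding cinner_ell2_def
  by (subst infsum_UNIV_single[of i]) (auto simp: ell2_nth_single)

lemma ell2_nth_tensor_vec [simp]: "ell2_nth (tensor_vec \<phi> k) w = ell2_nth \<phi> w *\<^sub>C k"
  by (simp add: tensor_vec.rep_eq)

lemma tensor_vec_basis_vec: "tensor_vec (basis_vec w) k = ell2_single w k"
  by (rule ell2_eqI) (simp add: basis_vec.rep_eq ell2_nth_single)

lemma cinner_tensor_vec:
  "cinner (tensor_vec \<phi> k) (tensor_vec \<psi> l) = cinner \<phi> \<psi> * cinner k l"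
  by (simp add: cinner_ell2_def cinner_scaleC_left cinner_scaleC_right cinner_complex_def
      infsum_cmult_left'[symmetric] infsum_cmult_right'[symmetric] mult_ac)

lemma norm_tensor_vec: "norm (tensor_vec \<phi> k) = norm \<phi> * norm k"
proof -
  have "complex_of_real ((norm (tensor_vec \<phi> k))\<^sup>2) = complex_of_real ((norm \<phi> * norm k)\<^sup>2)"
    by (simp only: cinner_self[symmetric] cinner_tensor_vec)
      (simp add: cinner_self power_mult_distrib)
  then have "(norm (tensor_vec \<phi> k))\<^sup>2 = (norm \<phi> * norm k)\<^sup>2" using of_real_eq_iff by blast
  then show ?thesis by (simp add: power2_eq_iff_nonneg)
qed

lemma bounded_op_tensor_vec_left: "bounded_op UNIV UNIV (\<lambda>\<phi>. tensor_vec \<phi> k)"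
  unfolding bounded_op_def
  by (auto intro!: ell2_eqI exI[of _ "norm k"]
      simp: scaleC_add_left scaleC_complex_def scaleC_scaleC norm_tensor_vec mult.commute)

lemma tensor_vec_add_left: "tensor_vec (\<phi> + \<psi>) k = tensor_vec \<phi> k + tensor_vec \<psi> k"
  by (rule ell2_eqI) (simp add: scaleC_add_left)

lemma tensor_vec_diff_right: "tensor_vec \<phi> (k - l) = tensor_vec \<phi> k - tensor_vec \<phi> l"
  by (rule ell2_eqI) (simp add: scaleC.diff_right)

lemma tensor_vec_ext:
  assumes "\<And>\<phi> k. cinner z (tensor_vec \<phi> k) = 0"
  shows "z = 0"
proof (rule ell2_eqI)
  fix w
  have "cinner (ell2_nth z w) (ell2_nth z w) = 0"
    using assms[of "basis_vec w" "ell2_nth z w"] by (simp add: tensor_vec_basis_vec cinner_single_right)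
  then show "ell2_nth z w = ell2_nth 0 w" by (simp add: cinner_self)
qed

subsection \<open>Coordinatewise operators\<close>

text \<open>On a Fock tensor this is the identity tensor \<open>Y\<close>: a concrete operator to
  put in place of \<open>tensor_op\<close>, which is only a choice. The value is meaningful when
  \<open>Y\<close> is bounded, since then the family is square-summable.\<close>

definition map_ell2 :: "('a::real_normed_vector \<Rightarrow> 'b::real_normed_vector) \<Rightarrow> ('i, 'a) ell2 \<Rightarrow> ('i, 'b) ell2"
  where "map_ell2 Y x = Abs_ell2 (\<lambda>i. Y (ell2_nth x i))"

lemma ell2_nth_map:
  assumes "bounded_linear Y"
  shows "ell2_nth (map_ell2 Y x) i = Y (ell2_nth x i)"
proof -
  obtain K where K: "0 \<le> K" "\<And>x. norm (Y x) \<le> norm x * K"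
    using bounded_linear.nonneg_bounded[OF assms] by blast
  have "(\<lambda>i. (norm (Y (ell2_nth x i)))\<^sup>2) summable_on UNIV"
  proof (rule summable_on_le_real)
    show "(\<lambda>i. (norm (ell2_nth x i))\<^sup>2 * K\<^sup>2) summable_on UNIV"
      by (rule summable_on_cmult_left[OF ell2_nth_summable])
    show "(norm (Y (ell2_nth x i)))\<^sup>2 \<le> (norm (ell2_nth x i))\<^sup>2 * K\<^sup>2" for i
      unfolding power_mult_distrib[symmetric] by (rule power_mono[OF K(2)]) simp
  qed simp
  then show ?thesis by (simp add: map_ell2_def ell2_nth_Abs)
qed

lemma norm_map_ell2_le:
  fixes Y :: "'a::real_inner \<Rightarrow> 'b::real_inner"
  assumes Y: "bounded_linear Y" and K: "0 \<le> K" "\<And>x. norm (Y x) \<le> K * norm x"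
  shows "norm (map_ell2 Y x) \<le> K * norm x"
proof (rule power2_le_imp_le)
  show "(norm (map_ell2 Y x))\<^sup>2 \<le> (K * norm x)\<^sup>2"
  proof (rule norm_ell2_le)
    fix F :: "'c set" assume F: "finite F"
    have "(\<Sum>i\<in>F. (norm (ell2_nth (map_ell2 Y x) i))\<^sup>2) \<le> (\<Sum>i\<in>F. K\<^sup>2 * (norm (ell2_nth x i))\<^sup>2)"
      unfolding ell2_nth_map[OF Y] power_mult_distrib[symmetric]
      by (intro sum_mono power_mono K) simp
    also have "\<dots> \<le> K\<^sup>2 * (norm x)\<^sup>2"
      unfolding sum_distrib_left[symmetric] by (intro mult_left_mono sum_ell2_le F) simp
    finally show "(\<Sum>i\<in>F. (norm (ell2_nth (map_ell2 Y x) i))\<^sup>2) \<le> (K * norm x)\<^sup>2"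
      by (simp add: power_mult_distrib)
  qed
qed (use K in simp)

lemma bounded_op_map_ell2:
  assumes Y: "bounded_op UNIV UNIV Y"
  shows "bounded_op UNIV UNIV (map_ell2 Y)"
proof -
  note bl = bounded_op_linear[OF Y]
  obtain K where K: "0 \<le> K" "\<And>x. norm (Y x) \<le> norm x * K"
    using bounded_linear.nonneg_bounded[OF bl] by blast
  show ?thesis
    unfolding bounded_op_def
    using norm_map_ell2_le[OF bl K(1)] K(2)
    by (auto intro!: ell2_eqI exI[of _ K]
        simp: ell2_nth_map[OF bl] linear_add bl bounded_linear.linear bounded_op_scaleC[OF Y] mult.commute)
qed

lemma map_ell2_tensor_vec:
  assumes Y: "bounded_op UNIV UNIV Y"
  shows "map_ell2 Y (tensor_vec \<phi> k) = tensor_vec \<phi> (Y k)"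
  by (rule ell2_eqI) (simp add: ell2_nth_map[OF bounded_op_linear[OF Y]] bounded_op_scaleC[OF Y])

lemma cinner_map_ell2:
  assumes Y: "bounded_op UNIV UNIV Y"
  shows "cinner (map_ell2 Y x) y = cinner x (map_ell2 (adj Y) y)"
  by (simp add: cinner_ell2_def ell2_nth_map bounded_op_linear Y bounded_op_adj cinner_adj)

subsection \<open>Shifts along injections\<close>

text \<open>For injective \<open>g\<close> this is the isometry sending the basis index
  \<open>w\<close> to \<open>g w\<close>, and \<open>pull g\<close> is its adjoint. Prepending or
  appending a letter gives left or right creation, with coefficients in any Hilbert space.\<close>

definition push :: "('i \<Rightarrow> 'i) \<Rightarrow> ('i, 'a::real_normed_vector) ell2 \<Rightarrow> ('i, 'a) ell2" where
  "push g x = Abs_ell2 (\<lambda>w. if w \<in> range g then ell2_nth x (inv g w) else 0)"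

definition pull :: "('i \<Rightarrow> 'i) \<Rightarrow> ('i, 'a::real_normed_vector) ell2 \<Rightarrow> ('i, 'a) ell2" where
  "pull g x = Abs_ell2 (\<lambda>w. ell2_nth x (g w))"

context
  fixes g :: "'i \<Rightarrow> 'i"
  assumes g: "inj g"
begin

lemma ell2_nth_push: "ell2_nth (push g x) w = (if w \<in> range g then ell2_nth x (inv g w) else 0)"
  by (simp add: push_def ell2_nth_Abs sq_summable_inj_shift[OF ell2_nth_summable g])

lemma ell2_nth_push_image [simp]: "ell2_nth (push g x) (g w) = ell2_nth x w"
  by (simp add: ell2_nth_push g)

lemma ell2_nth_push_other: "w \<notin> range g \<Longrightarrow> ell2_nth (push g x) w = 0"
  by (simp add: ell2_nth_push)

lemma ell2_nth_pull [simp]: "ell2_nth (pull g x) w = ell2_nth x (g w)"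
proof -
  have "(\<lambda>i. (norm (ell2_nth x i))\<^sup>2) summable_on range g"
    by (rule summable_on_subset_banach[OF ell2_nth_summable]) simp
  then have "(\<lambda>w. (norm (ell2_nth x (g w)))\<^sup>2) summable_on UNIV"
    using g by (simp add: summable_on_reindex o_def)
  then show ?thesis by (simp add: pull_def ell2_nth_Abs)
qed

lemma cinner_push: "cinner (push g x) y = cinner x (pull g (y :: ('i, 'a::chilbert_space) ell2))"
proof -
  have "cinner (push g x) y = (\<Sum>\<^sub>\<infinity>w\<in>range g. cinner (ell2_nth (push g x) w) (ell2_nth y w))"
    unfolding cinner_ell2_def by (rule infsum_cong_neutral) (auto simp: ell2_nth_push_other)
  also have "\<dots> = cinner x (pull g y)"
    by (subst infsum_reindex[OF g]) (simp add: cinner_ell2_def o_def)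
  finally show ?thesis .
qed

lemma cinner_pull: "cinner (pull g x) y = cinner x (push g (y :: ('i, 'a::chilbert_space) ell2))"
  using cinner_push[of y x] cinner_commute by metis

lemma pull_push [simp]: "pull g (push g x) = x"
  by (rule ell2_eqI) simp

lemma norm_push [simp]: "norm (push g (x :: ('i, 'a::chilbert_space) ell2)) = norm x"
proof -
  have "complex_of_real ((norm (push g x))\<^sup>2) = complex_of_real ((norm x)\<^sup>2)"
    by (simp only: cinner_self[symmetric] cinner_push pull_push)
  then have "(norm (push g x))\<^sup>2 = (norm x)\<^sup>2" using of_real_eq_iff by blast
  then show ?thesis by simp
qed

lemma bounded_op_push: "bounded_op UNIV UNIV (push g :: ('i, 'a::chilbert_space) ell2 \<Rightarrow> _)"
  unfolding bounded_op_def by (auto intro!: ell2_eqI exI[of _ 1] simp: ell2_nth_push)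

lemma map_ell2_push:
  assumes "bounded_linear Y"
  shows "map_ell2 Y (push g x) = push g (map_ell2 Y x)"
  by (rule ell2_eqI)
    (simp add: ell2_nth_map[OF assms] ell2_nth_push linear_simps(3)[OF assms])

end

lemma push_tensor_vec: "inj g \<Longrightarrow> push g (tensor_vec \<phi> k) = tensor_vec (push g \<phi>) k"
  by (rule ell2_eqI) (simp add: ell2_nth_push)

lemma pull_tensor_vec: "inj g \<Longrightarrow> pull g (tensor_vec \<phi> k) = tensor_vec (pull g \<phi>) k"
  by (rule ell2_eqI) simp

lemma inj_Cons [simp]: "inj ((#) i)"
  by (simp add: inj_def)

lemma inj_append_right [simp]: "inj (\<lambda>w. w @ v)"
  by (simp add: inj_def)

lemma left_creation_eq_push: "left_creation i = push ((#) i)"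
proof (intro ext ell2_eqI)
  fix x :: "'a fock" and w
  show "ell2_nth (left_creation i x) w = ell2_nth (push ((#) i) x) w"
    using ell2_nth_push_image[OF inj_Cons, of i x "tl w"]
    by (cases w) (auto simp: left_creation.rep_eq ell2_nth_push_other image_iff)
qed

lemma right_creation_eq_push: "right_creation i = push (\<lambda>w. w @ [i])"
proof (intro ext ell2_eqI)
  fix x :: "'a fock" and w
  show "ell2_nth (right_creation i x) w = ell2_nth (push (\<lambda>w. w @ [i]) x) w"
    using ell2_nth_push_image[OF inj_append_right, of "[i]" x "butlast w"]
    by (cases w rule: rev_cases) (auto simp: right_creation.rep_eq ell2_nth_push_other image_iff)
qed

section \<open>Tensor products with closed subspaces\<close>

lemma ortho_compl_ccspan: "ortho_compl (ccspan A) = ortho_compl A"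
proof
  show "ortho_compl (ccspan A) \<subseteq> ortho_compl A"
    using ccspan_superset[of A] by (auto simp: ortho_compl_def)
  have "A \<subseteq> ortho_compl (ortho_compl A)"
    by (auto simp: ortho_compl_def cinner_eq_zero_commute)
  then have "ccspan A \<subseteq> ortho_compl (ortho_compl A)" by (rule ccspan_minimal) auto
  then show "ortho_compl A \<subseteq> ortho_compl (ccspan A)"
    unfolding ortho_compl_def using cinner_eq_zero_commute by blast
qed

lemma csubspace_tensor_space [simp]: "csubspace (tensor_space N K)"
  and closed_tensor_space [simp]: "closed (tensor_space N K)"
  by (simp_all add: tensor_space_def)

lemma tensor_vec_in_tensor_space: "\<phi> \<in> N \<Longrightarrow> k \<in> K \<Longrightarrow> tensor_vec \<phi> k \<in> tensor_space N K"
  unfolding tensor_space_def by (rule subsetD[OF ccspan_superset]) blast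

lemma ortho_compl_tensor_space_iff:
  "z \<in> ortho_compl (tensor_space N K) \<longleftrightarrow> (\<forall>\<phi>\<in>N. \<forall>k\<in>K. cinner z (tensor_vec \<phi> k) = 0)"
  unfolding tensor_space_def ortho_compl_ccspan by (auto simp: ortho_compl_def)

lemma cinner_tensor_space_ortho:
  fixes z :: "('n, 'a::chilbert_space) fock_tensor"
  assumes "z \<in> tensor_space N UNIV" "\<phi> \<in> ortho_compl N"
  shows "cinner z (tensor_vec \<phi> k) = 0"
proof -
  have "tensor_space N (UNIV :: 'a set) \<subseteq> ortho_compl {tensor_vec \<phi> k |\<phi> k. \<phi> \<in> ortho_compl N}"
    unfolding tensor_space_def
  proof (rule ccspan_minimal)
    show "{tensor_vec \<phi> k |\<phi> k. \<phi> \<in> N \<and> k \<in> UNIV}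
        \<subseteq> ortho_compl {tensor_vec \<phi> k |\<phi> k. \<phi> \<in> ortho_compl N}"
      by (auto simp: ortho_compl_def cinner_tensor_vec) (use cinner_eq_zero_commute in blast)
  qed simp_all
  then have "z \<in> ortho_compl {tensor_vec \<phi> k |\<phi> k. \<phi> \<in> ortho_compl N}" using assms(1) by blast
  then show ?thesis by (rule ortho_complD) (use assms(2) in blast)
qed

text \<open>A dual description of N tensor H as the complement of the elementary tensors over the
  complement of \<open>N\<close>. Membership becomes a test by inner products, in which operators
  can be moved to the other side.\<close>

lemma tensor_space_UNIV_iff:
  fixes z :: "('n, 'a::chilbert_space) fock_tensor"
  assumes N: "csubspace N" "closed N"
  shows "z \<in> tensor_space N UNIV \<longleftrightarrow> (\<forall>\<phi>\<in>ortho_compl N. \<forall>k. cinner z (tensor_vec \<phi> k) = 0)"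
proof (intro iffI ballI allI)
  assume z: "\<forall>\<phi>\<in>ortho_compl N. \<forall>k. cinner z (tensor_vec \<phi> k) = 0"
  let ?p = "proj (tensor_space N UNIV) z"
  have p: "?p \<in> tensor_space N UNIV" "z - ?p \<in> ortho_compl (tensor_space N UNIV)"
    by (simp_all add: proj_in proj_ortho)
  have "z - ?p = 0"
  proof (rule tensor_vec_ext)
    fix \<phi> :: "'n fock" and k :: 'a
    have "tensor_vec \<phi> k = tensor_vec (proj N \<phi>) k + tensor_vec (\<phi> - proj N \<phi>) k"
      by (simp add: tensor_vec_add_left[symmetric])
    moreover have "cinner (z - ?p) (tensor_vec (proj N \<phi>) k) = 0"
      using p(2) proj_in[OF N] by (simp add: ortho_compl_tensor_space_iff)
    moreover have "cinner (z - ?p) (tensor_vec (\<phi> - proj N \<phi>) k) = 0"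
      using z cinner_tensor_space_ortho[OF p(1)] proj_ortho[OF N] by (simp add: cinner.diff_left)
    ultimately show "cinner (z - ?p) (tensor_vec \<phi> k) = 0" by (simp add: cinner.add_right)
  qed
  then show "z \<in> tensor_space N UNIV" using p(1) by simp
qed (rule cinner_tensor_space_ortho)

lemma tensor_space_mono: "K \<subseteq> K' \<Longrightarrow> tensor_space N K \<subseteq> tensor_space N K'"
  unfolding tensor_space_def[of N K] by (rule ccspan_minimal) (auto intro: tensor_vec_in_tensor_space)

lemma ell2_nth_tensor_space:
  fixes z :: "('n, 'a::chilbert_space) fock_tensor"
  assumes K: "csubspace K" "closed K" and z: "z \<in> tensor_space N K"
  shows "ell2_nth z w \<in> K"
proof -
  interpret e: bounded_linear "\<lambda>z::('n, 'a) fock_tensor. ell2_nth z w"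
    by (rule bounded_op_linear[OF bounded_op_ell2_nth])
  have "closed ((\<lambda>z::('n, 'a) fock_tensor. ell2_nth z w) -` K)"
    by (intro continuous_closed_vimage K) (simp add: e.continuous)
  moreover have "csubspace ((\<lambda>z::('n, 'a) fock_tensor. ell2_nth z w) -` K)"
    using K(1) by (auto simp: csubspace_def)
  ultimately have "tensor_space N K \<subseteq> (\<lambda>z. ell2_nth z w) -` K"
    unfolding tensor_space_def using K(1) by (intro ccspan_minimal) (auto simp: csubspace_def)
  then show ?thesis using z by blast
qed

text \<open>Split a test coefficient \<open>k\<close> into its projection to \<open>K\<close> and
  the rest: the rest is orthogonal to all values of \<open>z\<close> and of its projection. Hence a
  single projection onto N tensor H serves all coefficient spaces.\<close>

lemma proj_tensor_space_eq:
  fixes z :: "('n, 'a::chilbert_space) fock_tensor"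
  assumes N: "csubspace N" "closed N" and K: "csubspace K" "closed K" and z: "\<And>w. ell2_nth z w \<in> K"
  shows "proj (tensor_space N UNIV) z = proj (tensor_space N K) z"
proof (rule proj_eqI[OF csubspace_tensor_space])
  let ?p = "proj (tensor_space N K) z"
  have p: "?p \<in> tensor_space N K" "z - ?p \<in> ortho_compl (tensor_space N K)"
    by (simp_all add: proj_in proj_ortho)
  show "?p \<in> tensor_space N UNIV" using p(1) tensor_space_mono[of K UNIV N] by blast
  have "cinner (z - ?p) (tensor_vec \<phi> k) = 0" if "\<phi> \<in> N" for \<phi> k
  proof -
    have 1: "cinner (z - ?p) (tensor_vec \<phi> (proj K k)) = 0"
      using p(2) proj_in[OF K] that by (simp add: ortho_compl_tensor_space_iff)
    have "cinner (ell2_nth (z - ?p) w) (k - proj K k) = 0" for w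
      using ortho_complD[OF proj_ortho[OF K, of k]] csubspace_diff[OF K(1) z ell2_nth_tensor_space[OF K p(1)]]
      by (simp add: cinner_eq_zero_commute)
    then have "cinner (z - ?p) (tensor_vec \<phi> (k - proj K k)) = 0"
      by (simp add: cinner_ell2_def cinner_scaleC_right)
    with 1 show ?thesis by (simp add: tensor_vec_diff_right cinner.diff_right)
  qed
  then show "z - ?p \<in> ortho_compl (tensor_space N UNIV)" by (simp add: ortho_compl_tensor_space_iff)
qed

lemma tensor_space_iff:
  assumes N: "csubspace N" "closed N" and K: "csubspace K" "closed K"
  shows "z \<in> tensor_space N K \<longleftrightarrow> z \<in> tensor_space N UNIV \<and> (\<forall>w. ell2_nth z w \<in> K)"
proof
  assume "z \<in> tensor_space N K"
  then show "z \<in> tensor_space N UNIV \<and> (\<forall>w. ell2_nth z w \<in> K)"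
    using tensor_space_mono[of K UNIV N] ell2_nth_tensor_space[OF K] by blast
next
  assume z: "z \<in> tensor_space N UNIV \<and> (\<forall>w. ell2_nth z w \<in> K)"
  then have "z = proj (tensor_space N K) z"
    using proj_tensor_space_eq[OF N K, of z] proj_id[of "tensor_space N UNIV" z] by simp
  then show "z \<in> tensor_space N K" using proj_in[of "tensor_space N K" z] by simp
qed

section \<open>Evaluating tensor products of operators\<close>

lemma bounded_op_zero_on_ccspan:
  assumes f: "bounded_op (ccspan A) UNIV f" and 0: "\<And>a. a \<in> A \<Longrightarrow> f a = 0" and x: "x \<in> ccspan A"
  shows "f x = 0"
proof -
  have f': "f (x + y) = f x + f y" "f (c *\<^sub>C x) = c *\<^sub>C f x"
    if "x \<in> ccspan A" "y \<in> ccspan A" for x y c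
    using f that by (auto simp: bounded_op_def)
  obtain K where K: "\<And>x. x \<in> ccspan A \<Longrightarrow> norm (f x) \<le> K * norm x"
    using f unfolding bounded_op_def by blast
  have cs: "csubspace (ccspan A)" by simp
  let ?Z = "{x \<in> ccspan A. f x = 0}"
  have f0: "f 0 = 0" using f'(2)[of 0 0 0] cs by (simp add: csubspace_def)
  have "csubspace ?Z" using cs f' f0 by (auto simp: csubspace_def)
  moreover have "closed ?Z"
    unfolding closed_sequential_limits
  proof (intro allI impI)
    fix u l assume u: "(\<forall>n. u n \<in> ?Z) \<and> u \<longlonglongrightarrow> l"
    then have l: "l \<in> ccspan A"
      using closed_sequentially[OF closed_ccspan, of u A l] by blast
    have "norm (f l) \<le> K * norm (l - u n)" for n
    proof -
      have d: "l - u n \<in> ccspan A" using u l by (intro csubspace_diff) auto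
      then have "f (l - u n + u n) = f (l - u n) + f (u n)" using u by (intro f') auto
      then show ?thesis using K[OF d] u by simp
    qed
    moreover have "(\<lambda>n. K * norm (l - u n)) \<longlonglongrightarrow> K * norm (l - l)"
      using u by (intro tendsto_intros) auto
    ultimately have "norm (f l) \<le> K * norm (l - l)" by (meson LIMSEQ_le_const)
    then show "l \<in> ?Z" using l by simp
  qed
  ultimately have "ccspan A \<subseteq> ?Z" using 0 ccspan_superset by (intro ccspan_minimal) blast
  then show ?thesis using x by blast
qed

text \<open>This eliminates the choice in \<open>tensor_op\<close>: \<open>Z\<close> witnesses that
  a suitable operator exists, and two bounded operators agreeing on elementary tensors agree on the
  closed span.\<close>

lemma tensor_op_eqI:
  assumes Z: "bounded_op UNIV UNIV Z"
    and eq: "\<And>\<phi> k. \<phi> \<in> N \<Longrightarrow> k \<in> K \<Longrightarrow> Z (tensor_vec \<phi> k) = tensor_vec (X \<phi>) (Y k)"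
    and x: "x \<in> tensor_space N K"
  shows "tensor_op N K X Y x = Z x"
proof -
  let ?P = "\<lambda>Z. bounded_op (tensor_space N K) UNIV Z \<and>
     (\<forall>\<phi>\<in>N. \<forall>k\<in>K. Z (tensor_vec \<phi> k) = tensor_vec (X \<phi>) (Y k))"
  have "?P Z" using bounded_op_subset[OF Z] eq by auto
  then have Z': "?P (tensor_op N K X Y)" unfolding tensor_op_def by (rule someI[of ?P])
  let ?D = "\<lambda>x. tensor_op N K X Y x - Z x"
  have bZ: "bounded_op (tensor_space N K) UNIV Z" using bounded_op_subset[OF Z] by auto
  obtain a where a: "\<And>x. x \<in> tensor_space N K \<Longrightarrow> norm (tensor_op N K X Y x) \<le> a * norm x"
    using Z' unfolding bounded_op_def by blast
  obtain b where b: "\<And>x. x \<in> tensor_space N K \<Longrightarrow> norm (Z x) \<le> b * norm x"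
    using bZ unfolding bounded_op_def by blast
  have "norm (?D x) \<le> (a + b) * norm x" if "x \<in> tensor_space N K" for x
    using a[OF that] b[OF that] norm_triangle_ineq4[of "tensor_op N K X Y x" "Z x"]
    by (simp add: distrib_right)
  then have "bounded_op (tensor_space N K) UNIV ?D"
    using Z' bZ by (auto simp: bounded_op_def scaleC.diff_right)
  then have "?D x = 0"
    using x eq Z' unfolding tensor_space_def by (elim bounded_op_zero_on_ccspan) auto
  then show ?thesis by simp
qed

lemma proj_tensor_vec:
  assumes N: "csubspace N" "closed N" and k: "k \<in> K"
  shows "proj (tensor_space N K) (tensor_vec \<phi> k) = tensor_vec (proj N \<phi>) k"
proof (rule proj_eqI)
  show "tensor_vec (proj N \<phi>) k \<in> tensor_space N K"
    using proj_in[OF N] k by (rule tensor_vec_in_tensor_space)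
  have "tensor_vec \<phi> k - tensor_vec (proj N \<phi>) k = tensor_vec (\<phi> - proj N \<phi>) k"
    by (rule ell2_eqI) (simp add: scaleC.diff_left)
  then show "tensor_vec \<phi> k - tensor_vec (proj N \<phi>) k \<in> ortho_compl (tensor_space N K)"
    using ortho_complD[OF proj_ortho[OF N, of \<phi>]]
    by (simp add: ortho_compl_tensor_space_iff cinner_tensor_vec)
qed simp

lemma map_ell2_tensor_space:
  assumes N: "csubspace N" "closed N" and Y: "bounded_op UNIV UNIV Y" and z: "z \<in> tensor_space N UNIV"
  shows "map_ell2 Y z \<in> tensor_space N UNIV"
  using z by (simp add: tensor_space_UNIV_iff[OF N] cinner_map_ell2[OF Y] map_ell2_tensor_vec
      bounded_op_adj Y)

lemma map_ell2_ortho_compl: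
  assumes Y: "bounded_op UNIV UNIV Y" and z: "z \<in> ortho_compl (tensor_space N UNIV)"
  shows "map_ell2 Y z \<in> ortho_compl (tensor_space N UNIV)"
  using z by (simp add: ortho_compl_tensor_space_iff cinner_map_ell2[OF Y] map_ell2_tensor_vec
      bounded_op_adj Y)

lemma proj_map_ell2:
  fixes z :: "('n, 'a::chilbert_space) fock_tensor"
  assumes N: "csubspace N" "closed N" and Y: "bounded_op UNIV UNIV Y"
  shows "proj (tensor_space N UNIV) (map_ell2 Y z) = map_ell2 Y (proj (tensor_space N UNIV) z)"
proof (rule proj_eqI)
  interpret m: bounded_linear "map_ell2 Y :: ('n, 'a) fock_tensor \<Rightarrow> _"
    by (rule bounded_op_linear[OF bounded_op_map_ell2[OF Y]])
  show "map_ell2 Y z - map_ell2 Y (proj (tensor_space N UNIV) z) \<in> ortho_compl (tensor_space N UNIV)"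
    unfolding m.diff[symmetric] by (intro map_ell2_ortho_compl[OF Y] proj_ortho) simp_all
qed (simp_all add: map_ell2_tensor_space[OF N Y] proj_in)

text \<open>Invariance of \<open>N\<close> under the adjoint \<open>pull g\<close> is invariance of
  its complement under \<open>push g\<close>.\<close>

lemma push_ortho_compl:
  assumes g: "inj g" and N: "\<And>\<phi>. \<phi> \<in> N \<Longrightarrow> pull g \<phi> \<in> N"
    and z: "z \<in> ortho_compl (tensor_space N UNIV)"
  shows "push g z \<in> ortho_compl (tensor_space N UNIV)"
  using z N by (simp add: ortho_compl_tensor_space_iff cinner_push[OF g] pull_tensor_vec[OF g])

lemma pull_tensor_space:
  assumes g: "inj g" and N: "\<And>\<phi>. \<phi> \<in> N \<Longrightarrow> pull g \<phi> \<in> N" "csubspace N" "closed N"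
    and K: "csubspace K" "closed K" and z: "z \<in> tensor_space N K"
  shows "pull g z \<in> tensor_space N K"
proof -
  have "push g \<phi> \<in> ortho_compl N" if "\<phi> \<in> ortho_compl N" for \<phi>
    using that N(1) by (auto simp: ortho_compl_def cinner_push[OF g])
  then show ?thesis
    using z by (simp add: tensor_space_iff[OF N(2,3) K] tensor_space_UNIV_iff[OF N(2,3)] g
        cinner_pull[OF g] push_tensor_vec[OF g])
qed

section \<open>Sums over words\<close>

lemma finite_words_length [simp]: "finite {w::'n::finite list. length w = k}"
  using finite_lists_length_eq[of "UNIV::'n set" k] by simp

lemma sum_words_append:
  fixes f :: "'n::finite list \<Rightarrow> 'b::comm_monoid_add"
  shows "(\<Sum>w | length w = p + k. f w) = (\<Sum>v | length v = p. \<Sum>u | length u = k. f (v @ u))"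
proof -
  have "(\<Sum>v | length v = p. \<Sum>u | length u = k. f (v @ u))
      = (\<Sum>(v, u)\<in>{v. length v = p} \<times> {u. length u = k}. f (v @ u))"
    by (rule sum.cartesian_product)
  also have "\<dots> = (\<Sum>w | length w = p + k. f w)"
    by (rule sum.reindex_bij_witness[of _ "\<lambda>w. (take p w, drop p w)" "\<lambda>(v, u). v @ u"]) auto
  finally show ?thesis by simp
qed

lemma sum_words_Suc:
  fixes f :: "'n::finite list \<Rightarrow> 'b::comm_monoid_add"
  shows "(\<Sum>w | length w = Suc m. f w) = (\<Sum>v | length v = m. \<Sum>i\<in>UNIV. f (v @ [i]))"
proof -
  have "(\<Sum>u | length u = 1. f (v @ u)) = (\<Sum>i\<in>UNIV. f (v @ [i]))" for v
    by (rule sum.reindex_bij_witness[of _ "\<lambda>i. [i]" hd]) (auto simp: length_Suc_conv)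
  then show ?thesis using sum_words_append[of f m 1] by simp
qed

lemma finite_words_subset_levels:
  assumes "finite (F :: 'n list set)"
  shows "\<exists>m. F \<subseteq> (\<Union>k<m. {w. length w = k})"
  using assms
proof induction
  case (insert w F)
  then obtain m where m: "F \<subseteq> (\<Union>k<m. {w. length w = k})" by blast
  have "insert w F \<subseteq> (\<Union>k<max m (Suc (length w)). {w. length w = k})"
    using m by (auto simp: subset_iff)
  then show ?case by blast
qed simp

lemma sum_levels:
  fixes f :: "'n::finite list \<Rightarrow> real"
  shows "(\<Sum>k<m. \<Sum>w | length w = k. f w) = sum f (\<Union>k<m. {w. length w = k})"
  by (subst sum.UNION_disjoint) auto

lemma summable_words_levels:
  fixes f :: "'n::finite list \<Rightarrow> real"
  assumes f: "\<And>w. 0 \<le> f w" and le: "\<And>m. (\<Sum>k<m. \<Sum>w | length w = k. f w) \<le> s"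
  shows "f summable_on UNIV"
proof (rule nonneg_bdd_above_summable_on)
  show "bdd_above (sum f ` {F. F \<subseteq> UNIV \<and> finite F})"
  proof (rule bdd_aboveI2)
    fix F :: "'n list set" assume F: "F \<in> {F. F \<subseteq> UNIV \<and> finite F}"
    then obtain m where m: "F \<subseteq> (\<Union>k<m. {w. length w = k})"
      using finite_words_subset_levels by blast
    then have "sum f F \<le> sum f (\<Union>k<m. {w. length w = k})" using f by (intro sum_mono2) auto
    then show "sum f F \<le> s" using le[of m] by (simp add: sum_levels)
  qed
qed (use f in blast)

text \<open>Energy is balanced level by level in the word length, whereas norms are unordered sums.
  The two agree because every finite set of words lies below some level and each level is
  finite.\<close>

lemma tendsto_sum_levels:
  fixes f :: "'n::finite list \<Rightarrow> real"
  assumes f: "\<And>w. 0 \<le> f w" and s: "f summable_on UNIV"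
  shows "(\<lambda>m. \<Sum>k<m. \<Sum>w | length w = k. f w) \<longlonglongrightarrow> infsum f UNIV"
proof (rule LIMSEQ_I)
  fix e :: real assume e: "0 < e"
  have "(sum f \<longlongrightarrow> infsum f UNIV) (finite_subsets_at_top UNIV)"
    using has_sum_infsum[OF s] by (simp add: has_sum_def)
  then have "\<forall>\<^sub>F A in finite_subsets_at_top UNIV. infsum f UNIV - e < sum f A"
    using e by (intro order_tendstoD(1)) auto
  then obtain A where A: "finite A" "infsum f UNIV - e < sum f A"
    by (auto simp: eventually_finite_subsets_at_top)
  obtain M where M: "A \<subseteq> (\<Union>k<M. {w. length w = k})" using finite_words_subset_levels[OF A(1)] by blast
  have "norm ((\<Sum>k<m. \<Sum>w | length w = k. f w) - infsum f UNIV) < e" if m: "m \<ge> M" for m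
  proof -
    have "sum f A \<le> sum f (\<Union>k<m. {w. length w = k})"
      using M m f by (intro sum_mono2) fastforce+
    moreover have "sum f (\<Union>k<m. {w. length w = k}) \<le> infsum f UNIV"
      using f by (intro finite_sum_le_infsum s) auto
    ultimately show ?thesis using A(2) by (simp add: sum_levels)
  qed
  then show "\<exists>M. \<forall>m\<ge>M. norm ((\<Sum>k<m. \<Sum>w | length w = k. f w) - infsum f UNIV) < e" by blast
qed

lemma infsum_words_levels:
  fixes f :: "'n::finite list \<Rightarrow> real"
  assumes "\<And>w. 0 \<le> f w" "f summable_on UNIV"
    "(\<lambda>m. \<Sum>k<m. \<Sum>w | length w = k. f w) \<longlonglongrightarrow> s"
  shows "infsum f UNIV = s"
  using LIMSEQ_unique[OF tendsto_sum_levels[OF assms(1,2)] assms(3)] .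

lemma sum_levels_le_norm:
  "(\<Sum>k<m. \<Sum>w | length w = k. (norm (ell2_nth x w))\<^sup>2) \<le> (norm (x::('n::finite list, 'a::real_inner) ell2))\<^sup>2"
  unfolding sum_levels by (rule sum_ell2_le) auto

lemma ell2_nth_partial_sum:
  fixes x :: "('n::finite list, 'a::real_inner) ell2"
  shows "ell2_nth (\<Sum>k<m. \<Sum>w | length w = k. ell2_single w (ell2_nth x w)) v
    = (if length v < m then ell2_nth x v else 0)"
proof -
  have "(\<Sum>w | length w = k. ell2_nth (ell2_single w (ell2_nth x w)) v)
      = (if k = length v then ell2_nth x v else 0)" for k
    by (simp add: ell2_nth_single sum.delta)
  then show ?thesis by simp
qed

lemma sums_words_single:
  fixes x :: "('n::finite list, 'a::real_inner) ell2"
  shows "(\<lambda>k. \<Sum>w | length w = k. ell2_single w (ell2_nth x w)) sums x"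
  unfolding sums_def
proof (rule tendsto_ell2_coordinatewise)
  let ?p = "\<lambda>m. \<Sum>k<m. \<Sum>w | length w = k. ell2_single w (ell2_nth x w)"
  fix w
  have "\<forall>\<^sub>F m in sequentially. ell2_nth (?p m) w = ell2_nth x w"
    unfolding ell2_nth_partial_sum by (rule eventually_sequentiallyI[of "Suc (length w)"]) simp
  then show "(\<lambda>m. ell2_nth (?p m) w) \<longlonglongrightarrow> ell2_nth x w" by (rule tendsto_eventually)
next
  let ?p = "\<lambda>m. \<Sum>k<m. \<Sum>w | length w = k. ell2_single w (ell2_nth x w)"
  have "(norm (?p m))\<^sup>2 \<le> (norm x)\<^sup>2" for m
    by (rule norm_ell2_le, rule order_trans[OF _ sum_ell2_le])
      (auto simp: ell2_nth_partial_sum simp del: ell2_nth_sum intro!: sum_mono)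
  then show "\<forall>\<^sub>F m in sequentially. norm (?p m) \<le> norm x"
    by (intro always_eventually allI power2_le_imp_le[OF _ norm_ge_zero])
qed

section \<open>Row contractions\<close>

lemma norm_vec_sq: "(norm (x::'a::real_inner ^ 'n::finite))\<^sup>2 = (\<Sum>i\<in>UNIV. (norm (x $ i))\<^sup>2)"
  by (simp add: power2_norm_eq_inner inner_vec_def)

lemma inner_adj:
  "bounded_op UNIV UNIV (A::'a::chilbert_space \<Rightarrow> 'b::chilbert_space) \<Longrightarrow> inner (A x) y = inner x (adj A y)"
  by (simp add: Re_cinner[symmetric] cinner_adj)

lemma bounded_op_vec_nth: "bounded_op UNIV UNIV (\<lambda>x::'a::chilbert_space ^ 'n::finite. x $ i)"
  by (auto simp: bounded_op_def scaleC_vec_def intro!: exI[of _ 1] Finite_Cartesian_Product.norm_nth_le)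

lemma vec_nth_scaleC [simp]: "(c *\<^sub>C x) $ i = c *\<^sub>C (x $ i)"
  by (simp add: scaleC_vec_def)

lemma word_op_Nil [simp]: "word_op T [] = id"
  by (simp add: word_op_def)

lemma word_op_Cons: "word_op T (i # w) = T i \<circ> word_op T w"
  by (simp add: word_op_def)

lemma word_op_append: "word_op T (v @ w) = word_op T v \<circ> word_op T w"
  by (induction v) (simp_all only: word_op_Nil word_op_Cons append.simps comp_assoc id_comp)

lemma bounded_op_word_op:
  assumes "\<And>i. bounded_op UNIV UNIV (T i)"
  shows "bounded_op UNIV UNIV (word_op T w)"
  by (induction w) (simp_all only: word_op_Nil word_op_Cons bounded_op_id bounded_op_compose assms)

lemma adj_word_op_snoc:
  assumes "\<And>i. bounded_op UNIV UNIV (T i)"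
  shows "adj (word_op T (w @ [j])) = adj (T j) \<circ> adj (word_op T w)"
  by (simp only: word_op_append word_op_Cons word_op_Nil comp_id adj_compose bounded_op_word_op assms)

lemma csubspace_range:
  assumes f: "bounded_op UNIV UNIV f"
  shows "csubspace (range f)"
proof -
  interpret f: bounded_linear f using f by (rule bounded_op_linear)
  show ?thesis
    unfolding csubspace_def
    by (auto simp: f.add[symmetric] bounded_op_scaleC[OF f, symmetric] image_iff intro: exI[of _ 0])
qed

lemma adj_ident [simp]: "adj (\<lambda>x::'a::chilbert_space. x) = (\<lambda>x. x)"
  by (rule adj_eqI) simp

locale row_contr =
  fixes T :: "'n::finite \<Rightarrow> 'h::chilbert_space \<Rightarrow> 'h"
  assumes row_contraction: "row_contraction T"
begin

abbreviation "Trow \<equiv> row_op T"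
abbreviation "Tadj \<equiv> adj (row_op T)"
abbreviation "\<Delta> \<equiv> defect T"
abbreviation "\<Delta>s \<equiv> defect_star T"

lemma bounded_op_T [simp]: "bounded_op UNIV UNIV (T i)"
  using row_contraction by (simp add: row_contraction_def)

lemma bounded_op_Trow [simp]: "bounded_op UNIV UNIV Trow"
proof -
  have "bounded_linear (\<lambda>x. T i (x $ i))" for i
    by (rule bounded_linear_compose[OF bounded_op_linear[OF bounded_op_T] bounded_linear_vec_nth])
  then have "bounded_linear Trow"
    unfolding row_op_def[abs_def] by (intro bounded_linear_sum)
  moreover have "Trow (c *\<^sub>C x) = c *\<^sub>C Trow x" for c x
    by (simp add: row_op_def bounded_op_scaleC scaleC.sum_right)
  ultimately show ?thesis by (simp add: bounded_op_UNIV_iff)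
qed

lemma bounded_op_Tadj [simp]: "bounded_op UNIV UNIV Tadj"
  by (simp add: bounded_op_adj)

lemma Tadj_nth [simp]: "Tadj h $ i = adj (T i) h"
proof -
  have "Tadj = (\<lambda>h. \<chi> i. adj (T i) h)"
    by (rule adj_eqI) (simp add: row_op_def cinner_vec_def cinner.sum_left cinner_adj)
  then show ?thesis by simp
qed

lemma norm_Tadj_le: "norm (Tadj h) \<le> norm h"
proof -
  have "0 \<le> Re (cinner (h - Trow (Tadj h)) h)"
    using row_contraction by (simp add: row_contraction_def positive_op_def)
  then have "(norm (Tadj h))\<^sup>2 \<le> (norm h)\<^sup>2"
    by (simp add: Re_cinner inner_diff_left inner_adj power2_norm_eq_inner)
  then show ?thesis by (rule power2_le_imp_le) simp
qed

lemma norm_Trow_le: "norm (Trow x) \<le> norm x"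
proof (cases "Trow x = 0")
  case False
  have "(norm (Trow x))\<^sup>2 = inner x (Tadj (Trow x))"
    by (simp add: power2_norm_eq_inner inner_adj)
  also have "\<dots> \<le> norm x * norm (Tadj (Trow x))" by (rule norm_cauchy_schwarz)
  also have "\<dots> \<le> norm x * norm (Trow x)" by (intro mult_left_mono norm_Tadj_le) simp
  finally show ?thesis using False by (simp add: power2_eq_square)
qed simp

lemma cinner_Tadj: "cinner (Tadj h) x = cinner h (Trow x)"
  by (simp add: cinner_adj_left)

lemma selfadjoint_contraction_Trow: "selfadjoint_contraction (\<lambda>h. Trow (Tadj h))"
proof
  show "bounded_op UNIV UNIV (\<lambda>h. Trow (Tadj h))"
    using bounded_op_compose[OF bounded_op_Trow bounded_op_Tadj] by (simp add: o_def)
  show "cinner (Trow (Tadj x)) y = cinner x (Trow (Tadj y))" for x y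
    by (simp add: cinner_adj cinner_Tadj)
  show "norm (Trow (Tadj x)) \<le> norm x" for x
    using norm_Trow_le norm_Tadj_le order_trans by blast
qed

lemma selfadjoint_contraction_Tadj: "selfadjoint_contraction (\<lambda>x. Tadj (Trow x))"
proof
  show "bounded_op UNIV UNIV (\<lambda>h. Tadj (Trow h))"
    using bounded_op_compose[OF bounded_op_Tadj bounded_op_Trow] by (simp add: o_def)
  show "cinner (Tadj (Trow x)) y = cinner x (Tadj (Trow y))" for x y
    by (simp add: cinner_Tadj) (simp add: cinner_adj)
  show "norm (Tadj (Trow x)) \<le> norm x" for x
    using norm_Trow_le norm_Tadj_le order_trans by blast
qed

lemma defect_eq_root: "\<Delta> = selfadjoint_contraction.root (\<lambda>h. Trow (Tadj h))"
  unfolding defect_def by (rule selfadjoint_contraction.sqrt_op_eq_root[OF selfadjoint_contraction_Trow])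

lemma defect_star_eq_root: "\<Delta>s = selfadjoint_contraction.root (\<lambda>x. Tadj (Trow x))"
  unfolding defect_star_def
  by (rule selfadjoint_contraction.sqrt_op_eq_root[OF selfadjoint_contraction_Tadj])

lemma bounded_op_defect [simp]: "bounded_op UNIV UNIV \<Delta>"
  using selfadjoint_contraction.positive_root[OF selfadjoint_contraction_Trow]
  by (simp add: positive_op_def defect_eq_root)

lemma bounded_op_defect_star [simp]: "bounded_op UNIV UNIV \<Delta>s"
  using selfadjoint_contraction.positive_root[OF selfadjoint_contraction_Tadj]
  by (simp add: positive_op_def defect_star_eq_root)

sublocale T: bounded_linear "T i" for i by (rule bounded_op_linear) simp
sublocale Trow: bounded_linear Trow by (rule bounded_op_linear) simp
sublocale Tadj: bounded_linear Tadj by (rule bounded_op_linear) simp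
sublocale \<Delta>: bounded_linear \<Delta> by (rule bounded_op_linear) simp
sublocale \<Delta>s: bounded_linear \<Delta>s by (rule bounded_op_linear) simp

lemma Trow_defect_star: "Trow (\<Delta>s x) = \<Delta> (Trow x)"
  unfolding defect_eq_root defect_star_eq_root
  by (rule root_intertwine[OF selfadjoint_contraction_Tadj selfadjoint_contraction_Trow
        Trow.bounded_linear]) simp

lemma Tadj_defect: "Tadj (\<Delta> h) = \<Delta>s (Tadj h)"
  unfolding defect_eq_root defect_star_eq_root
  by (rule root_intertwine[OF selfadjoint_contraction_Trow selfadjoint_contraction_Tadj
        Tadj.bounded_linear]) simp

lemma defect_sq: "\<Delta> (\<Delta> h) = h - Trow (Tadj h)"
  unfolding defect_eq_root
  by (rule selfadjoint_contraction.root_root[OF selfadjoint_contraction_Trow])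

lemma defect_star_sq: "\<Delta>s (\<Delta>s x) = x - Tadj (Trow x)"
  unfolding defect_star_eq_root
  by (rule selfadjoint_contraction.root_root[OF selfadjoint_contraction_Tadj])

lemma defect_selfadjoint: "cinner (\<Delta> h) g = cinner h (\<Delta> g)"
  unfolding defect_eq_root
  by (rule selfadjoint_contraction.root_selfadjoint[OF selfadjoint_contraction_Trow])

lemma defect_star_selfadjoint: "cinner (\<Delta>s h) g = cinner h (\<Delta>s g)"
  unfolding defect_star_eq_root
  by (rule selfadjoint_contraction.root_selfadjoint[OF selfadjoint_contraction_Tadj])

text \<open>Unitarity of the Julia operator with rows \<open>(T\<^sup>*, \<Delta>\<^bsub>T*\<^esub>)\<close> and \<open>(\<Delta>\<^bsub>T\<^esub>, -T)\<close>.\<close>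

lemma julia_isometry:
  "(norm (Tadj h + \<Delta>s x))\<^sup>2 + (norm (\<Delta> h - Trow x))\<^sup>2 = (norm h)\<^sup>2 + (norm x)\<^sup>2"
proof -
  have i1: "inner (\<Delta> h) g = inner h (\<Delta> g)" for h g
    by (simp add: Re_cinner[symmetric] defect_selfadjoint)
  have i2: "inner (\<Delta>s h) g = inner h (\<Delta>s g)" for h g
    by (simp add: Re_cinner[symmetric] defect_star_selfadjoint)
  have i3: "inner (Tadj h) y = inner h (Trow y)" for h y
    by (simp add: Re_cinner[symmetric] cinner_Tadj)
  have i4: "inner (Trow x) (Trow x) = inner x (Tadj (Trow x))"
    by (simp add: inner_adj)
  show ?thesis
    unfolding power2_norm_eq_inner
    by (simp add: inner_add_left inner_add_right inner_diff_left inner_diff_right i3 i4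
        inner_commute[of "\<Delta>s x" "Tadj h"] inner_commute[of "Trow x" "\<Delta> h"] Trow_defect_star)
      (simp add: i1 i2 defect_sq defect_star_sq inner_diff_right)
qed

lemma csubspace_defect_space [simp]: "csubspace (defect_space T)"
  by (simp add: defect_space_def csubspace_closure csubspace_range)

lemma closed_defect_space [simp]: "closed (defect_space T)"
  by (simp add: defect_space_def)

lemma csubspace_defect_star_space [simp]: "csubspace (defect_star_space T)"
  by (simp add: defect_star_space_def csubspace_closure csubspace_range)

lemma closed_defect_star_space [simp]: "closed (defect_star_space T)"
  by (simp add: defect_star_space_def)

lemma defect_in_space [simp]: "\<Delta> h \<in> defect_space T"
  unfolding defect_space_def by (rule subsetD[OF closure_subset]) simp

lemma defect_star_in_space [simp]: "\<Delta>s x \<in> defect_star_space T"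
  unfolding defect_star_space_def by (rule subsetD[OF closure_subset]) simp

text \<open>On the dense range of \<open>\<Delta>s\<close> this is the relation
  \<open>Trow (\<Delta>s x) = \<Delta> (Trow x)\<close>; it is what lets D_T-valued outputs arise
  from inputs in the other defect space.\<close>

lemma Trow_in_defect_space:
  assumes "x \<in> defect_star_space T"
  shows "Trow x \<in> defect_space T"
proof -
  obtain f where f: "\<And>n::nat. f n \<in> range \<Delta>s" "f \<longlonglongrightarrow> x"
    using assms by (auto simp: defect_star_space_def closure_sequential)
  then have "(\<lambda>n. Trow (f n)) \<longlonglongrightarrow> Trow x" by (intro Trow.tendsto)
  moreover have "Trow (f n) \<in> defect_space T" for n using f(1)[of n] by (auto simp: Trow_defect_star)
  ultimately show ?thesis by (rule closed_sequentially[OF closed_defect_space, rotated])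
qed

lemma Tadj_in_defect_star_space:
  assumes "h \<in> defect_space T"
  shows "Tadj h \<in> defect_star_space T"
proof -
  obtain f where f: "\<And>n::nat. f n \<in> range \<Delta>" "f \<longlonglongrightarrow> h"
    using assms by (auto simp: defect_space_def closure_sequential)
  then have "(\<lambda>n. Tadj (f n)) \<longlonglongrightarrow> Tadj h" by (intro Tadj.tendsto)
  moreover have "Tadj (f n) \<in> defect_star_space T" for n
    using f(1)[of n] by (auto simp: Tadj_defect)
  ultimately show ?thesis by (rule closed_sequentially[OF closed_defect_star_space, rotated])
qed

end

section \<open>The state space recursion\<close>

context row_contr
begin

text \<open>
  Reading a word letter by letter from the left, the system with state \<open>h\<close> and input \<open>x\<close>
  moves to \<open>T\<^sup>* h + \<Delta>\<^bsub>T*\<^esub> x\<close> and emits \<open>\<Delta>\<^bsub>T\<^esub> h - T x\<close>.  Its transfer function is the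
  characteristic function (radius \<open>r\<close> scales the state), and its response to an initial state
  without input is the Poisson kernel.
\<close>

primrec state_rev :: "real \<Rightarrow> 'h \<Rightarrow> ('n, 'h ^ 'n) fock_tensor \<Rightarrow> 'n list \<Rightarrow> 'h" where
  "state_rev r h x [] = h"
| "state_rev r h x (j # w) =
    r *\<^sub>R ((Tadj (state_rev r h x w) + \<Delta>s (ell2_nth x (rev w))) $ j)"

text \<open>The primitive recursion runs on the reversed word so that each step removes the letter
  read last.\<close>

definition state :: "real \<Rightarrow> 'h \<Rightarrow> ('n, 'h ^ 'n) fock_tensor \<Rightarrow> 'n list \<Rightarrow> 'h" where
  "state r h x w = state_rev r h x (rev w)"

lemma state_Nil [simp]: "state r h x [] = h"
  by (simp add: state_def)

lemma state_snoc:
  "state r h x (w @ [j]) = r *\<^sub>R ((Tadj (state r h x w) + \<Delta>s (ell2_nth x w)) $ j)"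
  by (simp add: state_def)

lemma state_tendsto: "((\<lambda>r. state r h x w) \<longlongrightarrow> state 1 h x w) (at_left 1)"
proof (induction w rule: rev_induct)
  case (snoc j w)
  show ?case unfolding state_snoc
    by (intro tendsto_intros Tadj.tendsto snoc)
qed simp

text \<open>Time invariance: after the first letter the same system runs on, from a new initial
  state and with the shifted input. This reconciles a recursion at the end of words with shifts at
  their beginning.\<close>

lemma state_Cons:
  "state 1 h x (i # w) = state 1 ((Tadj h + \<Delta>s (ell2_nth x [])) $ i) (pull ((#) i) x) w"
proof (induction w rule: rev_induct)
  case Nil
  show ?case using state_snoc[of 1 h x "[]" i] by simp
next
  case (snoc j w)
  have "state 1 h x (i # w @ [j]) = state 1 h x ((i # w) @ [j])" by simp
  then show ?case by (simp only: state_snoc snoc ell2_nth_pull[OF inj_Cons])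
qed

lemma state_add: "state r (h + h') (x + x') w = state r h x w + state r h' x' w"
  by (induction w rule: rev_induct)
    (simp_all only: state_Nil state_snoc Tadj.add \<Delta>s.add ell2_nth_simps vector_add_component
      scaleR_add_right add_ac)

lemma state_scaleC: "state r (c *\<^sub>C h) (c *\<^sub>C x) w = c *\<^sub>C state r h x w"
  by (induction w rule: rev_induct)
    (simp_all add: state_snoc bounded_op_scaleC[OF bounded_op_Tadj] bounded_op_scaleC[OF bounded_op_defect_star]
      bounded_op_scaleC[OF bounded_op_adj] scaleC.add_right scaleC.scaleR_right)

lemma state_append_zero_input:
  assumes "\<And>u. ell2_nth x (v @ u) = 0"
  shows "state 1 h x (v @ u) = adj (word_op T u) (state 1 h x v)"
proof (induction u rule: rev_induct)
  case (snoc j u)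
  then show ?case
    using state_snoc[of 1 h x "v @ u" j] by (simp add: assms \<Delta>s.zero adj_word_op_snoc)
qed simp

definition outp :: "real \<Rightarrow> 'h \<Rightarrow> ('n, 'h ^ 'n) fock_tensor \<Rightarrow> 'n list \<Rightarrow> 'h" where
  "outp r h x w = \<Delta> (state r h x w) - Trow (ell2_nth x w)"

abbreviation state_sq :: "'h \<Rightarrow> ('n, 'h ^ 'n) fock_tensor \<Rightarrow> nat \<Rightarrow> real" where
  "state_sq h x m \<equiv> (\<Sum>w | length w = m. (norm (state 1 h x w))\<^sup>2)"

text \<open>Summing the Julia identity over one level trades state and input energy for output
  energy and the state energy of the next level; over the levels this telescopes.\<close>

lemma energy_balance:
  "(\<Sum>k<m. \<Sum>w | length w = k. (norm (outp 1 h x w))\<^sup>2) + state_sq h x m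
    = (norm h)\<^sup>2 + (\<Sum>k<m. \<Sum>w | length w = k. (norm (ell2_nth x w))\<^sup>2)"
proof (induction m)
  case (Suc m)
  \<comment> \<open>The states at all successors \<open>w @ [j]\<close> are the coordinates of one
    vector, so their energies add up to its squared norm.\<close>
  have "state_sq h x (Suc m)
      = (\<Sum>w | length w = m. (norm (Tadj (state 1 h x w) + \<Delta>s (ell2_nth x w)))\<^sup>2)"
    by (simp add: sum_words_Suc state_snoc norm_vec_sq)
  then have "(\<Sum>w | length w = m. (norm (outp 1 h x w))\<^sup>2) + state_sq h x (Suc m)
      = (\<Sum>w | length w = m. (norm (Tadj (state 1 h x w) + \<Delta>s (ell2_nth x w)))\<^sup>2
          + (norm (outp 1 h x w))\<^sup>2)"
    by (simp add: sum.distrib)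
  also have "\<dots> = state_sq h x m + (\<Sum>w | length w = m. (norm (ell2_nth x w))\<^sup>2)"
    by (simp add: outp_def julia_isometry sum.distrib)
  finally show ?case using Suc by simp
qed simp

lemma state_sq_le: "state_sq h x m \<le> (norm h)\<^sup>2 + (norm x)\<^sup>2"
proof -
  have "0 \<le> (\<Sum>k<m. \<Sum>w | length w = k. (norm (outp 1 h x w))\<^sup>2)" by (intro sum_nonneg) simp
  then show ?thesis using energy_balance[where h=h and x=x and m=m] sum_levels_le_norm[of x m] by linarith
qed

definition response :: "'h \<Rightarrow> ('n, 'h ^ 'n) fock_tensor \<Rightarrow> ('n, 'h) fock_tensor" where
  "response h x = Abs_ell2 (outp 1 h x)"

lemma summable_outp: "(\<lambda>w. (norm (outp 1 h x w))\<^sup>2) summable_on UNIV"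
proof (rule summable_words_levels)
  show "(\<Sum>k<m. \<Sum>w | length w = k. (norm (outp 1 h x w))\<^sup>2) \<le> (norm h)\<^sup>2 + (norm x)\<^sup>2" for m
  proof -
    have "0 \<le> state_sq h x m" by (intro sum_nonneg) simp
    then show ?thesis using energy_balance[where h=h and x=x and m=m] sum_levels_le_norm[of x m] by linarith
  qed
qed simp

lemma ell2_nth_response [simp]: "ell2_nth (response h x) w = outp 1 h x w"
  by (simp add: response_def ell2_nth_Abs summable_outp)

lemma response_add: "response (h + h') (x + x') = response h x + response h' x'"
  by (rule ell2_eqI) (simp add: outp_def state_add \<Delta>.add Trow.add)

lemma response_scaleC: "response (c *\<^sub>C h) (c *\<^sub>C x) = c *\<^sub>C response h x"
  by (rule ell2_eqI)
    (simp add: outp_def state_scaleC bounded_op_scaleC[OF bounded_op_defect]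
      bounded_op_scaleC[OF bounded_op_Trow] scaleC.diff_right)

lemma response_zero [simp]: "response 0 0 = 0"
  using response_scaleC[of 0 0 0] by simp

lemma pull_response:
  "pull ((#) i) (response h x) = response ((Tadj h + \<Delta>s (ell2_nth x [])) $ i) (pull ((#) i) x)"
  by (rule ell2_eqI) (simp add: outp_def state_Cons)

lemma ell2_eqI_Cons:
  assumes "ell2_nth x [] = ell2_nth y []" "\<And>i. pull ((#) i) x = pull ((#) i) y"
  shows "x = y"
proof (rule ell2_eqI)
  show "ell2_nth x w = ell2_nth y w" for w
    using assms(1) arg_cong[OF assms(2), of "\<lambda>z. ell2_nth z (tl w)" "hd w"] by (cases w) simp_all
qed

lemma pull_Cons_push_Cons: "pull ((#) i) (push ((#) j) x) = (if i = j then x else 0)"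
  by (rule ell2_eqI) (auto simp: ell2_nth_push image_iff)

lemma pull_Cons_single_Nil [simp]: "pull ((#) i) (ell2_single [] z) = 0"
  by (rule ell2_eqI) (simp add: ell2_nth_single)

lemma push_Cons_Nil [simp]: "ell2_nth (push ((#) i) x) [] = 0"
  by (rule ell2_nth_push_other) auto

text \<open>A system at rest that receives no input at the empty word stays at rest, so delaying the
  input by a letter delays the output. Thus input-to-output commutes with left creation.\<close>

lemma push_response_input: "push ((#) i) (response 0 x) = response 0 (push ((#) i) x)"
  by (rule ell2_eqI_Cons)
    (auto simp: pull_response pull_Cons_push_Cons outp_def ell2_nth_push_other \<Delta>.zero \<Delta>s.zero
      Trow.zero Tadj.zero)

end

section \<open>Pure row contractions: decay of the state energy and the isometric response\<close>

locale pure_row_contr = row_contr T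
  for T :: "'n::finite \<Rightarrow> 'h::chilbert_space \<Rightarrow> 'h" +
  assumes pure: "pure T"
begin

lemma tendsto_adj_word_op:
  "(\<lambda>k. \<Sum>w | length w = k. (norm (adj (word_op T w) h))\<^sup>2) \<longlonglongrightarrow> 0"
proof -
  have "(\<lambda>k. Re (cinner (\<Sum>w | length w = k. word_op T w (adj (word_op T w) h)) h)) \<longlonglongrightarrow> Re (cinner 0 h)"
    using pure unfolding pure_def by (intro tendsto_intros cinner.tendsto) auto
  then show ?thesis
    by (simp add: cinner.sum_left Re_cinner inner_adj bounded_op_word_op power2_norm_eq_inner)
qed

text \<open>Beyond length \<open>p\<close> the states evolve by adjoints of word operators alone.
  Level \<open>p\<close> has finitely many states, and purity drives the energy issuing from each of
  them to zero.\<close>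

lemma state_sq_tendsto_finite:
  assumes "\<And>w. p \<le> length w \<Longrightarrow> ell2_nth x w = 0"
  shows "state_sq h x \<longlonglongrightarrow> 0"
proof (rule LIMSEQ_offset[of _ p])
  have "state_sq h x (k + p) = (\<Sum>v | length v = p. \<Sum>u | length u = k.
      (norm (adj (word_op T u) (state 1 h x v)))\<^sup>2)" for k
    unfolding add.commute[of k p] sum_words_append
    by (intro sum.cong refl arg_cong[where f="\<lambda>y. (norm y)\<^sup>2"] state_append_zero_input) (auto intro: assms)
  then show "(\<lambda>k. state_sq h x (k + p)) \<longlonglongrightarrow> 0"
    using tendsto_sum[of "{v. length v = p}", OF tendsto_adj_word_op[of "state 1 h x _"]] by simp
qed

text \<open>Truncate the input to short words. By linearity the cut-off part acts from initial state
  0, with state energy bounded by its squared norm; each of the two parts has energy below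
  \<open>e / 4\<close>, and the square of a sum costs a factor 2.\<close>

lemma state_sq_tendsto: "state_sq h x \<longlonglongrightarrow> 0"
proof (rule LIMSEQ_I)
  fix e :: real assume e: "0 < e"
  define xp where "xp p = (\<Sum>k<p. \<Sum>w | length w = k. ell2_single w (ell2_nth x w))" for p
  have "xp \<longlonglongrightarrow> x"
    using sums_words_single[of x] by (simp add: sums_def xp_def[abs_def])
  then have "(\<lambda>p. (norm (x - xp p))\<^sup>2) \<longlonglongrightarrow> (norm (x - x))\<^sup>2" by (intro tendsto_intros)
  then have to_0: "(\<lambda>p. (norm (x - xp p))\<^sup>2) \<longlonglongrightarrow> 0" by (simp only: diff_self norm_zero zero_power2)
  have "\<forall>\<^sub>F p in sequentially. (norm (x - xp p))\<^sup>2 < e / 4"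
    by (rule order_tendstoD(2)[OF to_0]) (use e in simp)
  then obtain p where p: "(norm (x - xp p))\<^sup>2 < e / 4" by (auto simp: eventually_sequentially)
  have "state_sq h (xp p) \<longlonglongrightarrow> 0" by (rule state_sq_tendsto_finite[of p]) (simp add: xp_def ell2_nth_partial_sum del: ell2_nth_sum)
  then obtain M where M: "\<And>m. m \<ge> M \<Longrightarrow> state_sq h (xp p) m < e / 4"
    using order_tendstoD(2)[of "state_sq h (xp p)" 0 sequentially "e / 4"] e
    by (auto simp: eventually_sequentially)
  have "norm (state_sq h x m - 0) < e" if m: "m \<ge> M" for m
  proof -
    have "state_sq h x m \<le> (\<Sum>w | length w = m. 2 * (norm (state 1 h (xp p) w))\<^sup>2
        + 2 * (norm (state 1 0 (x - xp p) w))\<^sup>2)"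
    proof (rule sum_mono)
      fix w
      let ?a = "state 1 h (xp p) w" and ?b = "state 1 0 (x - xp p) w"
      have s: "state 1 h x w = ?a + ?b"
        using state_add[of 1 h 0 "xp p" "x - xp p" w] by simp
      have "(norm (?a - ?b))\<^sup>2 + (norm (?a + ?b))\<^sup>2 = 2 * (norm ?a)\<^sup>2 + 2 * (norm ?b)\<^sup>2"
        by (simp add: power2_norm_eq_inner algebra_simps inner_commute)
      then show "(norm (state 1 h x w))\<^sup>2 \<le> 2 * (norm ?a)\<^sup>2 + 2 * (norm ?b)\<^sup>2"
        unfolding s using zero_le_power2[of "norm (?a - ?b)"] by argo
    qed
    also have "\<dots> = 2 * state_sq h (xp p) m + 2 * state_sq 0 (x - xp p) m"
      by (simp add: sum.distrib sum_distrib_left)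
    also have "\<dots> < e" using M[OF m] p state_sq_le[of 0 "x - xp p" m] by simp
    finally have "state_sq h x m < e" .
    moreover have "0 \<le> state_sq h x m" by (intro sum_nonneg) simp
    ultimately show ?thesis by simp
  qed
  then show "\<exists>M. \<forall>m\<ge>M. norm (state_sq h x m - 0) < e" by blast
qed

lemma norm_response: "(norm (response h x))\<^sup>2 = (norm h)\<^sup>2 + (norm x)\<^sup>2"
proof -
  have "(\<lambda>m. (norm h)\<^sup>2 + (\<Sum>k<m. \<Sum>w | length w = k. (norm (ell2_nth x w))\<^sup>2) - state_sq h x m)
      \<longlonglongrightarrow> (norm h)\<^sup>2 + (norm x)\<^sup>2 - 0"
    unfolding norm_ell2_sq
    by (intro tendsto_intros tendsto_sum_levels ell2_nth_summable state_sq_tendsto) simp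
  then have "(\<lambda>m. \<Sum>k<m. \<Sum>w | length w = k. (norm (outp 1 h x w))\<^sup>2)
      \<longlonglongrightarrow> (norm h)\<^sup>2 + (norm x)\<^sup>2"
    unfolding energy_balance[symmetric] by simp
  then show ?thesis
    unfolding norm_ell2_sq ell2_nth_response
    by (intro infsum_words_levels summable_outp) auto
qed

text \<open>Polarisation of the norm identity, with \<i> supplying the imaginary part. For
  \<open>x = 0\<close> and \<open>h' = 0\<close> it says that the Poisson kernel and
  \<open>\<Theta>\<close> have orthogonal ranges.\<close>

lemma cinner_response:
  "cinner (response h x) (response h' x') = cinner h h' + cinner x x'"
proof -
  have i: "inner (response h x) (response h' x') = inner h h' + inner x x'" for h x h' x'
  proof -
    have "(norm (response (h + h') (x + x')))\<^sup>2 = (norm (h + h'))\<^sup>2 + (norm (x + x'))\<^sup>2"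
      by (rule norm_response)
    then show ?thesis
      unfolding response_add power2_norm_eq_inner inner_add_left inner_add_right
        inner_commute[of "response h' x'" "response h x"] inner_commute[of h' h] inner_commute[of x' x]
      using norm_response[of h x] norm_response[of h' x'] by (simp add: power2_norm_eq_inner)
  qed
  show ?thesis
    using i[of h x h' x'] i[of h x "\<i> *\<^sub>C h'" "\<i> *\<^sub>C x'"]
    by (simp add: complex_eq_iff Re_cinner Im_cinner response_scaleC)
qed

abbreviation "poisson h \<equiv> response h 0"
abbreviation "\<Theta> x \<equiv> response 0 x"

lemma bounded_op_response_state: "bounded_op UNIV UNIV (\<lambda>h. poisson h)"
proof -
  have "norm (poisson h) = norm h" for h using norm_response[of h 0] by simp
  then show ?thesis
    using response_add[of _ _ 0 0] response_scaleC[of _ _ 0]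
    by (auto simp: bounded_op_def intro!: exI[of _ 1])
qed

lemma pull_poisson: "pull ((#) i) (poisson h) = poisson (adj (T i) h)"
proof -
  have "pull ((#) i) (0 :: ('n, 'h ^ 'n) fock_tensor) = 0" by (rule ell2_eqI) simp
  then show ?thesis by (simp add: pull_response \<Delta>s.zero)
qed

text \<open>
  The Julia operator being onto, every \<open>e\<^bsub>[]\<^esub> \<otimes> g + \<Sum>\<^sub>i S\<^sub>i K a\<^sub>i\<close>, where \<open>K\<close> is the
  Poisson kernel, is a response.  So a vector orthogonal to all responses vanishes at the empty word, and its backward shifts
  are again orthogonal to all responses.
\<close>

lemma orthogonal_responses_zero:
  assumes q: "\<And>w. ell2_nth q w \<in> defect_space T"
    and K: "\<And>h. cinner q (poisson h) = 0"
    and \<Theta>: "\<And>x. (\<And>w. ell2_nth x w \<in> defect_star_space T) \<Longrightarrow> cinner q (\<Theta> x) = 0"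
  shows "ell2_nth q w = 0"
  using q K \<Theta>
proof (induction w arbitrary: q)
  case (Nil q)
  have 0: "0 \<in> defect_star_space T" using csubspace_defect_star_space by (simp only: csubspace_def)
  have orth: "cinner q (response h (ell2_single [] y)) = 0" if "y \<in> defect_star_space T" for h y
  proof -
    have "response h (ell2_single [] y) = poisson h + \<Theta> (ell2_single [] y)"
      using response_add[of h 0 0 "ell2_single [] y"] by simp
    then show ?thesis
      using Nil(2)[of h] Nil(3)[of "ell2_single [] y"] that 0
      by (simp add: cinner.add_right ell2_nth_single)
  qed
  let ?g = "ell2_nth q []"
  have y: "- Tadj ?g \<in> defect_star_space T"
    using Tadj_in_defect_star_space[OF Nil(1)[of "[]"]]
      csubspace_scaleR[OF csubspace_defect_star_space, of "Tadj ?g" "-1"] by simp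
  \<comment> \<open>Initial state and input are the adjoint of the Julia operator applied to next
    state 0 and output \<open>?g\<close>.\<close>
  have "response (\<Delta> ?g) (ell2_single [] (- Tadj ?g)) = ell2_single [] ?g"
  proof (rule ell2_eqI_Cons)
    show "ell2_nth (response (\<Delta> ?g) (ell2_single [] (- Tadj ?g))) [] = ell2_nth (ell2_single [] ?g) []"
      by (simp add: outp_def ell2_nth_single defect_sq Trow.neg)
    show "pull ((#) i) (response (\<Delta> ?g) (ell2_single [] (- Tadj ?g)))
        = pull ((#) i) (ell2_single [] ?g)" for i
      by (simp add: pull_response ell2_nth_single Tadj_defect \<Delta>s.neg)
  qed
  then have "cinner q (ell2_single [] ?g) = 0" using orth[OF y, of "\<Delta> ?g"] by simp
  then show ?case by (simp add: cinner_single_right cinner_self)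
next
  case (Cons i w q)
  have 0: "0 \<in> defect_star_space T" using csubspace_defect_star_space by (simp only: csubspace_def)
  have "ell2_nth (pull ((#) i) q) w = 0"
  proof (rule Cons.IH)
    show "ell2_nth (pull ((#) i) q) w \<in> defect_space T" for w using Cons.prems(1) by simp
    show "cinner (pull ((#) i) q) (\<Theta> x) = 0" if "\<And>w. ell2_nth x w \<in> defect_star_space T" for x
      unfolding cinner_pull[OF inj_Cons] push_response_input
      by (rule Cons.prems(3)) (simp add: ell2_nth_push that 0)
    show "cinner (pull ((#) i) q) (poisson a) = 0" for a
    proof -
      define u :: "'h ^ 'n" where "u = (\<chi> j. if j = i then a else 0)"
      \<comment> \<open>Here the adjoint of the Julia operator is applied to next state
        \<open>u\<close> and output 0; \<open>u\<close> places \<open>a\<close> at the letter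
        \<open>i\<close>.\<close>
      have "response (Trow u) (ell2_single [] (\<Delta>s u)) = push ((#) i) (poisson a)"
      proof (rule ell2_eqI_Cons)
        show "ell2_nth (response (Trow u) (ell2_single [] (\<Delta>s u))) []
            = ell2_nth (push ((#) i) (poisson a)) []"
          by (simp add: outp_def ell2_nth_single Trow_defect_star)
        have "(Tadj (Trow u) + \<Delta>s (\<Delta>s u)) = u" by (simp add: defect_star_sq)
        then show "pull ((#) j) (response (Trow u) (ell2_single [] (\<Delta>s u)))
            = pull ((#) j) (push ((#) i) (poisson a))" for j
          by (simp add: pull_response ell2_nth_single pull_Cons_push_Cons del: Tadj_nth)
            (simp add: u_def)
      qed
      then have "push ((#) i) (poisson a) = poisson (Trow u) + \<Theta> (ell2_single [] (\<Delta>s u))"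
        using response_add[of "Trow u" 0 0 "ell2_single [] (\<Delta>s u)"] by simp
      moreover have "cinner q (\<Theta> (ell2_single [] (\<Delta>s u))) = 0"
        by (rule Cons.prems(3)) (simp add: ell2_nth_single 0)
      ultimately show ?thesis
        using Cons.prems(2)[of "Trow u"] by (simp add: cinner_pull cinner.add_right)
    qed
  qed
  then show ?case by simp
qed

lemma closed_range_poisson: "closed (range (\<lambda>h. poisson h))"
proof -
  interpret P: bounded_linear "\<lambda>h. poisson h" by (rule bounded_op_linear[OF bounded_op_response_state])
  have n: "norm (poisson h) = norm h" for h using norm_response[of h 0] by simp
  show ?thesis
    unfolding closed_sequential_limits
  proof (intro allI impI)
    fix u l assume u: "(\<forall>n. u n \<in> range (\<lambda>h. poisson h)) \<and> u \<longlonglongrightarrow> l"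
    then have "\<forall>n. \<exists>h. u n = poisson h" by blast
    then obtain h where h: "\<And>n. u n = poisson (h n)" by metis
    have "Cauchy u" using u LIMSEQ_imp_Cauchy by blast
    then have "Cauchy h"
      unfolding Cauchy_def dist_norm h by (simp only: P.diff[symmetric] n)
    then obtain h' where h': "h \<longlonglongrightarrow> h'" using Cauchy_convergent_iff convergent_def by blast
    have "u \<longlonglongrightarrow> poisson h'" using P.tendsto[OF h'] unfolding h[symmetric] .
    then have "l = poisson h'" using u LIMSEQ_unique by blast
    then show "l \<in> range (\<lambda>h. poisson h)" by blast
  qed
qed

text \<open>If \<open>z\<close> is orthogonal to the range of \<open>\<Theta>\<close>, then so is
  its difference from the projection to the range of the Poisson kernel. That difference is
  orthogonal to all responses, hence zero.\<close>

lemma range_poisson_iff: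
  assumes z: "\<And>w. ell2_nth z w \<in> defect_space T"
  shows "z \<in> range (\<lambda>h. poisson h) \<longleftrightarrow>
    (\<forall>x. (\<forall>w. ell2_nth x w \<in> defect_star_space T) \<longrightarrow> cinner z (\<Theta> x) = 0)"
proof
  show "z \<in> range (\<lambda>h. poisson h) \<Longrightarrow>
    \<forall>x. (\<forall>w. ell2_nth x w \<in> defect_star_space T) \<longrightarrow> cinner z (\<Theta> x) = 0"
    by (auto simp: cinner_response)
  assume orth: "\<forall>x. (\<forall>w. ell2_nth x w \<in> defect_star_space T) \<longrightarrow> cinner z (\<Theta> x) = 0"
  let ?R = "range (\<lambda>h. poisson h)"
  have R: "csubspace ?R" "closed ?R"
    by (simp_all add: csubspace_range bounded_op_response_state closed_range_poisson)
  obtain h where h: "proj ?R z = poisson h" using proj_in[OF R, of z] by blast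
  have "ell2_nth (z - proj ?R z) w = 0" for w
  proof (rule orthogonal_responses_zero)
    have "ell2_nth (poisson h) w \<in> defect_space T" for w by (simp add: outp_def Trow.zero)
    then show "ell2_nth (z - proj ?R z) w \<in> defect_space T" for w
      unfolding h ell2_nth_minus by (intro csubspace_diff z) simp_all
    show "cinner (z - proj ?R z) (poisson g) = 0" for g
      using ortho_complD[OF proj_ortho[OF R]] by blast
    show "cinner (z - proj ?R z) (\<Theta> x) = 0" if "\<And>w. ell2_nth x w \<in> defect_star_space T" for x
      using orth that unfolding h by (simp add: cinner.diff_left cinner_response)
  qed
  then have "z - proj ?R z = 0" by (intro ell2_eqI) simp
  then show "z \<in> ?R" using h by (metis eq_iff_diff_eq_0 rangeI)
qed

end

section \<open>The constrained Fock space\<close>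

abbreviation snoc :: "'n \<Rightarrow> 'n list \<Rightarrow> 'n list" where
  "snoc i \<equiv> \<lambda>w. w @ [i]"

text \<open>The commutant of the right creation operators is a WOT-closed algebra containing the
  generators, so it contains the hull.\<close>

lemma F_infty_subset_commutant:
  "F_infty \<subseteq> {A. bounded_op UNIV UNIV A \<and> (\<forall>i x. A (right_creation i x) = right_creation i (A x))}"
  (is "_ \<subseteq> ?C")
  unfolding F_infty_def
proof (rule hull_minimal)
  show "insert id (range left_creation) \<subseteq> ?C"
  proof -
    have "left_creation j (right_creation i x) = right_creation i (left_creation j x)" for i j :: 'a and x
    proof (rule ell2_eqI)
      fix w
      show "ell2_nth (left_creation j (right_creation i x)) w = ell2_nth (right_creation i (left_creation j x)) w"
        by (cases w; cases "tl w" rule: rev_cases)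
          (auto simp: left_creation.rep_eq right_creation.rep_eq)
    qed
    then show ?thesis
      by (auto simp: bounded_op_id left_creation_eq_push bounded_op_push)
  qed
  show "op_algebra ?C \<and> closedin wot ?C"
  proof
    have lin: "right_creation i (x + y) = right_creation i x + right_creation i y"
      "right_creation i (c *\<^sub>C x) = c *\<^sub>C right_creation i x" "right_creation i 0 = 0" for i :: 'a and x y c
      by (auto intro!: ell2_eqI simp: right_creation_eq_push ell2_nth_push)
    have add: "bounded_op UNIV UNIV (\<lambda>x. f x + g x)"
      if "bounded_op UNIV UNIV f" "bounded_op UNIV UNIV g" for f g :: "'a fock \<Rightarrow> 'a fock"
      using that by (simp add: bounded_op_UNIV_iff bounded_linear_add scaleC_add_right)
    have scale: "bounded_op UNIV UNIV (\<lambda>x. c *\<^sub>C f x)"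
      if "bounded_op UNIV UNIV f" for c and f :: "'a fock \<Rightarrow> 'a fock"
      using that
      by (simp add: bounded_op_UNIV_iff scaleC_scaleC mult.commute
          bounded_linear_compose[OF scaleC.bounded_linear_right])
    have zero: "bounded_op UNIV UNIV (\<lambda>x. 0 :: 'a fock)"
      by (simp add: bounded_op_UNIV_iff bounded_linear_zero)
    show "op_algebra ?C"
      unfolding op_algebra_def by (auto simp: lin add scale zero bounded_op_compose)
    \<comment> \<open>\<open>wot\<close> is pulled back from the product topology along matrix
      coefficients. On these, commutation is a family of equations between two coordinates, hence a
      closed condition.\<close>
    define V :: "('a fock \<times> 'a fock \<Rightarrow> complex) set" where
      "V = {F. \<forall>i x y. F (right_creation i x, y) = F (x, pull (snoc i) y)}"
    have "V = (\<Inter>i. \<Inter>x. \<Inter>y. {F. F (right_creation i x, y) = F (x, pull (snoc i) y)})"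
      by (auto simp: V_def)
    then have "closed V"
      by (auto intro!: closed_INT closed_Collect_eq continuous_on_product_coordinates)
    let ?f = "\<lambda>(A :: 'a fock \<Rightarrow> 'a fock) (x, y). cinner (A x) y"
    have eq: "?C = ?f -` V \<inter> bounded_ops"
    proof -
      have "A (right_creation i x) = right_creation i (A x) \<longleftrightarrow>
          (\<forall>y. cinner (A (right_creation i x)) y = cinner (A x) (pull (snoc i) y))"
        for A :: "'a fock \<Rightarrow> 'a fock" and i x
        using cinner_ext[of "A (right_creation i x)" "right_creation i (A x)"]
        by (auto simp: right_creation_eq_push cinner_push)
      then show ?thesis by (auto simp: V_def)
    qed
    have ts: "topspace (wot :: ('a fock \<Rightarrow> 'a fock) topology) = bounded_ops"
      unfolding wot_def topspace_pullback_topology by simp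
    have "openin wot (bounded_ops - ?C)"
      unfolding wot_def openin_pullback_topology
      by (rule exI[of _ "- V"]) (use \<open>closed V\<close> eq in auto)
    then show "closedin wot ?C"
      unfolding closedin_def ts by auto
  qed
qed

lemma left_creation_in_F_infty: "left_creation i \<in> F_infty"
  unfolding F_infty_def by (rule hull_inc) simp

section \<open>Invariance of the constrained space under backward shifts\<close>

locale ideal =
  fixes J :: "('n::finite fock \<Rightarrow> 'n fock) set"
  assumes two_sided_ideal: "two_sided_ideal J"
begin

abbreviation "N \<equiv> N_space J"

lemma csubspace_N [simp]: "csubspace N" and closed_N [simp]: "closed N"
  by (simp_all add: N_space_def)

lemma N_iff: "\<phi> \<in> N \<longleftrightarrow> (\<forall>f\<in>J. \<forall>\<psi>. cinner \<phi> (f \<psi>) = 0)"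
  unfolding N_space_def ortho_compl_ccspan by (auto simp: ortho_compl_def)

lemma ortho_compl_N: "ortho_compl N = ccspan {f \<phi> | f \<phi>. f \<in> J}"
  by (simp add: N_space_def ortho_compl_ortho_compl)

lemma J_bounded: "f \<in> J \<Longrightarrow> bounded_op UNIV UNIV f"
  and J_commute: "f \<in> J \<Longrightarrow> f (push (snoc i) x) = push (snoc i) (f x)"
  using two_sided_ideal F_infty_subset_commutant
  by (auto simp: two_sided_ideal_def right_creation_eq_push)

text \<open>Commutation makes the ranges of elements of \<open>J\<close> invariant under right
  creation; the complement is invariant under the adjoint.\<close>

lemma pull_snoc_N:
  assumes "\<phi> \<in> N"
  shows "pull (snoc i) \<phi> \<in> N"
proof -
  have "cinner (pull (snoc i) \<phi>) (f \<psi>) = 0" if "f \<in> J" for f \<psi>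
    using assms J_commute[OF that, of i \<psi>] that unfolding N_iff cinner_pull[OF inj_append_right]
    by metis
  then show ?thesis by (simp add: N_iff)
qed

text \<open>Here the ideal property is used: left creation composed with an element of
  \<open>J\<close> stays in \<open>J\<close>.\<close>

lemma pull_Cons_N:
  assumes "\<phi> \<in> N"
  shows "pull ((#) i) \<phi> \<in> N"
proof -
  have mult: "\<forall>f\<in>J. \<forall>g\<in>F_infty. f \<circ> g \<in> J \<and> g \<circ> f \<in> J"
    using two_sided_ideal by (simp add: two_sided_ideal_def)
  have "left_creation i \<circ> f \<in> J" if "f \<in> J" for f
    by (rule conjunct2[OF bspec[OF bspec[OF mult that] left_creation_in_F_infty]])
  then have "cinner \<phi> ((left_creation i \<circ> f) \<psi>) = 0" if "f \<in> J" for f \<psi>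
    using assms that by (simp only: N_iff)
  then show ?thesis by (simp add: N_iff cinner_pull left_creation_eq_push)
qed

abbreviation P :: "('n, 'a::chilbert_space) fock_tensor \<Rightarrow> ('n, 'a) fock_tensor" where
  "P \<equiv> proj (tensor_space N UNIV)"

lemma bounded_op_P [simp]: "bounded_op UNIV UNIV P"
  by (simp add: bounded_op_proj)

lemma P_in [simp]: "P x \<in> tensor_space N UNIV"
  by (simp add: proj_in)

lemma P_ortho [simp]: "x - P x \<in> ortho_compl (tensor_space N UNIV)"
  by (simp add: proj_ortho)

lemma P_id: "x \<in> tensor_space N UNIV \<Longrightarrow> P x = x"
  by (simp add: proj_id)

lemma P_map_ell2: "bounded_op UNIV UNIV Y \<Longrightarrow> P (map_ell2 Y z) = map_ell2 Y (P z)"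
  by (simp add: proj_map_ell2)

lemma tensor_space_N_iff:
  "csubspace K \<Longrightarrow> closed K \<Longrightarrow>
    z \<in> tensor_space N K \<longleftrightarrow> z \<in> tensor_space N UNIV \<and> (\<forall>w. ell2_nth z w \<in> K)"
  by (rule tensor_space_iff[OF csubspace_N closed_N])

lemma proj_tensor_space_eq_P:
  "csubspace K \<Longrightarrow> closed K \<Longrightarrow> (\<And>w. ell2_nth x w \<in> K) \<Longrightarrow> proj (tensor_space N K) x = P x"
  by (rule proj_tensor_space_eq[OF csubspace_N closed_N, symmetric])

lemma tensor_op_id_left:
  assumes "bounded_op UNIV UNIV Y" "x \<in> tensor_space N K"
  shows "tensor_op N K id Y x = map_ell2 Y x"
  by (rule tensor_op_eqI[OF _ _ assms(2)]) (simp_all add: assms bounded_op_map_ell2 map_ell2_tensor_vec)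

lemma tensor_op_B_op:
  assumes K: "csubspace K" "closed K" and x: "x \<in> tensor_space N K"
  shows "tensor_op N K (B_op J i) id x = proj (tensor_space N K) (push ((#) i) x)"
proof (rule tensor_op_eqI[OF _ _ x])
  show "bounded_op UNIV UNIV (\<lambda>x. proj (tensor_space N K) (push ((#) i) x))"
    using bounded_op_compose[OF bounded_op_proj[OF csubspace_tensor_space closed_tensor_space, of N K]
        bounded_op_push[OF inj_Cons, of i]] by (simp add: o_def)
  show "proj (tensor_space N K) (push ((#) i) (tensor_vec \<phi> k)) = tensor_vec (B_op J i \<phi>) (id k)"
    if "k \<in> K" for \<phi> k
    using that by (simp add: push_tensor_vec proj_tensor_vec B_op_def left_creation_eq_push)
qed

lemma bounded_op_scaleR: "bounded_op UNIV UNIV f \<Longrightarrow> bounded_op UNIV UNIV (\<lambda>x. r *\<^sub>R f x)"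
  using bounded_linear_compose[OF bounded_linear_scaleR_right, of f r]
  by (simp add: bounded_op_UNIV_iff scaleC.scaleR_right)

lemma tensor_op_W_op:
  assumes Y: "bounded_op UNIV UNIV Y" and x: "x \<in> tensor_space N UNIV"
  shows "tensor_op N UNIV (\<lambda>\<phi>. r *\<^sub>R W_op J i \<phi>) Y x = P (r *\<^sub>R push (snoc i) (map_ell2 Y x))"
proof (rule tensor_op_eqI[OF _ _ x])
  have "bounded_op UNIV UNIV (\<lambda>x. r *\<^sub>R push (snoc i) (map_ell2 Y x))"
    using bounded_op_scaleR[OF bounded_op_compose[OF bounded_op_push[OF inj_append_right] bounded_op_map_ell2[OF Y]]]
    by (simp add: o_def)
  from bounded_op_compose[OF bounded_op_P this]
  show "bounded_op UNIV UNIV (\<lambda>x. P (r *\<^sub>R push (snoc i) (map_ell2 Y x)))" by (simp add: o_def)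
  show "P (r *\<^sub>R push (snoc i) (map_ell2 Y (tensor_vec \<phi> k))) = tensor_vec (r *\<^sub>R W_op J i \<phi>) (Y k)"
    for \<phi> k
  proof -
    have "r *\<^sub>R push (snoc i) (map_ell2 Y (tensor_vec \<phi> k)) = tensor_vec (r *\<^sub>R push (snoc i) \<phi>) (Y k)"
      by (rule ell2_eqI)
        (simp add: map_ell2_tensor_vec[OF Y] push_tensor_vec scaleC.scaleR_left)
    moreover have "proj N (r *\<^sub>R push (snoc i) \<phi>) = r *\<^sub>R W_op J i \<phi>"
      using bounded_op_linear[OF bounded_op_proj[of N]]
      by (simp add: W_op_def right_creation_eq_push linear_simps)
    ultimately show ?thesis by (simp add: proj_tensor_vec)
  qed
qed

end

section \<open>The radial characteristic functions\<close>

lemma eventually_at_left_1: "\<forall>\<^sub>F r::real in at_left 1. 0 \<le> r \<and> r < 1"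
  using eventually_at_left[of 0 "1::real"] by (auto intro!: exI[of _ 0])

text \<open>The row operator [R_1, ..., R_n] tensor the identity, with n-tuples of Fock tensors read
  as one Fock tensor with vector coefficients.\<close>

definition row_shift :: "('n::finite, 'a::chilbert_space ^ 'n) fock_tensor \<Rightarrow> ('n, 'a) fock_tensor" where
  "row_shift v = (\<Sum>i\<in>UNIV. push (snoc i) (map_ell2 (\<lambda>u. u $ i) v))"

lemma ell2_nth_row_shift_Nil [simp]: "ell2_nth (row_shift v) [] = 0"
  by (simp add: row_shift_def ell2_nth_push_other image_iff)

lemma ell2_nth_row_shift_snoc [simp]: "ell2_nth (row_shift v) (w @ [j]) = ell2_nth v w $ j"
proof -
  have "ell2_nth (push (snoc i) (map_ell2 (\<lambda>u. u $ i) v)) (w @ [j]) = (if i = j then ell2_nth v w $ j else 0)" for i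
    using ell2_nth_push_image[OF inj_append_right, of "[j]" "map_ell2 (\<lambda>u. u $ j) v" w]
    by (auto simp: ell2_nth_push_other image_iff ell2_nth_map bounded_linear_vec_nth)
  then show ?thesis by (simp add: row_shift_def)
qed

lemma row_shift_diff: "row_shift (u - v) = row_shift u - row_shift v"
proof (rule ell2_eqI)
  show "ell2_nth (row_shift (u - v)) w = ell2_nth (row_shift u - row_shift v) w" for w
    by (cases w rule: rev_cases) simp_all
qed

lemma row_shift_add: "row_shift (u + v) = row_shift u + row_shift v"
proof (rule ell2_eqI)
  show "ell2_nth (row_shift (u + v)) w = ell2_nth (row_shift u + row_shift v) w" for w
    by (cases w rule: rev_cases) simp_all
qed

lemma norm_row_shift_le: "norm (row_shift v) \<le> norm v"
proof (rule power2_le_imp_le)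
  have le: "(\<Sum>k<m. \<Sum>w | length w = k. (norm (ell2_nth (row_shift v) w))\<^sup>2) \<le> (norm v)\<^sup>2" for m
  proof (cases m)
    case (Suc m')
    have "(\<Sum>k<m. \<Sum>w | length w = k. (norm (ell2_nth (row_shift v) w))\<^sup>2)
        = (\<Sum>k<m'. \<Sum>w | length w = k. (norm (ell2_nth v w))\<^sup>2)"
      unfolding Suc sum.lessThan_Suc_shift by (simp add: sum_words_Suc norm_vec_sq)
    then show ?thesis by (simp add: sum_levels_le_norm)
  qed simp
  show "(norm (row_shift v))\<^sup>2 \<le> (norm v)\<^sup>2"
    unfolding norm_ell2_sq[of "row_shift v"]
    by (rule LIMSEQ_le_const2[OF tendsto_sum_levels[OF _ ell2_nth_summable]]) (use le in auto)
qed simp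

lemma (in ideal) row_shift_ortho_compl:
  assumes "z \<in> ortho_compl (tensor_space N UNIV)"
  shows "row_shift z \<in> ortho_compl (tensor_space N UNIV)"
proof -
  have sub: "subspace (ortho_compl (tensor_space N (UNIV :: 'a set)))"
    by (simp add: csubspace_imp_subspace)
  show ?thesis
    unfolding row_shift_def
    by (intro subspace_sum[OF sub] push_ortho_compl[OF inj_append_right] pull_snoc_N
        map_ell2_ortho_compl[OF bounded_op_vec_nth] assms)
qed

section \<open>The states as the fixed point of a contraction\<close>

context row_contr
begin

lemma bounded_linears [simp]: "bounded_linear Trow" "bounded_linear Tadj" "bounded_linear \<Delta>"
  "bounded_linear \<Delta>s"
  by (simp_all add: bounded_op_linear)

definition state_map :: "real \<Rightarrow> ('n, 'h ^ 'n) fock_tensor \<Rightarrow> ('n, 'h) fock_tensor \<Rightarrow> ('n, 'h) fock_tensor"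
  where "state_map r x y = r *\<^sub>R row_shift (map_ell2 Tadj y + map_ell2 \<Delta>s x)"

lemma norm_map_Tadj: "norm (map_ell2 Tadj y) \<le> norm (y :: ('n, 'h) fock_tensor)"
  using norm_map_ell2_le[of Tadj 1 y] by (simp add: norm_Tadj_le)

lemma state_map_contraction:
  assumes "0 \<le> r"
  shows "dist (state_map r x y) (state_map r x y') \<le> r * dist y y'"
proof -
  have "map_ell2 Tadj y - map_ell2 Tadj y' = map_ell2 Tadj (y - y')"
    by (rule ell2_eqI) (simp add: ell2_nth_map Tadj.diff)
  then have "state_map r x y - state_map r x y' = r *\<^sub>R row_shift (map_ell2 Tadj (y - y'))"
    by (simp add: state_map_def scaleR_diff_right[symmetric] row_shift_diff[symmetric])
  moreover have "norm (row_shift (map_ell2 Tadj (y - y'))) \<le> norm (y - y')"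
    using norm_row_shift_le norm_map_Tadj order_trans by blast
  ultimately show ?thesis using assms by (simp add: dist_norm mult_left_mono)
qed

lemma state_map_fixed_point_nth:
  assumes "y = state_map r x y"
  shows "ell2_nth y w = state r 0 x w"
proof (induction w rule: rev_induct)
  case Nil
  show ?case by (subst assms) (simp add: state_map_def)
next
  case (snoc j w)
  show ?case by (subst assms) (simp add: state_map_def state_snoc ell2_nth_map snoc del: Tadj_nth)
qed

text \<open>The closed set is left free: the whole space yields existence, and the complement of N
  tensor H yields that the states of an input from there remain there.\<close>

lemma state_map_fixed_point_exists:
  assumes r: "0 \<le> r" "r < 1" and S: "closed S" "S \<noteq> {}" "\<And>y. y \<in> S \<Longrightarrow> state_map r x y \<in> S"
  shows "\<exists>y\<in>S. y = state_map r x y"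
proof -
  have "\<exists>!y\<in>S. state_map r x y = y"
    by (rule Banach_fix[OF _ S(2) r]) (use S state_map_contraction[OF r(1)] in \<open>auto simp: complete_eq_closed\<close>)
  then show ?thesis by metis
qed

definition state_fun :: "real \<Rightarrow> ('n, 'h ^ 'n) fock_tensor \<Rightarrow> ('n, 'h) fock_tensor" where
  "state_fun r x = Abs_ell2 (state r 0 x)"

text \<open>A fixed point has the states as its coordinates, which is what makes the family under
  \<open>Abs_ell2\<close> square-summable.\<close>

lemma state_map_fixed_point_eq:
  assumes "y = state_map r x y"
  shows "state_fun r x = y"
proof -
  have "state r 0 x = ell2_nth y" using state_map_fixed_point_nth[OF assms] by auto
  then show ?thesis by (simp add: state_fun_def ell2_nth_inverse)
qed

lemma state_fun_fixed_point:
  assumes "0 \<le> r" "r < 1"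
  shows "state_fun r x = state_map r x (state_fun r x)"
  using state_map_fixed_point_exists[OF assms closed_UNIV, of x] state_map_fixed_point_eq[of _ r x] by auto

definition char_output :: "real \<Rightarrow> ('n, 'h ^ 'n) fock_tensor \<Rightarrow> ('n, 'h) fock_tensor" where
  "char_output r x = map_ell2 \<Delta> (state_fun r x) - map_ell2 Trow x"

lemma ell2_nth_char_output:
  assumes "0 \<le> r" "r < 1"
  shows "ell2_nth (char_output r x) w = outp r 0 x w"
  using state_map_fixed_point_nth[OF state_fun_fixed_point[OF assms]]
  by (simp add: char_output_def ell2_nth_map outp_def)

text \<open>Sum the Julia identity over all words. Since \<open>y\<close> is \<open>r\<close> times
  the row shift of \<open>?u\<close>, the incoming state energy is at most the outgoing one, so
  output energy is at most input energy.\<close>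

lemma norm_char_output_le:
  assumes r: "0 \<le> r" "r < 1"
  shows "norm (char_output r x) \<le> norm x"
proof (rule power2_le_imp_le)
  let ?y = "state_fun r x"
  let ?u = "map_ell2 Tadj ?y + map_ell2 \<Delta>s x"
  have "(norm ?u)\<^sup>2 + (norm (char_output r x))\<^sup>2
      = (\<Sum>\<^sub>\<infinity>w. (norm (ell2_nth ?u w))\<^sup>2 + (norm (ell2_nth (char_output r x) w))\<^sup>2)"
    unfolding norm_ell2_sq by (intro infsum_add[symmetric] ell2_nth_summable)
  also have "\<dots> = (\<Sum>\<^sub>\<infinity>w. (norm (ell2_nth ?y w))\<^sup>2 + (norm (ell2_nth x w))\<^sup>2)"
    by (simp add: char_output_def ell2_nth_map julia_isometry)
  also have "\<dots> = (norm ?y)\<^sup>2 + (norm x)\<^sup>2"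
    unfolding norm_ell2_sq by (intro infsum_add ell2_nth_summable)
  finally have eq: "(norm ?u)\<^sup>2 + (norm (char_output r x))\<^sup>2 = (norm ?y)\<^sup>2 + (norm x)\<^sup>2" .
  have "norm ?y = r * norm (row_shift ?u)"
    using r by (subst state_fun_fixed_point[OF r]) (simp add: state_map_def)
  also have "\<dots> \<le> 1 * norm ?u" using r by (intro mult_mono norm_row_shift_le) auto
  finally have "(norm ?y)\<^sup>2 \<le> (norm ?u)\<^sup>2" by (intro power_mono) auto
  then show "(norm (char_output r x))\<^sup>2 \<le> (norm x)\<^sup>2" using eq by linarith
qed simp

end

text \<open>Coordinates converge because each is a finite recursion in \<open>r\<close>. The norm
  bound required of the approximants is the norm of \<open>x\<close>, and by purity that is the norm
  of the limit.\<close>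

lemma (in pure_row_contr) char_output_tendsto: "((\<lambda>r. char_output r x) \<longlongrightarrow> \<Theta> x) (at_left 1)"
proof (rule tendsto_ell2_coordinatewise)
  have n: "norm (\<Theta> x) = norm x" using norm_response[of 0 x] by simp
  show "\<forall>\<^sub>F r in at_left 1. norm (char_output r x) \<le> norm (\<Theta> x)"
    using eventually_at_left_1 by eventually_elim (simp add: norm_char_output_le n)
  fix w
  have "((\<lambda>r. outp r 0 x w) \<longlongrightarrow> outp 1 0 x w) (at_left 1)"
    unfolding outp_def by (intro tendsto_intros \<Delta>.tendsto state_tendsto)
  then show "((\<lambda>r. ell2_nth (char_output r x) w) \<longlongrightarrow> ell2_nth (\<Theta> x) w) (at_left 1)"
    unfolding ell2_nth_response
    by (rule Lim_transform_eventually)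
      (use eventually_at_left_1 in eventually_elim, simp add: ell2_nth_char_output)
qed

section \<open>Compression of the characteristic function to the constrained space\<close>

locale constrained_setup = ideal J + pure_row_contr T
  for J :: "('n::finite fock \<Rightarrow> 'n fock) set" and T :: "'n \<Rightarrow> 'h::chilbert_space \<Rightarrow> 'h" +
  assumes constrained: "constrained J T"
begin

sublocale P: bounded_linear "P :: ('n, 'h) fock_tensor \<Rightarrow> ('n, 'h) fock_tensor"
  by (rule bounded_op_linear) simp

lemma char_output_ortho_compl:
  assumes r: "0 \<le> r" "r < 1" and x: "x \<in> ortho_compl (tensor_space N UNIV)"
  shows "char_output r x \<in> ortho_compl (tensor_space N UNIV)"
proof -
  let ?S = "ortho_compl (tensor_space N (UNIV :: 'h set))"
  have S: "csubspace ?S" by simp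
  have "state_map r x y \<in> ?S" if "y \<in> ?S" for y
    unfolding state_map_def
    using that x map_ell2_ortho_compl[OF bounded_op_Tadj that] map_ell2_ortho_compl[OF bounded_op_defect_star x]
    by (intro csubspace_scaleR[OF S] row_shift_ortho_compl
        subspace_add[OF csubspace_imp_subspace[OF csubspace_ortho_compl]])
  moreover have "?S \<noteq> {}" using S by (auto simp: csubspace_def)
  ultimately obtain y where "y \<in> ?S" "y = state_map r x y"
    using state_map_fixed_point_exists[OF r closed_ortho_compl] by blast
  then have "state_fun r x \<in> ?S" using state_map_fixed_point_eq[of y r x] by simp
  then show ?thesis
    unfolding char_output_def
    by (intro csubspace_diff[OF S] map_ell2_ortho_compl x) simp_all
qed

lemma \<Theta>_ortho_compl:
  assumes x: "x \<in> ortho_compl (tensor_space N UNIV)"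
  shows "\<Theta> x \<in> ortho_compl (tensor_space N UNIV)"
proof (rule Lim_in_closed_set[OF closed_ortho_compl _ _ char_output_tendsto])
  show "\<forall>\<^sub>F r in at_left 1. char_output r x \<in> ortho_compl (tensor_space N UNIV)"
    using eventually_at_left[of 0 "1::real"] char_output_ortho_compl[OF _ _ x] by (auto intro!: exI[of _ 0])
qed simp

text \<open>The projected state solves the resolvent equation with W_i in place of R_i. The operator
  \<open>A\<close> is injective, so \<open>inv_into\<close> can only return that solution.\<close>

lemma char_fun_r_eq:
  assumes r: "0 \<le> r" "r < 1" and x: "x \<in> tensor_space N (defect_star_space T)"
  shows "char_fun_r J T r x = P (char_output r x)"
proof -
  let ?TS = "tensor_space N (UNIV :: 'h set)"
  define A where "A z = z - (\<Sum>i\<in>UNIV. tensor_op N UNIV (\<lambda>\<phi>. r *\<^sub>R W_op J i \<phi>) (adj (T i)) z)" for z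
  define y where "y = state_fun r x"
  have xN: "x \<in> tensor_space N UNIV"
    using x tensor_space_N_iff[OF csubspace_defect_star_space closed_defect_star_space] by blast
  have A_eq: "A z = z - P (r *\<^sub>R row_shift (map_ell2 Tadj z))" if z: "z \<in> ?TS" for z
  proof -
    have "map_ell2 (\<lambda>u. u $ i) (map_ell2 Tadj z) = map_ell2 (adj (T i)) z" for i
      by (rule ell2_eqI) (simp add: ell2_nth_map bounded_linear_vec_nth bounded_op_linear bounded_op_adj)
    then show ?thesis
      by (simp add: A_def tensor_op_W_op z bounded_op_adj P.sum[symmetric] scaleR_sum_right[symmetric]
          row_shift_def)
  qed
  have inj: "inj_on A ?TS"
  proof (rule inj_onI)
    fix z z' assume z: "z \<in> ?TS" "z' \<in> ?TS" and eq: "A z = A z'"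
    \<comment> \<open>With zero input \<open>state_map\<close> is the linear part of the equation,
      whose contraction constant \<open>r < 1\<close> survives projection.\<close>
    have "z - z' = P (state_map r 0 z) - P (state_map r 0 z')"
      using eq z by (simp add: A_eq state_map_def map_ell2_def[of \<Delta>s] \<Delta>s.zero algebra_simps
          zero_ell2_def[symmetric])
    then have "norm (z - z') \<le> norm (state_map r 0 z - state_map r 0 z')"
      unfolding P.diff[symmetric] by (simp add: norm_proj_le)
    also have "\<dots> \<le> r * norm (z - z')" using state_map_contraction[OF r(1), of 0 z z'] by (simp add: dist_norm)
    finally have "(1 - r) * norm (z - z') \<le> 0" by (simp add: algebra_simps)
    then show "z = z'" using r by (simp add: mult_le_0_iff)
  qed
  let ?b = "P (r *\<^sub>R row_shift (map_ell2 \<Delta>s x))"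
  have b: "(\<Sum>i\<in>UNIV. tensor_op N UNIV (\<lambda>\<phi>. r *\<^sub>R W_op J i \<phi>) (\<lambda>h. h $ i)
      (tensor_op N (defect_star_space T) id \<Delta>s x)) = ?b"
    by (simp add: tensor_op_id_left x tensor_op_W_op bounded_op_vec_nth map_ell2_tensor_space xN
        P.sum[symmetric] scaleR_sum_right[symmetric] row_shift_def)
  \<comment> \<open>Project the fixed point equation: the row shift sends the part
    \<open>y - P y\<close> into the complement, where \<open>P\<close> annihilates it, so only
    \<open>P y\<close> remains on the right.\<close>
  have "A (P y) = ?b"
  proof -
    have "row_shift (map_ell2 Tadj (y - P y)) \<in> ortho_compl (tensor_space N UNIV)"
      by (intro row_shift_ortho_compl map_ell2_ortho_compl) simp_all
    then have "P (row_shift (map_ell2 Tadj (y - P y))) = 0" by (simp add: proj_ortho_zero)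
    moreover have "map_ell2 Tadj (y - P y) = map_ell2 Tadj y - map_ell2 Tadj (P y)"
      by (rule ell2_eqI) (simp add: ell2_nth_map Tadj.diff)
    ultimately have 1: "P (row_shift (map_ell2 Tadj y)) = P (row_shift (map_ell2 Tadj (P y)))"
      by (simp add: row_shift_diff P.diff)
    have "P y = P (state_map r x y)"
      using state_fun_fixed_point[OF r, of x] by (simp add: y_def[symmetric])
    then have "P y = P (r *\<^sub>R row_shift (map_ell2 Tadj (P y))) + ?b"
      by (simp add: state_map_def row_shift_add P.add P.scaleR 1 scaleR_add_right)
    moreover have "A (P y) = P y - P (r *\<^sub>R row_shift (map_ell2 Tadj (P y)))"
      by (rule A_eq) simp
    ultimately show ?thesis by (metis add_diff_cancel_left')
  qed
  then have inv: "inv_into ?TS A ?b = P y"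
    using inv_into_f_f[OF inj, of "P y"] by simp
  have "char_fun_r J T r x = - map_ell2 Trow x + map_ell2 \<Delta> (P y)"
    unfolding char_fun_r_def Let_def b A_def[abs_def, symmetric] inv
    by (simp add: tensor_op_id_left x)
  also have "\<dots> = P (char_output r x)"
    by (simp add: char_output_def P.diff P_map_ell2 y_def P_id map_ell2_tensor_space xN)
  finally show ?thesis .
qed

lemma char_fun_eq:
  assumes x: "x \<in> tensor_space N (defect_star_space T)"
  shows "char_fun J T x = P (\<Theta> x)"
  unfolding char_fun_def
proof (rule tendsto_Lim)
  have "((\<lambda>r. P (char_output r x)) \<longlongrightarrow> P (\<Theta> x)) (at_left 1)"
    by (rule P.tendsto[OF char_output_tendsto])
  moreover have "\<forall>\<^sub>F r in at_left 1. P (char_output r x) = char_fun_r J T r x"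
    using eventually_at_left[of 0 "1::real"] char_fun_r_eq[OF _ _ x] by (auto intro!: exI[of _ 0])
  ultimately show "((\<lambda>r. char_fun_r J T r x) \<longlongrightarrow> P (\<Theta> x)) (at_left 1)"
    by (rule Lim_transform_eventually)
qed simp

end

section \<open>The Poisson kernel of a constrained row contraction\<close>

context pure_row_contr
begin

definition poisson_adj :: "('n, 'h) fock_tensor \<Rightarrow> 'h" where
  "poisson_adj = adj (\<lambda>h. poisson h)"

lemma cinner_poisson_adj: "cinner (poisson_adj z) h = cinner z (poisson h)"
  unfolding poisson_adj_def by (rule cinner_adj_left[OF bounded_op_response_state])

lemma bounded_op_poisson_adj: "bounded_op UNIV UNIV poisson_adj"
  unfolding poisson_adj_def by (rule bounded_op_adj[OF bounded_op_response_state])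

text \<open>Adjoint form of \<open>pull_poisson\<close>: the adjoint kernel turns left creation by
  \<open>i\<close> into \<open>T i\<close>, applied letter by letter.\<close>

lemma poisson_adj_single:
  "poisson_adj (ell2_single (w @ v) k) = word_op T w (poisson_adj (ell2_single v k))"
proof (induction w)
  case (Cons i w)
  have "ell2_single (i # u) k = push ((#) i) (ell2_single u k)" for u
  proof (rule ell2_eqI)
    fix w
    show "ell2_nth (ell2_single (i # u) k) w = ell2_nth (push ((#) i) (ell2_single u k)) w"
      by (cases "w \<in> range ((#) i)") (auto simp: ell2_nth_single ell2_nth_push_other split: if_splits)
  qed
  moreover have "poisson_adj (push ((#) i) z) = T i (poisson_adj z)" for z
    by (rule cinner_ext)
      (simp add: cinner_poisson_adj cinner_push pull_poisson cinner_adj)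
  ultimately show ?case using Cons by (simp add: word_op_Cons)
qed simp

text \<open>On these vectors the series at radius \<open>r\<close> is the bounded operator
  \<open>L\<close> applied to the dilation of \<open>a\<close> with coefficients scaled by powers of
  \<open>r\<close>. The dilations tend to \<open>a\<close>, so the radial limit exists and equals
  \<open>L a\<close>.\<close>

lemma func_calc_poisson_adj:
  assumes a: "a = f (basis_vec [])"
  shows "func_calc f T (poisson_adj (ell2_single v k))
    = poisson_adj (tensor_vec (push (\<lambda>w. w @ v) a) k)"
proof -
  define L where "L \<phi> = poisson_adj (tensor_vec (push (\<lambda>w. w @ v) \<phi>) k)" for \<phi> :: "'n fock"
  have L: "bounded_op UNIV UNIV L"
    using bounded_op_compose[OF bounded_op_poisson_adj
        bounded_op_compose[OF bounded_op_tensor_vec_left bounded_op_push[OF inj_append_right]], of k v]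
    by (simp add: L_def[abs_def] o_def)
  interpret L: bounded_linear L by (rule bounded_op_linear[OF L])
  have L_single: "L (ell2_single w c) = c *\<^sub>C word_op T w (poisson_adj (ell2_single v k))" for w c
  proof -
    have "tensor_vec (push (\<lambda>w. w @ v) (ell2_single w c)) k = c *\<^sub>C ell2_single (w @ v) k"
      by (rule ell2_eqI) (auto simp: ell2_nth_push ell2_nth_single inv_f_f[OF inj_append_right])
    then show ?thesis
      by (simp add: L_def bounded_op_scaleC[OF bounded_op_poisson_adj] poisson_adj_single)
  qed
  define ar where "ar r = Abs_ell2 (\<lambda>w. complex_of_real r ^ length w * ell2_nth a w)" for r
  have ar: "ell2_nth (ar r) w = complex_of_real r ^ length w * ell2_nth a w" if "0 \<le> r" "r \<le> 1" for r w
  proof -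
    have "(\<lambda>w. (norm (complex_of_real r ^ length w * ell2_nth a w))\<^sup>2) summable_on UNIV"
      using that
      by (intro summable_on_le_real[OF ell2_nth_summable[of a]])
        (auto simp: norm_mult norm_power power_mult_distrib power_le_one mult_left_le_one_le)
    then show ?thesis by (simp add: ar_def ell2_nth_Abs)
  qed
  have "(ar \<longlongrightarrow> a) (at_left 1)"
  proof (rule tendsto_ell2_coordinatewise)
    fix w
    have "((\<lambda>r. complex_of_real r ^ length w * ell2_nth a w) \<longlongrightarrow>
        complex_of_real 1 ^ length w * ell2_nth a w) (at_left 1)"
      by (intro tendsto_intros)
    then have "((\<lambda>r. complex_of_real r ^ length w * ell2_nth a w) \<longlongrightarrow> ell2_nth a w) (at_left 1)"
      by simp
    then show "((\<lambda>r. ell2_nth (ar r) w) \<longlongrightarrow> ell2_nth a w) (at_left 1)"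
      by (rule Lim_transform_eventually) (use eventually_at_left_1 in eventually_elim, simp add: ar)
    show "\<forall>\<^sub>F r in at_left 1. norm (ar r) \<le> norm a"
      using eventually_at_left_1
    proof eventually_elim
      case (elim r)
      have "(norm (ar r))\<^sup>2 \<le> (norm a)\<^sup>2"
        by (rule norm_ell2_le, rule order_trans[OF _ sum_ell2_le])
          (use elim in \<open>auto simp: ar norm_mult norm_power power_mult_distrib power_le_one
            mult_left_le_one_le intro!: sum_mono\<close>)
      then show ?case by (rule power2_le_imp_le) simp
    qed
  qed
  then have lim: "((\<lambda>r. L (ar r)) \<longlongrightarrow> L a) (at_left 1)" by (rule L.tendsto)
  have eq: "(\<Sum>m. \<Sum>w | length w = m. (complex_of_real r ^ length w * ell2_nth a w) *\<^sub>C
      word_op T w (poisson_adj (ell2_single v k))) = L (ar r)" if "0 \<le> r" "r < 1" for r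
  proof -
    have "(\<lambda>m. L (\<Sum>w | length w = m. ell2_single w (ell2_nth (ar r) w))) sums L (ar r)"
      by (rule L.sums[OF sums_words_single])
    then show ?thesis
      using that by (simp add: L.sum L_single ar sums_iff)
  qed
  have "func_calc f T (poisson_adj (ell2_single v k)) = L a"
    unfolding func_calc_def a[symmetric]
  proof (rule tendsto_Lim)
    show "((\<lambda>r. \<Sum>m. \<Sum>w | length w = m. (complex_of_real r ^ length w * ell2_nth a w) *\<^sub>C
      word_op T w (poisson_adj (ell2_single v k))) \<longlongrightarrow> L a) (at_left 1)"
      using lim by (rule Lim_transform_eventually) (use eventually_at_left_1 in eventually_elim, simp only: eq)
  qed simp
  then show ?thesis by (simp add: L_def)
qed

end

context constrained_setup
begin

text \<open>Commuting with right creation, \<open>f\<close> is determined by its value at the vacuum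
  vector.\<close>

lemma J_basis_vec:
  assumes "f \<in> J"
  shows "f (basis_vec v) = push (\<lambda>w. w @ v) (f (basis_vec []))"
proof (induction v rule: rev_induct)
  case Nil
  show ?case by (rule ell2_eqI) (use ell2_nth_push_image[OF inj_append_right, of "[]" "f (basis_vec [])"] in simp)
next
  case (snoc j v)
  have "f (basis_vec (v @ [j])) = push (snoc j) (f (basis_vec v))"
    by (simp add: right_creation_basis_vec[symmetric] right_creation_eq_push J_commute[OF assms])
  also have "\<dots> = push (snoc j) (push (\<lambda>w. w @ v) (f (basis_vec [])))" by (simp only: snoc)
  also have "\<dots> = push (\<lambda>w. w @ v @ [j]) (f (basis_vec []))"
  proof (rule cinner_ext)
    fix z :: "'n fock"
    have "pull (\<lambda>w. w @ v) (pull (snoc j) z) = pull (\<lambda>w. w @ v @ [j]) z"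
      by (rule ell2_eqI) simp
    then show "cinner (push (snoc j) (push (\<lambda>w. w @ v) (f (basis_vec [])))) z
        = cinner (push (\<lambda>w. w @ v @ [j]) (f (basis_vec []))) z"
      by (simp add: cinner_push)
  qed
  finally show ?case .
qed

text \<open>For basis vectors, f(T) = 0 on the adjoint kernel says that the adjoint kernel kills
  \<open>f (basis_vec v)\<close> tensor \<open>k\<close>. Linearity and continuity extend this to
  the closed span of the ranges of \<open>J\<close>, which is the complement of
  \<open>N\<close>.\<close>

lemma poisson_in_tensor_space: "poisson h \<in> tensor_space N (defect_space T)"
proof -
  have basis: "cinner (tensor_vec (f (basis_vec v)) k) (poisson h) = 0" if f: "f \<in> J" for f v k
  proof -
    have "func_calc f T (poisson_adj (ell2_single v k)) = 0"
      using constrained f by (simp add: constrained_def)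
    then have "poisson_adj (tensor_vec (f (basis_vec v)) k) = 0"
      using func_calc_poisson_adj[OF refl, of f v k] J_basis_vec[OF f, of v] by simp
    then show ?thesis by (simp add: cinner_poisson_adj[symmetric])
  qed
  have J0: "cinner (tensor_vec (f \<psi>) k) (poisson h) = 0" if f: "f \<in> J" for f \<psi> k
  proof -
    define L where "L \<psi> = cinner (tensor_vec (f \<psi>) k) (poisson h)" for \<psi>
    note b = bounded_op_compose[OF bounded_op_tensor_vec_left J_bounded[OF f], of k]
    interpret L: bounded_linear L
      using bounded_linear_compose[OF cinner.bounded_linear_left bounded_op_linear[OF b]]
      by (simp add: L_def[abs_def] o_def)
    have "L (ell2_single w c) = 0" for w c
    proof -
      have "ell2_single w c = c *\<^sub>C basis_vec w"
        by (rule ell2_eqI) (simp add: basis_vec.rep_eq ell2_nth_single scaleC_complex_def)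
      then show ?thesis
        using bounded_op_scaleC[OF b, of c "basis_vec w"] basis[OF f]
        by (simp add: L_def cinner_scaleC_left)
    qed
    then have "(\<lambda>m. 0) sums L \<psi>"
      using L.sums[OF sums_words_single[of \<psi>]] by (simp add: L.sum)
    then show ?thesis using sums_unique2[OF sums_zero] by (simp add: L_def)
  qed
  have "cinner (poisson h) (tensor_vec \<phi> k) = 0" if "\<phi> \<in> ortho_compl N" for \<phi> k
  proof -
    interpret t: bounded_linear "\<lambda>\<phi>. tensor_vec \<phi> k"
      by (rule bounded_op_linear[OF bounded_op_tensor_vec_left])
    let ?V = "{\<phi>. cinner (poisson h) (tensor_vec \<phi> k) = 0}"
    have "closed ?V"
      by (intro closed_Collect_eq cinner.continuous_on continuous_on_const
          t.continuous_on continuous_on_id)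
    moreover have "csubspace ?V"
      by (simp add: csubspace_def t.add t.zero bounded_op_scaleC[OF bounded_op_tensor_vec_left]
          cinner.add_right cinner_scaleC_right)
    ultimately have "ccspan {f \<phi> | f \<phi>. f \<in> J} \<subseteq> ?V"
      using J0 by (intro ccspan_minimal) (auto simp: cinner_eq_zero_commute[of "poisson h"])
    then show ?thesis using that by (auto simp: ortho_compl_N)
  qed
  then have "poisson h \<in> tensor_space N UNIV" by (simp add: tensor_space_UNIV_iff)
  moreover have "ell2_nth (poisson h) w \<in> defect_space T" for w
    by (simp add: outp_def Trow.zero)
  ultimately show ?thesis
    by (subst tensor_space_N_iff) simp_all
qed

section \<open>The range of the Poisson kernel inside the constrained space\<close>

lemma response_values:
  assumes "\<And>w. ell2_nth x w \<in> defect_star_space T"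
  shows "ell2_nth (\<Theta> x) w \<in> defect_space T"
  unfolding ell2_nth_response outp_def
  by (intro csubspace_diff[OF csubspace_defect_space] defect_in_space Trow_in_defect_space assms)

text \<open>For \<open>z\<close> in N tensor D, projecting the output changes no inner product with
  \<open>z\<close>. Nor does projecting the input, since \<open>\<Theta>\<close> maps the discarded
  part into the complement.\<close>

lemma model_space_iff:
  assumes z: "z \<in> tensor_space N (defect_space T)"
  shows "z \<in> range (\<lambda>h. poisson h) \<longleftrightarrow>
    (\<forall>x\<in>tensor_space N (defect_star_space T). cinner z (char_fun J T x) = 0)"
proof -
  let ?D = "defect_star_space T"
  have zU: "z \<in> tensor_space N UNIV" and zD: "\<And>w. ell2_nth z w \<in> defect_space T"
    using z tensor_space_N_iff[OF csubspace_defect_space closed_defect_space] by blast+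
  have P: "cinner z (P y) = cinner z y" for y
    by (rule cinner_proj_right[OF _ _ zU]) simp_all
  have "cinner z (\<Theta> x) = cinner z (char_fun J T (proj (tensor_space N ?D) x))"
    if x: "\<And>w. ell2_nth x w \<in> ?D" for x
  proof -
    let ?p = "proj (tensor_space N ?D) x"
    have p: "?p \<in> tensor_space N ?D" by (simp add: proj_in)
    have "x - ?p \<in> ortho_compl (tensor_space N UNIV)"
      using proj_tensor_space_eq_P[OF _ _ x] by simp
    then have "\<Theta> (x - ?p) \<in> ortho_compl (tensor_space N UNIV)" by (rule \<Theta>_ortho_compl)
    then have "cinner z (\<Theta> (x - ?p)) = 0"
      using ortho_complD zU cinner_eq_zero_commute by blast
    moreover have "\<Theta> x = \<Theta> ?p + \<Theta> (x - ?p)" using response_add[of 0 0 ?p "x - ?p"] by simp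
    ultimately show ?thesis by (simp add: char_fun_eq[OF p] P cinner.add_right)
  qed
  moreover have "cinner z (char_fun J T x) = cinner z (\<Theta> x)" if "x \<in> tensor_space N ?D" for x
    using that by (simp add: char_fun_eq P)
  moreover have "ell2_nth x w \<in> ?D" if "x \<in> tensor_space N ?D" for x w
    using that tensor_space_N_iff[OF csubspace_defect_star_space closed_defect_star_space] by blast
  moreover have "proj (tensor_space N ?D) x \<in> tensor_space N ?D" for x
    by (simp add: proj_in)
  ultimately show ?thesis
    unfolding range_poisson_iff[OF zD] by metis
qed

lemma char_fun_in_tensor_space:
  assumes x: "x \<in> tensor_space N (defect_star_space T)"
  shows "char_fun J T x \<in> tensor_space N (defect_space T)"
proof -
  have xD: "\<And>w. ell2_nth x w \<in> defect_star_space T"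
    using x tensor_space_N_iff[OF csubspace_defect_star_space closed_defect_star_space] by blast
  have "char_fun J T x = proj (tensor_space N (defect_space T)) (\<Theta> x)"
    using proj_tensor_space_eq_P[OF csubspace_defect_space closed_defect_space response_values[OF xD]]
    by (simp add: char_fun_eq[OF x])
  then show ?thesis by (simp add: proj_in)
qed

end

section \<open>Unitary multi-analytic operators\<close>

context ideal
begin

lemma multi_analytic_iff:
  assumes K: "csubspace K" "closed K" and K': "csubspace K'" "closed K'"
  shows "multi_analytic J K K' M \<longleftrightarrow>
    bounded_op (tensor_space N K) (tensor_space N K') M \<and>
    (\<forall>i. \<forall>x\<in>tensor_space N K. M (proj (tensor_space N K) (push ((#) i) x)) =
      proj (tensor_space N K') (push ((#) i) (M x)))"
proof -
  have "M x \<in> tensor_space N K'" if "bounded_op (tensor_space N K) (tensor_space N K') M"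
    "x \<in> tensor_space N K" for x
    using that by (auto simp: bounded_op_def)
  then show ?thesis
    unfolding multi_analytic_def by (auto simp: tensor_op_B_op[OF K] tensor_op_B_op[OF K'])
qed

text \<open>A unitary intertwiner also intertwines the adjoints, and the adjoint of the compressed
  left creation is \<open>pull\<close> itself because \<open>N\<close> is invariant under it.
  Surjectivity writes the difference \<open>?d\<close> as \<open>U z\<close>, which is then tested
  against itself.\<close>

lemma unitary_multi_analytic_pull:
  fixes U :: "('n, 'a::chilbert_space) fock_tensor \<Rightarrow> ('n, 'b::chilbert_space) fock_tensor"
  assumes K: "csubspace K" "closed K" and K': "csubspace K'" "closed K'"
    and ma: "multi_analytic J K K' U" and un: "unitary_op (tensor_space N K) (tensor_space N K') U"
    and x: "x \<in> tensor_space N K"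
  shows "U (pull ((#) i) x) = pull ((#) i) (U x)"
proof -
  let ?S = "tensor_space N K" and ?S' = "tensor_space N K'"
  have U_in: "U z \<in> ?S'" if "z \<in> ?S" for z
    using un that by (auto simp: unitary_op_def)
  have U_inner: "cinner (U y) (U z) = cinner y z" if "y \<in> ?S" "z \<in> ?S" for y z
    using un that by (simp add: unitary_op_def)
  have U_proj: "U (proj ?S (push ((#) i) z)) = proj ?S' (push ((#) i) (U z))" if "z \<in> ?S" for z
    using ma that multi_analytic_iff[OF K K'] by blast
  have px: "pull ((#) i) x \<in> ?S" and pUx: "pull ((#) i) (U x) \<in> ?S'"
    by (intro pull_tensor_space pull_Cons_N K K' x U_in; simp)+
  let ?d = "U (pull ((#) i) x) - pull ((#) i) (U x)"
  have d: "?d \<in> ?S'" by (intro csubspace_diff U_in px pUx csubspace_tensor_space)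
  moreover have "?S' = U ` ?S" using un by (simp add: unitary_op_def)
  ultimately have "?d \<in> U ` ?S" by simp
  then obtain z where z: "z \<in> ?S" "?d = U z" by blast
  have "cinner (U (pull ((#) i) x)) (U z) = cinner (pull ((#) i) x) z" by (rule U_inner[OF px z(1)])
  also have "\<dots> = cinner x (proj ?S (push ((#) i) z))"
    by (simp add: cinner_pull cinner_proj_right x)
  also have "\<dots> = cinner (U x) (U (proj ?S (push ((#) i) z)))"
    by (rule U_inner[symmetric, OF x]) (simp add: proj_in)
  also have "\<dots> = cinner (pull ((#) i) (U x)) (U z)"
    by (simp add: U_proj z cinner_proj_right U_in x cinner_pull)
  finally have "cinner ?d ?d = 0" unfolding z(2)[symmetric] by (simp add: cinner.diff_left)
  then show ?thesis by (simp add: cinner_self)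
qed

text \<open>Acting on coefficients only, \<open>map_ell2 Y\<close> commutes with shifts and with
  \<open>P\<close>. The right inverse \<open>Z\<close> carries \<open>K'\<close> back into
  \<open>K\<close> and so supplies surjectivity between the coefficient spaces.\<close>

lemma map_ell2_unitary_multi_analytic:
  fixes Y :: "'a::chilbert_space \<Rightarrow> 'b::chilbert_space"
  assumes K: "csubspace K" "closed K" and K': "csubspace K'" "closed K'"
    and Y: "bounded_op UNIV UNIV Y" and Z: "bounded_op UNIV UNIV Z"
    and inner: "\<And>x y. cinner (Y x) (Y y) = cinner x y" and YZ: "\<And>y. Y (Z y) = y"
    and YK: "\<And>k. k \<in> K \<Longrightarrow> Y k \<in> K'" and ZK: "\<And>k. k \<in> K' \<Longrightarrow> Z k \<in> K"
  shows "unitary_op (tensor_space N K) (tensor_space N K') (map_ell2 Y)"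
    and "multi_analytic J K K' (map_ell2 Y)"
proof -
  let ?S = "tensor_space N K" and ?S' = "tensor_space N K'"
  have Y_in: "map_ell2 Y x \<in> ?S'" if "x \<in> ?S" for x
    using that unfolding tensor_space_N_iff[OF K] tensor_space_N_iff[OF K']
    by (simp add: map_ell2_tensor_space Y YK ell2_nth_map bounded_op_linear)
  have Z_in: "map_ell2 Z x \<in> ?S" if "x \<in> ?S'" for x
    using that unfolding tensor_space_N_iff[OF K] tensor_space_N_iff[OF K']
    by (simp add: map_ell2_tensor_space Z ZK ell2_nth_map bounded_op_linear)
  have b: "bounded_op ?S ?S' (map_ell2 Y)"
    using bounded_op_subset[OF bounded_op_map_ell2[OF Y]] Y_in by blast
  have YZ': "map_ell2 Y (map_ell2 Z x) = x" for x :: "('n, 'b) fock_tensor"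
    by (rule ell2_eqI) (simp add: ell2_nth_map bounded_op_linear Y Z YZ)
  have "x \<in> map_ell2 Y ` ?S" if "x \<in> ?S'" for x
    using Z_in[OF that] YZ'[of x] by (metis imageI)
  then show "unitary_op ?S ?S' (map_ell2 Y)"
    using b Y_in by (auto simp: unitary_op_def cinner_ell2_def ell2_nth_map bounded_op_linear Y inner)
  have "map_ell2 Y (proj ?S (push ((#) i) x)) = proj ?S' (push ((#) i) (map_ell2 Y x))"
    if x: "x \<in> ?S" for i x
  proof -
    \<comment> \<open>A push fills the remaining coordinates with 0, so its values stay in the
      coefficient spaces and both projections become \<open>P\<close>.\<close>
    have 0: "0 \<in> K" "0 \<in> K'" using K K' by (auto simp: csubspace_def)
    have "ell2_nth x w \<in> K" for w using x tensor_space_N_iff[OF K] by blast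
    then have "ell2_nth (push ((#) i) x) w \<in> K" "ell2_nth (push ((#) i) (map_ell2 Y x)) w \<in> K'" for w
      using 0 YK by (simp_all add: ell2_nth_push ell2_nth_map bounded_op_linear Y)
    then have "proj ?S (push ((#) i) x) = P (push ((#) i) x)"
      "proj ?S' (push ((#) i) (map_ell2 Y x)) = P (push ((#) i) (map_ell2 Y x))"
      by (auto intro: proj_tensor_space_eq_P K K')
    then show ?thesis
      by (simp only: P_map_ell2[OF Y, symmetric] map_ell2_push[OF inj_Cons bounded_op_linear[OF Y]])
  qed
  then show "multi_analytic J K K' (map_ell2 Y)"
    using b by (simp add: multi_analytic_iff K K')
qed

end

section \<open>Unitarily equivalent row contractions have coinciding characteristic functions\<close>

definition vec_map :: "('a::chilbert_space \<Rightarrow> 'b::chilbert_space) \<Rightarrow> 'a ^ 'n::finite \<Rightarrow> 'b ^ 'n" where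
  "vec_map U x = (\<chi> i. U (x $ i))"

lemma vec_map_nth [simp]: "vec_map U x $ i = U (x $ i)"
  by (simp add: vec_map_def)

lemma cinner_vec_map:
  "(\<And>x y. cinner (U x) (U y) = cinner x y) \<Longrightarrow> cinner (vec_map U x) (vec_map U y) = cinner x y"
  by (simp add: cinner_vec_def)

lemma isometry_bounded_op:
  assumes "\<And>x y. U (x + y) = U x + U y" "\<And>c x. U (c *\<^sub>C x) = c *\<^sub>C U x"
    "\<And>x y. cinner (U x) (U y) = cinner x y"
  shows "bounded_op UNIV UNIV U"
proof -
  have "norm (U x) = norm x" for x
  proof -
    have "complex_of_real ((norm (U x))\<^sup>2) = complex_of_real ((norm x)\<^sup>2)"
      by (simp only: cinner_self[symmetric] assms(3))
    then have "(norm (U x))\<^sup>2 = (norm x)\<^sup>2" using of_real_eq_iff by blast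
    then show ?thesis by simp
  qed
  then show ?thesis using assms by (auto simp: bounded_op_def intro!: exI[of _ 1])
qed

text \<open>Instantiated with a unitary and with its inverse, so that the inclusions of defect
  spaces hold in both directions.\<close>

locale intertwined = T: row_contr T + T': row_contr T'
  for T :: "'n::finite \<Rightarrow> 'h::chilbert_space \<Rightarrow> 'h" and T' :: "'n \<Rightarrow> 'k::chilbert_space \<Rightarrow> 'k" +
  fixes U :: "'h \<Rightarrow> 'k"
  assumes U: "bounded_op UNIV UNIV U" and U_cinner: "cinner (U x) (U y) = cinner x y"
    and U_T: "U (T i h) = T' i (U h)" and U_adj: "U (adj (T i) h) = adj (T' i) (U h)"
begin

sublocale U: bounded_linear U by (rule bounded_op_linear[OF U])

lemma bounded_op_vec_map: "bounded_op UNIV UNIV (vec_map U :: 'h ^ 'n \<Rightarrow> 'k ^ 'n)"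
  by (rule isometry_bounded_op)
    (simp_all add: vec_eq_iff U.add bounded_op_scaleC[OF U] cinner_vec_map U_cinner)

sublocale vec_map_U: bounded_linear "vec_map U :: 'h ^ 'n \<Rightarrow> 'k ^ 'n"
  by (rule bounded_op_linear[OF bounded_op_vec_map])

lemma U_row: "U (row_op T x) = row_op T' (vec_map U x)"
  by (simp add: row_op_def U.sum U_T)

lemma U_row_adj: "vec_map U (adj (row_op T) h) = adj (row_op T') (U h)"
  by (simp add: vec_eq_iff U_adj)

lemma U_defect: "U (defect T h) = defect T' (U h)"
  unfolding T.defect_eq_root T'.defect_eq_root
  by (rule root_intertwine[OF T.selfadjoint_contraction_Trow T'.selfadjoint_contraction_Trow
        U.bounded_linear]) (simp only: U_row U_row_adj)

lemma U_defect_star: "vec_map U (defect_star T x) = defect_star T' (vec_map U x)"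
  unfolding T.defect_star_eq_root T'.defect_star_eq_root
  by (rule root_intertwine[OF T.selfadjoint_contraction_Tadj T'.selfadjoint_contraction_Tadj
        vec_map_U.bounded_linear]) (simp only: U_row U_row_adj)

lemma U_defect_space:
  assumes "h \<in> defect_space T"
  shows "U h \<in> defect_space T'"
proof -
  obtain f where f: "\<And>n::nat. f n \<in> range (defect T)" "f \<longlonglongrightarrow> h"
    using assms by (auto simp: defect_space_def closure_sequential)
  have "U (f n) \<in> defect_space T'" for n using f(1)[of n] by (auto simp: U_defect)
  moreover have "(\<lambda>n. U (f n)) \<longlonglongrightarrow> U h" using f(2) by (rule U.tendsto)
  ultimately show ?thesis by (rule closed_sequentially[OF T'.closed_defect_space])
qed

lemma U_defect_star_space:
  assumes "x \<in> defect_star_space T"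
  shows "vec_map U x \<in> defect_star_space T'"
proof -
  obtain f where f: "\<And>n::nat. f n \<in> range (defect_star T)" "f \<longlonglongrightarrow> x"
    using assms by (auto simp: defect_star_space_def closure_sequential)
  have "vec_map U (f n) \<in> defect_star_space T'" for n using f(1)[of n] by (auto simp: U_defect_star)
  moreover have "(\<lambda>n. vec_map U (f n)) \<longlonglongrightarrow> vec_map U x" using f(2) by (rule vec_map_U.tendsto)
  ultimately show ?thesis by (rule closed_sequentially[OF T'.closed_defect_star_space])
qed

lemma U_state: "U (T.state r h x w) = T'.state r (U h) (map_ell2 (vec_map U) x) w"
proof (induction w rule: rev_induct)
  case (snoc j w)
  have "U (T.state r h x (w @ [j]))
      = r *\<^sub>R (vec_map U (adj (row_op T) (T.state r h x w) + defect_star T (ell2_nth x w)) $ j)"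
    by (simp add: T.state_snoc U.scaleR)
  also have "\<dots> = T'.state r (U h) (map_ell2 (vec_map U) x) (w @ [j])"
    by (simp only: vec_map_U.add U_row_adj U_defect_star snoc T'.state_snoc
        ell2_nth_map[OF vec_map_U.bounded_linear])
  finally show ?case .
qed simp

lemma U_response: "map_ell2 U (T.response h x) = T'.response (U h) (map_ell2 (vec_map U) x)"
  by (rule ell2_eqI)
    (simp add: ell2_nth_map U.bounded_linear vec_map_U.bounded_linear T.outp_def T'.outp_def U.diff
      U_defect U_state U_row)

end

text \<open>\<open>U\<close> carries the whole system of T to that of T', hence responses to
  responses. Tensoring the identity with \<open>U\<close>, and with its diagonal copy on n-tuples,
  gives the two unitaries.\<close>

lemma unitarily_equivalent_imp_coincide:
  fixes T :: "'n::finite \<Rightarrow> 'h::chilbert_space \<Rightarrow> 'h" and T' :: "'n \<Rightarrow> 'k::chilbert_space \<Rightarrow> 'k"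
  assumes "constrained_setup J T" "constrained_setup J T'" "unitarily_equivalent T T'"
  shows "coincide J (defect_star_space T) (defect_space T) (char_fun J T)
    (defect_star_space T') (defect_space T') (char_fun J T')"
proof -
  interpret T: constrained_setup J T by fact
  interpret T': constrained_setup J T' by fact
  obtain U where un: "unitary_op UNIV UNIV U" and TU: "\<And>i. T i = adj U \<circ> T' i \<circ> U"
    using assms(3) by (auto simp: unitarily_equivalent_def)
  have U: "bounded_op UNIV UNIV U" and U_cinner: "\<And>x y. cinner (U x) (U y) = cinner x y"
    and surj: "range U = UNIV"
    using un by (auto simp: unitary_op_def)
  have adj_U: "adj U (U x) = x" for x
    by (rule cinner_ext) (simp add: cinner_adj_left[OF U] U_cinner)
  have U_adj: "U (adj U y) = y" for y
    using adj_U surj by (metis rangeE UNIV_I)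
  have adj_cinner: "cinner (adj U x) (adj U y) = cinner x y" for x y
    using U_cinner[of "adj U x" "adj U y"] by (simp add: U_adj)
  have UT: "U (T i h) = T' i (U h)" for i h by (simp add: TU U_adj)
  have UTadj: "U (adj (T i) h) = adj (T' i) (U h)" for i h
  proof (rule cinner_ext)
    fix z
    obtain g where g: "z = U g" using surj by blast
    show "cinner (U (adj (T i) h)) z = cinner (adj (T' i) (U h)) z"
      by (simp add: g U_cinner cinner_adj_left UT[symmetric])
  qed
  interpret I: intertwined T T' U
    by unfold_locales (fact U U_cinner UT UTadj)+
  interpret I': intertwined T' T "adj U"
  proof unfold_locales
    show "bounded_op UNIV UNIV (adj U)" by (rule bounded_op_adj[OF U])
    show "cinner (adj U x) (adj U y) = cinner x y" for x y by (rule adj_cinner)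
    show "adj U (T' i h) = T i (adj U h)" for i h using UT[of i "adj U h"] by (metis U_adj adj_U)
    show "adj U (adj (T' i) h) = adj (T i) (adj U h)" for i h
      using UTadj[of i "adj U h"] by (metis U_adj adj_U)
  qed
  let ?U\<^sub>1 = "map_ell2 (vec_map U) :: ('n, 'h ^ 'n) fock_tensor \<Rightarrow> _" and ?U\<^sub>2 = "map_ell2 U"
  have vec: "vec_map U (vec_map (adj U) y) = y" for y :: "'k ^ 'n"
    by (simp add: vec_eq_iff U_adj)
  have U1: "unitary_op (tensor_space (N_space J) (defect_star_space T))
      (tensor_space (N_space J) (defect_star_space T')) ?U\<^sub>1"
    "multi_analytic J (defect_star_space T) (defect_star_space T') ?U\<^sub>1"
    by (rule T.map_ell2_unitary_multi_analytic[where Z = "vec_map (adj U)"];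
        simp add: I.bounded_op_vec_map I'.bounded_op_vec_map cinner_vec_map U_cinner vec
          I.U_defect_star_space I'.U_defect_star_space)+
  have U2: "unitary_op (tensor_space (N_space J) (defect_space T))
      (tensor_space (N_space J) (defect_space T')) ?U\<^sub>2"
    "multi_analytic J (defect_space T) (defect_space T') ?U\<^sub>2"
    by (rule T.map_ell2_unitary_multi_analytic[where Z = "adj U"];
        simp add: U bounded_op_adj U_cinner U_adj I.U_defect_space I'.U_defect_space)+
  have "char_fun J T' (?U\<^sub>1 x) = ?U\<^sub>2 (char_fun J T x)"
    if x: "x \<in> tensor_space (N_space J) (defect_star_space T)" for x
  proof -
    have "?U\<^sub>1 x \<in> tensor_space (N_space J) (defect_star_space T')"
      using U1(1) x by (auto simp: unitary_op_def)
    then show ?thesis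
      using x I.U_response[of 0 x] by (simp add: T'.char_fun_eq T.char_fun_eq T.P_map_ell2[OF U, symmetric] I.U.zero)
  qed
  then show ?thesis
    unfolding coincide_def using U1 U2 by blast
qed

section \<open>Coinciding characteristic functions determine the row contraction\<close>

text \<open>\<open>U\<^sub>2\<close> matches the two model spaces because each is the complement of
  the range of its characteristic function. Conjugating it with the Poisson kernels gives a unitary
  between the original spaces.\<close>

lemma coincide_imp_unitarily_equivalent:
  fixes T :: "'n::finite \<Rightarrow> 'h::chilbert_space \<Rightarrow> 'h" and T' :: "'n \<Rightarrow> 'k::chilbert_space \<Rightarrow> 'k"
  assumes "constrained_setup J T" "constrained_setup J T'"
    and "coincide J (defect_star_space T) (defect_space T) (char_fun J T)
      (defect_star_space T') (defect_space T') (char_fun J T')"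
  shows "unitarily_equivalent T T'"
proof -
  interpret T: constrained_setup J T by fact
  interpret T': constrained_setup J T' by fact
  let ?K = "\<lambda>h. T.response h 0" and ?K' = "\<lambda>h. T'.response h 0"
  let ?S\<^sub>1 = "tensor_space (N_space J) (defect_star_space T)"
    and ?S\<^sub>1' = "tensor_space (N_space J) (defect_star_space T')"
    and ?S\<^sub>2 = "tensor_space (N_space J) (defect_space T)"
    and ?S\<^sub>2' = "tensor_space (N_space J) (defect_space T')"
  obtain U\<^sub>1 U\<^sub>2 where ma: "multi_analytic J (defect_space T) (defect_space T') U\<^sub>2"
    and un1: "unitary_op ?S\<^sub>1 ?S\<^sub>1' U\<^sub>1" and un2: "unitary_op ?S\<^sub>2 ?S\<^sub>2' U\<^sub>2"
    and \<Theta>: "\<And>x. x \<in> ?S\<^sub>1 \<Longrightarrow> char_fun J T' (U\<^sub>1 x) = U\<^sub>2 (char_fun J T x)"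
    using assms(3) unfolding coincide_def by blast
  have U2_in: "U\<^sub>2 x \<in> ?S\<^sub>2'" if "x \<in> ?S\<^sub>2" for x using un2 that by (auto simp: unitary_op_def)
  have U2_add: "U\<^sub>2 (x + y) = U\<^sub>2 x + U\<^sub>2 y" if "x \<in> ?S\<^sub>2" "y \<in> ?S\<^sub>2" for x y
    using un2 that by (simp add: unitary_op_def bounded_op_def)
  have U2_scaleC: "U\<^sub>2 (c *\<^sub>C x) = c *\<^sub>C U\<^sub>2 x" if "x \<in> ?S\<^sub>2" for c x
    using un2 that by (simp add: unitary_op_def bounded_op_def)
  have U2_cinner: "cinner (U\<^sub>2 x) (U\<^sub>2 y) = cinner x y" if "x \<in> ?S\<^sub>2" "y \<in> ?S\<^sub>2" for x y
    using un2 that by (simp add: unitary_op_def)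
  note K_in = T.poisson_in_tensor_space and K'_in = T'.poisson_in_tensor_space
  have K'_inj: "h = h'" if "?K' h = ?K' h'" for h h'
  proof -
    have "cinner h z = cinner h' z" for z
      using arg_cong[OF that, of "\<lambda>y. cinner y (?K' z)"] by (simp add: T'.cinner_response)
    then show ?thesis by (rule cinner_ext)
  qed
  have model: "U\<^sub>2 z \<in> range ?K' \<longleftrightarrow> z \<in> range ?K" if z: "z \<in> ?S\<^sub>2" for z
  proof -
    have "U\<^sub>2 z \<in> range ?K' \<longleftrightarrow> (\<forall>x\<in>?S\<^sub>1'. cinner (U\<^sub>2 z) (char_fun J T' x) = 0)"
      by (rule T'.model_space_iff[OF U2_in[OF z]])
    also have "\<dots> \<longleftrightarrow> (\<forall>x\<in>?S\<^sub>1. cinner (U\<^sub>2 z) (char_fun J T' (U\<^sub>1 x)) = 0)"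
    proof -
      \<comment> \<open>Surjectivity of \<open>U\<^sub>1\<close> is what replaces testing against
        all inputs of T' by testing against images of inputs of T.\<close>
      have "?S\<^sub>1' = U\<^sub>1 ` ?S\<^sub>1" using un1 by (simp add: unitary_op_def)
      then show ?thesis by simp
    qed
    also have "\<dots> \<longleftrightarrow> (\<forall>x\<in>?S\<^sub>1. cinner z (char_fun J T x) = 0)"
      by (simp add: \<Theta> U2_cinner z T.char_fun_in_tensor_space)
    also have "\<dots> \<longleftrightarrow> z \<in> range ?K" by (rule T.model_space_iff[OF z, symmetric])
    finally show ?thesis .
  qed
  have "\<exists>h'. ?K' h' = U\<^sub>2 (?K h)" for h
    using model[OF K_in, of h] by (metis rangeE rangeI)
  then obtain V where V: "\<And>h. ?K' (V h) = U\<^sub>2 (?K h)" by metis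
  have K_add: "?K (h + g) = ?K h + ?K g" for h g using T.response_add[of h g 0 0] by simp
  have K'_add: "?K' (h + g) = ?K' h + ?K' g" for h g using T'.response_add[of h g 0 0] by simp
  have K_scaleC: "?K (c *\<^sub>C h) = c *\<^sub>C ?K h" for c h using T.response_scaleC[of c h 0] by simp
  have K'_scaleC: "?K' (c *\<^sub>C h) = c *\<^sub>C ?K' h" for c h using T'.response_scaleC[of c h 0] by simp
  have V_add: "V (h + g) = V h + V g" for h g
    by (rule K'_inj) (simp add: V K_add K'_add U2_add K_in)
  have V_scaleC: "V (c *\<^sub>C h) = c *\<^sub>C V h" for c h
    by (rule K'_inj) (simp add: V K_scaleC K'_scaleC U2_scaleC K_in)
  have V_cinner: "cinner (V h) (V g) = cinner h g" for h g
    using T'.cinner_response[of "V h" 0 "V g" 0] T.cinner_response[of h 0 g 0]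
    by (simp add: V U2_cinner K_in)
  have bV: "bounded_op UNIV UNIV V"
    by (rule isometry_bounded_op) (fact V_add V_scaleC V_cinner)+
  have "h' \<in> range V" for h'
  proof -
    \<comment> \<open>Surjectivity of \<open>V\<close>: pull \<open>?K' h'\<close> back through
      \<open>U\<^sub>2\<close>; the equivalence \<open>model\<close> puts the preimage in the range
      of \<open>?K\<close>.\<close>
    obtain z where z: "z \<in> ?S\<^sub>2" "U\<^sub>2 z = ?K' h'"
      using un2 K'_in[of h'] unfolding unitary_op_def by (metis imageE)
    then have "z \<in> range ?K" using model[OF z(1)] by (metis rangeI)
    then obtain h where "z = ?K h" by blast
    then have "V h = h'" using z(2) by (intro K'_inj) (simp add: V)
    then show ?thesis by blast
  qed
  then have "unitary_op UNIV UNIV V" using bV V_cinner by (auto simp: unitary_op_def)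
  moreover have "T i = adj V \<circ> T' i \<circ> V" for i
  proof (rule ext, rule cinner_ext)
    fix x y
    \<comment> \<open>The relation is established for the adjoints first, since it is these that the
      Poisson kernels turn into backward shifts.\<close>
    have "?K' (V (adj (T i) y)) = U\<^sub>2 (pull ((#) i) (?K y))" by (simp add: V T.pull_poisson)
    also have "\<dots> = pull ((#) i) (U\<^sub>2 (?K y))"
      by (rule T.unitary_multi_analytic_pull[OF _ _ _ _ ma un2 K_in]) simp_all
    also have "\<dots> = ?K' (adj (T' i) (V y))" by (simp add: V[symmetric] T'.pull_poisson)
    finally have "V (adj (T i) y) = adj (T' i) (V y)" by (rule K'_inj)
    then have "cinner x (adj (T i) y) = cinner (V x) (adj (T' i) (V y))"
      by (metis V_cinner)
    then show "cinner (T i x) y = cinner ((adj V \<circ> T' i \<circ> V) x) y"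
      by (simp add: cinner_adj[OF T.bounded_op_T] cinner_adj_left[OF bV] cinner_adj[OF T'.bounded_op_T])
  qed
  ultimately show ?thesis unfolding unitarily_equivalent_def by blast
qed

theorem theorem4p4:
  fixes J :: "('n::finite fock \<Rightarrow> 'n fock) set"
    and T :: "'n \<Rightarrow> 'h::chilbert_space \<Rightarrow> 'h"
    and T' :: "'n \<Rightarrow> 'k::chilbert_space \<Rightarrow> 'k"
  assumes "two_sided_ideal J" and "closedin wot J" and "J \<noteq> F_infty"
    and "row_contraction T" and "pure T" and "constrained J T"
    and "row_contraction T'" and "pure T'" and "constrained J T'"
  shows "unitarily_equivalent T T' \<longleftrightarrow>
    coincide J
      (defect_star_space T) (defect_space T) (char_fun J T)
      (defect_star_space T') (defect_space T') (char_fun J T')"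
proof -
  have "constrained_setup J T" "constrained_setup J T'"
    by (unfold_locales; fact)+
  then show ?thesis
    using unitarily_equivalent_imp_coincide coincide_imp_unitarily_equivalent by blast
qed

end
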